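(* Suppose that $0<\alpha<\frac12$ and $k\le c\min\{p^{\gamma},\frac{n}{\log p}\}$ for some constants $c>0$ and $0\le\gamma<\frac12$. Let $k_1\le(1-\zeta_0)k-1$ for some constant $0<\zeta_0<1$. Then for any $\theta^*=(\beta^*,\mathrm{I},\sigma)\in\Theta(k_1)$, $$\inf_{\mathrm{CI}\in\mathcal{I}_\alpha(\Theta(k),\,\beta_1)}\mathbb{E}_{\theta^*}L(\mathrm{CI})\ge c_1\Big(\frac1{\sqrt n}+k\frac{\log p}{n}\Big)\sigma$$ for some constant $c_1>0$.
   Context: Model: one observes $Z=(Z_1,\dots,Z_n)$ with $Z_i=(y_i,X_{i\cdot})\in\mathbb{R}^{p+1}$, $y=X\beta+\epsilon$, where $X\in\mathbb{R}^{n\times p}$ has i.i.d. rows $X_{i\cdot}\sim N_p(0,\Sigma)$, independent of $\epsilon\sim N_n(0,\sigma^2\mathrm{I})$; $\Sigma$ and $\sigma$ are unknown. Let $\Omega=\Sigma^{-1}$ and $\theta=(\beta,\Omega,\sigma)$; $\mathbb{P}_\theta,\mathbb{E}_\theta$ are the corresponding probability and expectation. $\mathrm{I}$ is the identity matrix. $\|x\|_0$ is the number of nonzero entries of $x$; $\beta_1$ is the first coordinate of $\beta$. Parameter space: $\Theta(k)=\{(\beta,\Omega,\sigma):\|\beta\|_0\le k,\ \frac1{M_1}\le\lambda_{\min}(\Omega)\le\lambda_{\max}(\Omega)\le M_1,\ 0<\sigma\le M_2\}$, where $M_1>1$ and $M_2>0$ are constants. Confidence intervals: for a parameter space $\Theta$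 and functional $\mathrm{T}$ of $\beta$, $\mathcal{I}_\alpha(\Theta,\mathrm{T})$ is the set of all intervals $\mathrm{CI}=[l(Z),u(Z)]$ with $\inf_{\theta\in\Theta}\mathbb{P}_\theta(l(Z)\le\mathrm{T}(\beta)\le u(Z))\ge1-\alpha$; the length is $L(\mathrm{CI})=u(Z)-l(Z)$. *)

theory Defs
  imports
    "HOL-Probability.Probability"
    "Jordan_Normal_Form.Gauss_Jordan_Elimination"
    "Jordan_Normal_Form.Spectral_Radius"
begin

(* The dimensions n and p vary inside the statement, so vectors and matrices are those of
   Jordan_Normal_Form.  Points of the sample spaces are extensional functions on {..<p} and
   {..<n}, because the product measure PiM lives there.  All indices start at 0; in
   particular the first coordinate of beta is beta $ 0. *)

unbundle no vec_syntax
no_notation inner (infix "\<bullet>" 70)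

definition l0_norm :: "real Matrix.vec \<Rightarrow> nat" where
  "l0_norm x = card {i. i < dim_vec x \<and> x $ i \<noteq> 0}"

definition lambda_min :: "real mat \<Rightarrow> real" where
  "lambda_min A = Min (spectrum A)"

definition lambda_max :: "real mat \<Rightarrow> real" where
  "lambda_max A = Max (spectrum A)"

(* Meaningful for invertible A only, where mat_inverse A is not None. *)
definition inv_mat :: "real mat \<Rightarrow> real mat" where
  "inv_mat A = the (mat_inverse A)"

(* A parameter is a triple (beta, Omega, sigma).  Omega is the inverse of a covariance matrix,
   hence symmetric; positive definiteness follows from the bound on lambda_min. *)
type_synonym param = "real Matrix.vec \<times> real mat \<times> real"

definition Theta :: "nat \<Rightarrow> real \<Rightarrow> real \<Rightarrow> nat \<Rightarrow> param set" where
  "Theta p M1 M2 k = {(\<beta>, \<Omega>, \<sigma>).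
     \<beta> \<in> carrier_vec p \<and> \<Omega> \<in> carrier_mat p p \<and> \<Omega>\<^sup>T = \<Omega> \<and>
     l0_norm \<beta> \<le> k \<and>
     1 / M1 \<le> lambda_min \<Omega> \<and> lambda_min \<Omega> \<le> lambda_max \<Omega> \<and> lambda_max \<Omega> \<le> M1 \<and>
     0 < \<sigma> \<and> \<sigma> \<le> M2}"

definition mvn_density :: "nat \<Rightarrow> real mat \<Rightarrow> (nat \<Rightarrow> real) \<Rightarrow> real" where
  "mvn_density d \<Sigma> x =
     exp (- (Matrix.vec d x \<bullet> (inv_mat \<Sigma> *\<^sub>v Matrix.vec d x)) / 2)
       / sqrt ((2 * pi) ^ d * Determinant.det \<Sigma>)"

(* The law N_d(0, Sigma), for positive definite Sigma. *)
definition mvn :: "nat \<Rightarrow> real mat \<Rightarrow> (nat \<Rightarrow> real) measure" where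
  "mvn d \<Sigma> = density (Pi\<^sub>M {..<d} (\<lambda>_. lborel)) (\<lambda>x. ennreal (mvn_density d \<Sigma> x))"

(* Z i = (y_i, row i of X) *)
type_synonym sample = "nat \<Rightarrow> real \<times> (nat \<Rightarrow> real)"

definition sample_space :: "nat \<Rightarrow> nat \<Rightarrow> sample measure" where
  "sample_space n p = Pi\<^sub>M {..<n} (\<lambda>_. borel \<Otimes>\<^sub>M Pi\<^sub>M {..<p} (\<lambda>_. borel))"

definition regression_sample ::
  "nat \<Rightarrow> nat \<Rightarrow> real Matrix.vec \<Rightarrow> (nat \<Rightarrow> nat \<Rightarrow> real) \<times> (nat \<Rightarrow> real) \<Rightarrow> sample" where
  "regression_sample n p \<beta> = (\<lambda>(X, \<epsilon>). \<lambda>i\<in>{..<n}. (Matrix.vec p (X i) \<bullet> \<beta> + \<epsilon> i, X i))"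

(* The law P_theta of Z when y = X beta + epsilon, with the rows of X i.i.d. N_p(0, Omega^-1)
   and epsilon ~ N_n(0, sigma^2 I) independent of X. *)
definition sample_law :: "nat \<Rightarrow> nat \<Rightarrow> param \<Rightarrow> sample measure" where
  "sample_law n p = (\<lambda>(\<beta>, \<Omega>, \<sigma>).
     distr (Pi\<^sub>M {..<n} (\<lambda>_. mvn p (inv_mat \<Omega>)) \<Otimes>\<^sub>M mvn n (\<sigma>\<^sup>2 \<cdot>\<^sub>m 1\<^sub>m n))
       (sample_space n p) (regression_sample n p \<beta>))"

definition conf_intervals ::
  "nat \<Rightarrow> nat \<Rightarrow> real \<Rightarrow> param set \<Rightarrow> (real Matrix.vec \<Rightarrow> real)
     \<Rightarrow> ((sample \<Rightarrow> real) \<times> (sample \<Rightarrow> real)) set" where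
  "conf_intervals n p \<alpha> \<Theta> T = {(l, u).
     l \<in> borel_measurable (sample_space n p) \<and> u \<in> borel_measurable (sample_space n p) \<and>
     (\<forall>z\<in>space (sample_space n p). l z \<le> u z) \<and>
     (INF \<theta>\<in>\<Theta>. measure (sample_law n p \<theta>)
        {z \<in> space (sample_space n p). l z \<le> T (fst \<theta>) \<and> T (fst \<theta>) \<le> u z}) \<ge> 1 - \<alpha>}"

(* E_theta L(CI).  The length is nonnegative, so the expectation always exists in [0, infinity];
   ennreal keeps infinite expected lengths infinite, whereas the Bochner integral would
   make them 0. *)
definition expected_length ::
  "nat \<Rightarrow> nat \<Rightarrow> param \<Rightarrow> (sample \<Rightarrow> real) \<times> (sample \<Rightarrow> real) \<Rightarrow> ennreal" where
  "expected_length n p \<theta> = (\<lambda>(l, u). \<integral>\<^sup>+z. ennreal (u z - l z) \<partial>sample_law n p \<theta>)"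

end

theory Submission
  imports Defs
begin

text \<open>
  An interval that covers \<open>\<beta>\<^sub>1\<close> (the component of index \<open>0\<close>) throughout \<open>\<Theta>(k)\<close> must be long at \<open>\<theta>*\<close> as soon as \<open>\<Theta>(k)\<close> contains
  parameters whose first coefficient is \<open>\<beta>*\<^sub>1 + \<delta>\<close> and whose laws, averaged over a finite family,
  are close to the law at \<open>\<theta>*\<close>: under \<open>\<theta>*\<close> the interval then contains both \<open>\<beta>*\<^sub>1\<close> and \<open>\<beta>*\<^sub>1 + \<delta>\<close>
  with probability bounded below, so its expected length is at least a constant times \<open>|\<delta>|\<close>
  (\<open>expected_length_ge\<close>).  Closeness is measured by the chi-square divergence, that is, by the
  second moment of the averaged likelihood ratio.

  All alternatives come from one construction.  At \<open>\<theta>*\<close> the normalised residual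
  \<open>u = (y - x \<beta>*) / \<sigma>\<close> and the covariates \<open>x\<^sub>0, \<dots>, x\<^sub>p\<^sub>-\<^sub>1\<close> are independent standard normal.  Fix a
  unit vector \<open>(w1, w2)\<close>, put \<open>v = w1 u + w2 x\<^sub>0\<close>, and for a set \<open>S\<close> of covariates put
  \<open>s = \<rho> (\<Sum>j\<in>S. x\<^sub>j)\<close>.  The alternative of \<open>S\<close> leaves everything unchanged except that \<open>v\<close> becomes
  correlated with \<open>s\<close>: given the \<open>x\<^sub>j\<close>, \<open>j \<in> S\<close>, it is \<open>N(s, 1 - \<rho>\<^sup>2|S|)\<close>, still with variance one.  This is
  again a Gaussian linear model.  Its residual has to be uncorrelated with \<open>x\<^sub>0\<close> and with the \<open>x\<^sub>j\<close>,
  \<open>j \<in> S\<close>, and solving for the coefficients gives \<open>\<beta>' - \<beta>* = \<sigma> (w1 / D) (\<rho> 1\<^sub>S - w2 \<rho>\<^sup>2|S| e\<^sub>0)\<close> with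
  \<open>D = 1 - w2\<^sup>2 \<rho>\<^sup>2 |S|\<close>; the covariance of the covariates becomes the identity plus one spiked row
  and column, and the noise level only decreases (\<open>row_density_eq\<close>).

  The cross moment of the likelihood ratios of \<open>S\<close> and \<open>T\<close> is \<open>1 / (1 - \<rho>\<^sup>2 |S \<inter> T|)\<close> for one row
  (\<open>nn_integral_normal_ratio_mult\<close>): integrating out the covariates outside \<open>S \<inter> T\<close> replaces both sets
  by \<open>S \<inter> T\<close>.  Two choices give the two terms of the bound.

  For \<open>1 / sqrt n\<close>: \<open>(w1, w2) = (1, 0)\<close>, \<open>S = {0}\<close> and \<open>\<rho>\<close> of order \<open>1 / sqrt n\<close>.  The single
  alternative shifts \<open>\<beta>\<^sub>1\<close> by \<open>\<sigma> \<rho>\<close> (\<open>expected_length_ge_parametric\<close>).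

  For \<open>k log p / n\<close>: \<open>w1 = w2 = 1 / sqrt 2\<close>, \<open>|S| = k - k\<^sub>1 - 1 \<ge> \<zeta>\<^sub>0 k\<close>, \<open>\<rho>\<^sup>2\<close> of order \<open>log p / n\<close>, and
  \<open>S\<close> disjoint from \<open>0\<close> and from the support of \<open>\<beta>*\<close>.  The coefficients on \<open>S\<close> move by
  order \<open>\<sigma> \<rho>\<close>; as \<open>x\<^sub>0\<close> is correlated with every \<open>x\<^sub>j\<close>, \<open>j \<in> S\<close>, \<open>\<beta>\<^sub>1\<close> has to compensate for
  all of them and moves by order \<open>\<sigma> \<rho>\<^sup>2 |S|\<close>.  The set \<open>S\<close> is
  random, with one element from each of \<open>|S|\<close> disjoint blocks of about \<open>p / |S|\<close> covariates, so that
  two independent copies of \<open>S\<close> meet in a sum of independent indicators and the averaged second moment is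
  at most \<open>exp (|S| exp (2 n \<rho>\<^sup>2) / m)\<close> for blocks of size \<open>m\<close>.  Since \<open>|S| \<le> c p powr \<gamma>\<close> with
  \<open>\<gamma> < 1/2\<close>, this tends to one as \<open>p\<close> grows when the constant in \<open>\<rho>\<^sup>2\<close> is small
  (\<open>expected_length_ge_sparse\<close>).  For bounded \<open>p\<close> the second term is at most a constant
  times the first.
\<close>

section \<open>Integrals of Gaussian exponentials\<close>

abbreviation std_normal :: "real measure" where
  "std_normal \<equiv> density lborel (\<lambda>x. ennreal (std_normal_density x))"

lemma prob_space_std_normal: "prob_space std_normal"
  by (rule prob_space_normal_density) simp

interpretation std_normals: product_sigma_finite "\<lambda>_::nat. std_normal"
  by (intro product_sigma_finite.intro prob_space_imp_sigma_finite prob_space_std_normal)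

text \<open>
  Completing the square turns the integrand into a constant times another normal density.
\<close>

lemma nn_integral_exp_square_std_normal:
  fixes \<kappa> a b :: real
  assumes m: "2 * \<kappa> * b\<^sup>2 < 1"
  shows "(\<integral>\<^sup>+x. ennreal (exp (\<kappa> * (a + b * x)\<^sup>2)) \<partial>std_normal)
    = ennreal (exp (\<kappa> * a\<^sup>2 / (1 - 2 * \<kappa> * b\<^sup>2)) / sqrt (1 - 2 * \<kappa> * b\<^sup>2))"
proof -
  define q where "q = 1 - 2 * \<kappa> * b\<^sup>2"
  have q: "0 < q" using m by (simp add: q_def)
  define \<mu> where "\<mu> = 2 * \<kappa> * a * b / q"
  have square: "\<kappa> * (a + b * x)\<^sup>2 - x\<^sup>2 / 2 = \<kappa> * a\<^sup>2 / q - (x - \<mu>)\<^sup>2 / (2 * (1 / sqrt q)\<^sup>2)" for x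
  proof -
    have qs: "(1 / sqrt q)\<^sup>2 = 1 / q" using q by (simp add: power_divide)
    have e1: "\<mu> * q = 2 * \<kappa> * a * b" using q by (simp add: \<mu>_def)
    have e2: "\<kappa> * a\<^sup>2 / q = \<kappa> * a\<^sup>2 + \<mu> * \<mu> * q / 2"
    proof -
      have "\<mu> * \<mu> * q / 2 = \<kappa> * a\<^sup>2 * (2 * \<kappa> * b\<^sup>2) / q"
        using q by (simp add: \<mu>_def field_simps power2_eq_square)
      then have "\<kappa> * a\<^sup>2 + \<mu> * \<mu> * q / 2 = \<kappa> * a\<^sup>2 * (q + 2 * \<kappa> * b\<^sup>2) / q"
        using q by (simp add: field_simps)
      then show ?thesis by (simp add: q_def)
    qed
    have rhs: "(x - \<mu>)\<^sup>2 / (2 * (1 / sqrt q)\<^sup>2) = q * x\<^sup>2 / 2 - 2 * \<kappa> * a * b * x + \<mu> * \<mu> * q / 2"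
    proof -
      have "(x - \<mu>)\<^sup>2 / (2 * (1 / sqrt q)\<^sup>2) = q * x\<^sup>2 / 2 - (\<mu> * q) * x + \<mu> * \<mu> * q / 2"
        unfolding qs by (simp add: field_simps power2_eq_square)
      also have "\<dots> = q * x\<^sup>2 / 2 - 2 * \<kappa> * a * b * x + \<mu> * \<mu> * q / 2"
        by (simp only: e1)
      finally show ?thesis .
    qed
    have lhs: "\<kappa> * (a + b * x)\<^sup>2 = \<kappa> * a\<^sup>2 + 2 * \<kappa> * a * b * x + \<kappa> * b\<^sup>2 * x\<^sup>2"
      by (simp add: power2_eq_square algebra_simps)
    have qx: "q * x\<^sup>2 / 2 = x\<^sup>2 / 2 - \<kappa> * b\<^sup>2 * x\<^sup>2"
      by (simp add: q_def field_simps)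
    show ?thesis
      unfolding e2 rhs lhs using qx by linarith
  qed
  have "(\<integral>\<^sup>+x. ennreal (exp (\<kappa> * (a + b * x)\<^sup>2)) \<partial>std_normal)
      = (\<integral>\<^sup>+x. ennreal (std_normal_density x * exp (\<kappa> * (a + b * x)\<^sup>2)) \<partial>lborel)"
    by (subst nn_integral_density) (auto simp: ennreal_mult)
  also have "\<dots> = (\<integral>\<^sup>+x. ennreal (exp (\<kappa> * a\<^sup>2 / q) / sqrt q) * ennreal (normal_density \<mu> (1 / sqrt q) x) \<partial>lborel)"
  proof (rule nn_integral_cong)
    fix x :: real
    have "std_normal_density x * exp (\<kappa> * (a + b * x)\<^sup>2)
        = 1 / sqrt (2 * pi) * exp (\<kappa> * (a + b * x)\<^sup>2 - x\<^sup>2 / 2)"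
      by (simp add: std_normal_density_def mult_exp_exp)
    also have "\<dots> = exp (\<kappa> * a\<^sup>2 / q) / sqrt q * normal_density \<mu> (1 / sqrt q) x"
    proof -
      define Z where "Z = (x - \<mu>)\<^sup>2 / (2 * (1 / sqrt q)\<^sup>2)"
      have "normal_density \<mu> (1 / sqrt q) x = sqrt q / sqrt (2 * pi) * exp (- Z)"
        using q by (simp add: normal_density_def Z_def power_divide real_sqrt_divide)
      then show ?thesis
        unfolding square Z_def[symmetric] using q by (simp add: exp_diff exp_minus divide_inverse)
    qed
    finally show "ennreal (std_normal_density x * exp (\<kappa> * (a + b * x)\<^sup>2))
        = ennreal (exp (\<kappa> * a\<^sup>2 / q) / sqrt q) * ennreal (normal_density \<mu> (1 / sqrt q) x)"
      using q by (simp add: ennreal_mult[symmetric])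
  qed
  also have "\<dots> = ennreal (exp (\<kappa> * a\<^sup>2 / q) / sqrt q) * 1"
    using q prob_space.emeasure_space_1[OF prob_space_normal_density[of "1 / sqrt q" \<mu>]]
    by (subst nn_integral_cmult) (auto simp: emeasure_density)
  finally show ?thesis by (simp add: q_def)
qed

text \<open>
  One formula for both signs of \<open>\<kappa>\<close>: a negative \<open>\<kappa>\<close> expresses that the convolution of normal
  densities is normal, a positive one is the moment generating function of a chi-square variable.
  The coefficients \<open>c i\<close> may vanish and \<open>I\<close> may be empty, so degenerate variances are included.
\<close>

lemma nn_integral_exp_square_linear_form:
  fixes \<kappa> a :: real and c :: "nat \<Rightarrow> real"
  assumes "finite I" and "2 * \<kappa> * (\<Sum>i\<in>I. (c i)\<^sup>2) < 1"
  shows "(\<integral>\<^sup>+x. ennreal (exp (\<kappa> * (a + (\<Sum>i\<in>I. c i * x i))\<^sup>2)) \<partial>(\<Pi>\<^sub>M i\<in>I. std_normal))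
    = ennreal (exp (\<kappa> * a\<^sup>2 / (1 - 2 * \<kappa> * (\<Sum>i\<in>I. (c i)\<^sup>2))) / sqrt (1 - 2 * \<kappa> * (\<Sum>i\<in>I. (c i)\<^sup>2)))"
  using assms
proof (induction I arbitrary: a rule: finite_induct)
  case empty
  show ?case by (simp add: PiM_empty nn_integral_count_space_finite)
next
  case (insert i I)
  define C where "C = (\<Sum>i\<in>I. (c i)\<^sup>2)"
  define b where "b = c i"
  have C0: "C \<ge> 0" by (simp add: C_def sum_nonneg)
  have bC: "2 * \<kappa> * (b\<^sup>2 + C) < 1" using insert by (simp add: C_def b_def)
  have sC: "2 * \<kappa> * C < 1"
  proof (cases "\<kappa> \<ge> 0")
    case True
    then have "2 * \<kappa> * C \<le> 2 * \<kappa> * (b\<^sup>2 + C)" by (intro mult_left_mono) auto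
    then show ?thesis using bC by simp
  next
    case False
    then have "2 * \<kappa> * C \<le> 0" using C0 by (simp add: mult_nonpos_nonneg)
    then show ?thesis by linarith
  qed
  define q where "q = 1 - 2 * \<kappa> * C"
  have q: "0 < q" using sC by (simp add: q_def)
  define k' where "k' = \<kappa> / q"
  have r: "1 - 2 * k' * b\<^sup>2 = (1 - 2 * \<kappa> * (b\<^sup>2 + C)) / q"
    using q by (simp add: k'_def field_simps) (simp add: q_def field_simps)
  have k'b: "2 * k' * b\<^sup>2 < 1"
    using r q bC by (smt (verit) divide_pos_pos)
  have *: "a + (\<Sum>j\<in>insert i I. c j * (x(i := y)) j) = (a + b * y) + (\<Sum>j\<in>I. c j * x j)" for x y
  proof -
    have "(\<Sum>j\<in>I. c j * (x(i := y)) j) = (\<Sum>j\<in>I. c j * x j)"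
      using insert by (intro sum.cong) auto
    then show ?thesis using insert by (simp add: b_def)
  qed
  have "(\<integral>\<^sup>+x. ennreal (exp (\<kappa> * (a + (\<Sum>i\<in>insert i I. c i * x i))\<^sup>2)) \<partial>(\<Pi>\<^sub>M i\<in>insert i I. std_normal))
      = (\<integral>\<^sup>+y. (\<integral>\<^sup>+x. ennreal (exp (\<kappa> * ((a + b * y) + (\<Sum>j\<in>I. c j * x j))\<^sup>2)) \<partial>(\<Pi>\<^sub>M i\<in>I. std_normal)) \<partial>std_normal)"
    using insert by (subst std_normals.product_nn_integral_insert_rev) (auto simp only: *, auto)
  also have "\<dots> = (\<integral>\<^sup>+y. ennreal (exp (k' * (a + b * y)\<^sup>2)) * ennreal (1 / sqrt q) \<partial>std_normal)"
    using insert.IH sC q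
    by (intro nn_integral_cong) (simp add: C_def[symmetric] q_def[symmetric] k'_def ennreal_mult[symmetric])
  also have "\<dots> = ennreal (exp (k' * a\<^sup>2 / (1 - 2 * k' * b\<^sup>2)) / sqrt (1 - 2 * k' * b\<^sup>2)) * ennreal (1 / sqrt q)"
    by (subst nn_integral_multc) (auto simp: nn_integral_exp_square_std_normal[OF k'b])
  also have "\<dots> = ennreal (exp (\<kappa> * a\<^sup>2 / (1 - 2 * \<kappa> * (b\<^sup>2 + C))) / sqrt (1 - 2 * \<kappa> * (b\<^sup>2 + C)))"
  proof -
    have "k' * a\<^sup>2 / ((1 - 2 * \<kappa> * (b\<^sup>2 + C)) / q) = \<kappa> * a\<^sup>2 / (1 - 2 * \<kappa> * (b\<^sup>2 + C))"
      using q by (simp add: k'_def)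
    then show ?thesis
      using q bC unfolding r by (simp add: ennreal_mult[symmetric] real_sqrt_divide)
  qed
  finally show ?case using insert by (simp add: C_def b_def)
qed

section \<open>Densities and product measures\<close>

lemma sigma_finite_density_real:
  fixes f :: "'a \<Rightarrow> real"
  assumes "sigma_finite_measure M" "f \<in> borel_measurable M"
  shows "sigma_finite_measure (density M (\<lambda>x. ennreal (f x)))"
  using assms by (subst sigma_finite_measure.sigma_finite_iff_density_finite) auto

lemma PiM_density:
  fixes f :: "'i \<Rightarrow> 'a \<Rightarrow> real"
  assumes I: "finite I" and M: "\<And>i. sigma_finite_measure (M i)"
    and f: "\<And>i. f i \<in> borel_measurable (M i)" and nn: "\<And>i x. 0 \<le> f i x"
  shows "(\<Pi>\<^sub>M i\<in>I. density (M i) (\<lambda>x. ennreal (f i x)))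
    = density (\<Pi>\<^sub>M i\<in>I. M i) (\<lambda>x. ennreal (\<Prod>i\<in>I. f i (x i)))"
proof -
  interpret M: product_sigma_finite M by (rule product_sigma_finite.intro[OF M])
  interpret D: product_sigma_finite "\<lambda>i. density (M i) (\<lambda>x. ennreal (f i x))"
    by (rule product_sigma_finite.intro) (rule sigma_finite_density_real[OF M f])
  note f[measurable]
  show ?thesis
  proof (rule D.PiM_eqI[symmetric, OF I])
    show "sets (density (\<Pi>\<^sub>M i\<in>I. M i) (\<lambda>x. ennreal (\<Prod>i\<in>I. f i (x i))))
        = sets (\<Pi>\<^sub>M i\<in>I. density (M i) (\<lambda>x. ennreal (f i x)))"
      by (simp cong: sets_PiM_cong)
    fix A assume "\<And>i. i \<in> I \<Longrightarrow> A i \<in> sets (density (M i) (\<lambda>x. ennreal (f i x)))"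
    then have A[measurable]: "\<And>i. i \<in> I \<Longrightarrow> A i \<in> sets (M i)" by simp
    have S: "Pi\<^sub>E I A \<in> sets (\<Pi>\<^sub>M i\<in>I. M i)" using I A by (rule sets_PiM_I_finite)
    have "emeasure (density (\<Pi>\<^sub>M i\<in>I. M i) (\<lambda>x. ennreal (\<Prod>i\<in>I. f i (x i)))) (Pi\<^sub>E I A)
        = (\<integral>\<^sup>+x. ennreal (\<Prod>i\<in>I. f i (x i)) * indicator (Pi\<^sub>E I A) x \<partial>(\<Pi>\<^sub>M i\<in>I. M i))"
      using S by (subst emeasure_density) auto
    also have "\<dots> = (\<integral>\<^sup>+x. (\<Prod>i\<in>I. ennreal (f i (x i)) * indicator (A i) (x i)) \<partial>(\<Pi>\<^sub>M i\<in>I. M i))"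
    proof (rule nn_integral_cong)
      fix x assume x: "x \<in> space (\<Pi>\<^sub>M i\<in>I. M i)"
      have "indicator (Pi\<^sub>E I A) x = (\<Prod>i\<in>I. indicator (A i) (x i) :: ennreal)"
        using x I by (auto simp: indicator_def space_PiM PiE_iff prod_zero_iff)
      then show "ennreal (\<Prod>i\<in>I. f i (x i)) * indicator (Pi\<^sub>E I A) x
          = (\<Prod>i\<in>I. ennreal (f i (x i)) * indicator (A i) (x i))"
        using nn by (simp add: prod_ennreal prod.distrib)
    qed
    also have "\<dots> = (\<Prod>i\<in>I. \<integral>\<^sup>+x. ennreal (f i x) * indicator (A i) x \<partial>M i)"
      using A by (intro M.product_nn_integral_prod[OF I]) auto
    also have "\<dots> = (\<Prod>i\<in>I. emeasure (density (M i) (\<lambda>x. ennreal (f i x))) (A i))"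
      using A by (intro prod.cong refl) (subst emeasure_density, auto)
    finally show "emeasure (density (\<Pi>\<^sub>M i\<in>I. M i) (\<lambda>x. ennreal (\<Prod>i\<in>I. f i (x i)))) (Pi\<^sub>E I A)
        = (\<Prod>i\<in>I. emeasure (density (M i) (\<lambda>x. ennreal (f i x))) (A i))" .
  qed
qed

text \<open>
  Applying \<open>h\<close> row by row to a sample of \<open>A\<close> and an independent sample of \<open>B\<close> gives a sample of the
  image of \<open>A \<Otimes>\<^sub>M B\<close>: on a box both sides factor over the rows.
\<close>

lemma distr_pair_PiM_eq_PiM_distr:
  assumes I: "finite I" and A: "sigma_finite_measure A" and B: "sigma_finite_measure B"
    and C: "sigma_finite_measure (distr (A \<Otimes>\<^sub>M B) C h)"
    and h[measurable]: "h \<in> A \<Otimes>\<^sub>M B \<rightarrow>\<^sub>M C"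
  shows "distr ((\<Pi>\<^sub>M i\<in>I. A) \<Otimes>\<^sub>M (\<Pi>\<^sub>M i\<in>I. B)) (\<Pi>\<^sub>M i\<in>I. C) (\<lambda>(x, y). \<lambda>i\<in>I. h (x i, y i))
    = (\<Pi>\<^sub>M i\<in>I. distr (A \<Otimes>\<^sub>M B) C h)" (is "distr ?P ?C ?H = _")
proof -
  interpret A: product_sigma_finite "\<lambda>_. A" by (rule product_sigma_finite.intro[OF A])
  interpret B: product_sigma_finite "\<lambda>_. B" by (rule product_sigma_finite.intro[OF B])
  have PB: "sigma_finite_measure (\<Pi>\<^sub>M i\<in>I. B)" by (rule B.sigma_finite[OF I])
  interpret D: product_sigma_finite "\<lambda>_. distr (A \<Otimes>\<^sub>M B) C h"
    by (rule product_sigma_finite.intro[OF C])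
  have H: "?H \<in> ?P \<rightarrow>\<^sub>M ?C"
    unfolding case_prod_beta by (intro measurable_restrict measurable_compose[OF _ h]) measurable
  show ?thesis
  proof (rule D.PiM_eqI[OF I])
    show "sets (distr ?P ?C ?H) = sets (\<Pi>\<^sub>M i\<in>I. distr (A \<Otimes>\<^sub>M B) C h)"
      by (simp cong: sets_PiM_cong)
    fix E assume "\<And>i. i \<in> I \<Longrightarrow> E i \<in> sets (distr (A \<Otimes>\<^sub>M B) C h)"
    then have E[measurable]: "\<And>i. i \<in> I \<Longrightarrow> E i \<in> sets C" by simp
    have S: "Pi\<^sub>E I E \<in> sets ?C" using I E by (rule sets_PiM_I_finite)
    define V where "V i = h -` E i \<inter> space (A \<Otimes>\<^sub>M B)" for i
    have V[measurable]: "i \<in> I \<Longrightarrow> V i \<in> sets (A \<Otimes>\<^sub>M B)" for i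
      unfolding V_def using h E by (rule measurable_sets)
    let ?W = "?H -` Pi\<^sub>E I E \<inter> space ?P"
    have W: "?W \<in> sets ?P" using H S by (rule measurable_sets)
    \<comment> \<open>For fixed first components the preimage of a box is a box.\<close>
    have slice: "Pair x -` ?W = Pi\<^sub>E I (\<lambda>i. Pair (x i) -` V i)" if x: "x \<in> space (\<Pi>\<^sub>M i\<in>I. A)" for x
    proof -
      have xi: "x i \<in> space A" if "i \<in> I" for i
        using x that by (auto simp: space_PiM)
      have Vi: "t \<in> Pair (x i) -` V i \<longleftrightarrow> t \<in> space B \<and> h (x i, t) \<in> E i" if "i \<in> I" for i t
        using xi[OF that] by (auto simp: V_def space_pair_measure)
      have "y \<in> Pair x -` ?W \<longleftrightarrow> y \<in> space (\<Pi>\<^sub>M i\<in>I. B) \<and> (\<forall>i\<in>I. h (x i, y i) \<in> E i)" for y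
      proof -
        have "(\<lambda>i\<in>I. h (x i, y i)) \<in> Pi\<^sub>E I E \<longleftrightarrow> (\<forall>i\<in>I. h (x i, y i) \<in> E i)"
          by (simp add: PiE_iff)
        then show ?thesis
          using x unfolding vimage_eq Int_iff space_pair_measure mem_Sigma_iff split_conv by argo
      qed
      moreover have "y \<in> Pi\<^sub>E I (\<lambda>i. Pair (x i) -` V i) \<longleftrightarrow>
          y \<in> space (\<Pi>\<^sub>M i\<in>I. B) \<and> (\<forall>i\<in>I. h (x i, y i) \<in> E i)" for y
      proof -
        have "(\<forall>i\<in>I. y i \<in> Pair (x i) -` V i) \<longleftrightarrow> (\<forall>i\<in>I. y i \<in> space B) \<and> (\<forall>i\<in>I. h (x i, y i) \<in> E i)"
          using Vi by blast
        then show ?thesis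
          unfolding PiE_iff space_PiM by argo
      qed
      ultimately show ?thesis by (simp only: Set.set_eq_iff) blast
    qed
    have "emeasure (distr ?P ?C ?H) (Pi\<^sub>E I E) = emeasure ?P ?W"
      by (rule emeasure_distr[OF H S])
    also have "\<dots> = (\<integral>\<^sup>+x. emeasure (\<Pi>\<^sub>M i\<in>I. B) (Pair x -` ?W) \<partial>(\<Pi>\<^sub>M i\<in>I. A))"
      by (rule sigma_finite_measure.emeasure_pair_measure_alt[OF PB W])
    also have "\<dots> = (\<integral>\<^sup>+x. (\<Prod>i\<in>I. emeasure B (Pair (x i) -` V i)) \<partial>(\<Pi>\<^sub>M i\<in>I. A))"
    proof (rule nn_integral_cong)
      fix x assume x: "x \<in> space (\<Pi>\<^sub>M i\<in>I. A)"
      show "emeasure (\<Pi>\<^sub>M i\<in>I. B) (Pair x -` ?W) = (\<Prod>i\<in>I. emeasure B (Pair (x i) -` V i))"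
        unfolding slice[OF x] by (rule B.emeasure_PiM[OF I sets_Pair1[OF V]])
    qed
    also have "\<dots> = (\<Prod>i\<in>I. \<integral>\<^sup>+x. emeasure B (Pair x -` V i) \<partial>A)"
      by (intro A.product_nn_integral_prod[OF I] sigma_finite_measure.measurable_emeasure_Pair[OF B] V)
    also have "\<dots> = (\<Prod>i\<in>I. emeasure (A \<Otimes>\<^sub>M B) (V i))"
      by (intro prod.cong refl sigma_finite_measure.emeasure_pair_measure_alt[OF B, symmetric] V)
    also have "\<dots> = (\<Prod>i\<in>I. emeasure (distr (A \<Otimes>\<^sub>M B) C h) (E i))"
      using h E by (intro prod.cong refl) (simp add: emeasure_distr V_def)
    finally show "emeasure (distr ?P ?C ?H) (Pi\<^sub>E I E) = (\<Prod>i\<in>I. emeasure (distr (A \<Otimes>\<^sub>M B) C h) (E i))" .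
  qed
qed

section \<open>The likelihood ratio of correlated normal variables\<close>

text \<open>
  The density of \<open>N(s, 1 - r2)\<close> at \<open>v\<close> divided by the standard normal density at \<open>v\<close>.  When \<open>s\<close> is itself
  \<open>N(0, r2)\<close>, this is the ratio between two standard normal variables \<open>v\<close> and \<open>s / sqrt r2\<close> with
  correlation \<open>sqrt r2\<close> and the same two variables without correlation.
\<close>

definition normal_ratio :: "real \<Rightarrow> real \<Rightarrow> real \<Rightarrow> real" where
  "normal_ratio r2 v s = exp (v\<^sup>2 / 2 - (v - s)\<^sup>2 / (2 * (1 - r2))) / sqrt (1 - r2)"

lemma measurable_linear_form[measurable]:
  fixes c :: "nat \<Rightarrow> real"
  assumes "U \<subseteq> I"
  shows "(\<lambda>x. \<Sum>i\<in>U. c i * x i) \<in> borel_measurable (\<Pi>\<^sub>M i\<in>I. std_normal)"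
  using assms by (intro borel_measurable_sum borel_measurable_times) (auto intro!: measurable_compose[OF measurable_component_singleton])

lemma linear_form_merge:
  fixes c :: "nat \<Rightarrow> real"
  assumes "U \<subseteq> R"
  shows "(\<Sum>i\<in>U. c i * merge R B (x, y) i) = (\<Sum>i\<in>U. c i * x i)"
  using assms by (intro sum.cong) (auto simp: merge_def)

text \<open>
  Fubini for a block \<open>B\<close> of coordinates that enters the integrand through one linear form only, as
  in all integrations below.
\<close>

lemma nn_integral_exp_square_integrate_out:
  fixes F h :: "(nat \<Rightarrow> real) \<Rightarrow> real"
  assumes fin: "finite R" "finite B" and disj: "R \<inter> B = {}"
    and F: "F \<in> borel_measurable (\<Pi>\<^sub>M i\<in>R \<union> B. std_normal)"
    and h: "h \<in> borel_measurable (\<Pi>\<^sub>M i\<in>R \<union> B. std_normal)"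
    and dep: "\<And>x y. F (merge R B (x, y)) = F x" "\<And>x y. h (merge R B (x, y)) = h x"
    and F0: "\<And>x. 0 \<le> F x"
    and m: "m = 1 - 2 * \<kappa> * (\<Sum>i\<in>B. (c i)\<^sup>2)" "0 < m" and \<kappa>': "\<kappa>' = \<kappa> / m"
  shows "(\<integral>\<^sup>+x. ennreal (F x * exp (\<kappa> * (h x + (\<Sum>i\<in>B. c i * x i))\<^sup>2)) \<partial>(\<Pi>\<^sub>M i\<in>R \<union> B. std_normal))
    = (\<integral>\<^sup>+x. ennreal (F x / sqrt m * exp (\<kappa>' * (h x)\<^sup>2)) \<partial>(\<Pi>\<^sub>M i\<in>R. std_normal))"
proof -
  note F[measurable] h[measurable]
  have B: "(\<Sum>i\<in>B. c i * merge R B (x, y) i) = (\<Sum>i\<in>B. c i * y i)" for x y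
    using disj by (intro sum.cong) (auto simp: merge_def)
  have [measurable]: "(\<lambda>x. \<Sum>i\<in>B. c i * x i) \<in> borel_measurable (\<Pi>\<^sub>M i\<in>R \<union> B. std_normal)"
    by (rule measurable_linear_form) auto
  have [measurable]: "(\<lambda>x. \<Sum>i\<in>B. c i * x i) \<in> borel_measurable (\<Pi>\<^sub>M i\<in>B. std_normal)"
    by (rule measurable_linear_form) auto
  have inner: "(\<integral>\<^sup>+y. ennreal (F x * exp (\<kappa> * (h x + (\<Sum>i\<in>B. c i * y i))\<^sup>2)) \<partial>(\<Pi>\<^sub>M i\<in>B. std_normal))
      = ennreal (F x / sqrt m * exp (\<kappa>' * (h x)\<^sup>2))" for x
  proof -
    have "2 * \<kappa> * (\<Sum>i\<in>B. (c i)\<^sup>2) < 1" using m by simp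
    from nn_integral_exp_square_linear_form[OF fin(2) this, of "h x"]
    have "(\<integral>\<^sup>+y. ennreal (exp (\<kappa> * (h x + (\<Sum>i\<in>B. c i * y i))\<^sup>2)) \<partial>(\<Pi>\<^sub>M i\<in>B. std_normal))
        = ennreal (exp (\<kappa>' * (h x)\<^sup>2) / sqrt m)"
      by (simp add: m(1)[symmetric] \<kappa>')
    then show ?thesis
      using F0[of x] m(2) by (simp add: ennreal_mult nn_integral_cmult)
        (simp add: ennreal_mult[symmetric])
  qed
  show ?thesis
    by (subst std_normals.product_nn_integral_fold[OF disj fin]) (simp_all add: dep B inner)
qed

text \<open>
  Given the coordinates in \<open>S \<inter> T\<close>, averaging the ratio of \<open>S\<close> over the remaining coordinates of \<open>S\<close> adds
  their variance \<open>\<rho>\<^sup>2 |S - T|\<close> to the conditional variance \<open>1 - \<rho>\<^sup>2 |S|\<close>, which leaves the ratio of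
  \<open>S \<inter> T\<close>; likewise for \<open>T\<close>.  What remains is the second moment of the ratio with squared correlation
  \<open>q = \<rho>\<^sup>2 |S \<inter> T|\<close>, a Gaussian integral over \<open>S \<inter> T\<close> and then over the coordinates that carry
  the weights \<open>w\<close>.  With \<open>T = {}\<close> it says that the ratio of \<open>S\<close> integrates to one.
\<close>

lemma nn_integral_normal_ratio_mult:
  fixes w :: "nat \<Rightarrow> real" and \<rho> :: real
  assumes I: "finite I" and S: "S \<subseteq> I" and T: "T \<subseteq> I"
    and w0: "\<And>i. i \<in> S \<union> T \<Longrightarrow> w i = 0" and w1: "(\<Sum>i\<in>I. (w i)\<^sup>2) = 1"
    and a1: "\<rho>\<^sup>2 * card S < 1" and b1: "\<rho>\<^sup>2 * card T < 1"
  shows "(\<integral>\<^sup>+x. ennreal (normal_ratio (\<rho>\<^sup>2 * card S) (\<Sum>i\<in>I. w i * x i) (\<Sum>i\<in>S. \<rho> * x i)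
              * normal_ratio (\<rho>\<^sup>2 * card T) (\<Sum>i\<in>I. w i * x i) (\<Sum>i\<in>T. \<rho> * x i)) \<partial>(\<Pi>\<^sub>M i\<in>I. std_normal))
    = ennreal (1 / (1 - \<rho>\<^sup>2 * card (S \<inter> T)))"
proof -
  define A where "A = S \<inter> T"
  define B where "B = S - T"
  define C where "C = T - S"
  define J where "J = I - (S \<union> T)"
  note sets = A_def B_def C_def J_def
  have fin: "finite A" "finite B" "finite C" "finite J"
    using I S T by (auto simp: sets intro: finite_subset)
  have un: "((J \<union> A) \<union> C) \<union> B = I" "A \<union> B = S" "A \<union> C = T"
    using S T by (auto simp: sets)
  have disj: "A \<inter> B = {}" "A \<inter> C = {}" "J \<inter> A = {}" "(J \<union> A) \<inter> C = {}" "(J \<union> A \<union> C) \<inter> B = {}"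
    by (auto simp: sets)
  define a where "a = \<rho>\<^sup>2 * card S"
  define b where "b = \<rho>\<^sup>2 * card T"
  define q where "q = \<rho>\<^sup>2 * card A"
  have cS: "card S = card A + card B" and cT: "card T = card A + card C"
    using card_Un_disjoint[OF fin(1,2) disj(1)] card_Un_disjoint[OF fin(1,3) disj(2)] un by auto
  have aq: "a = q + \<rho>\<^sup>2 * card B" and bq: "b = q + \<rho>\<^sup>2 * card C"
    by (simp_all add: a_def b_def q_def cS cT algebra_simps)
  have lt: "a < 1" "b < 1" "q < 1" and q0: "0 \<le> q"
    using a1 b1 aq by (simp_all add: a_def b_def q_def) (smt (verit) mult_nonneg_nonneg of_nat_0_le_iff zero_le_power2)
  define v where "v x = (\<Sum>i\<in>J. w i * x i)" for x :: "nat \<Rightarrow> real"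
  define t where "t x = (\<Sum>i\<in>A. (- \<rho>) * x i)" for x :: "nat \<Rightarrow> real"
  have wJ: "(\<Sum>i\<in>J. (w i)\<^sup>2) = 1"
    using w1 I w0 by (subst sum.mono_neutral_left[of I J]) (auto simp: J_def)
  have vI: "(\<Sum>i\<in>I. w i * x i) = v x" for x
    using I w0 unfolding v_def by (intro sum.mono_neutral_right) (auto simp: J_def)
  have sS: "(\<Sum>i\<in>S. \<rho> * x i) = - (t x + (\<Sum>i\<in>B. (- \<rho>) * x i))" for x
    using fin disj by (simp add: un(2)[symmetric] sum.union_disjoint t_def sum_negf)
  have sT: "(\<Sum>i\<in>T. \<rho> * x i) = - (t x + (\<Sum>i\<in>C. (- \<rho>) * x i))" for x
    using fin disj by (simp add: un(3)[symmetric] sum.union_disjoint t_def sum_negf)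
  have vm: "v \<in> borel_measurable (\<Pi>\<^sub>M i\<in>K. std_normal)" if "J \<subseteq> K" for K
    unfolding v_def using that by (rule measurable_linear_form)
  have tm: "t \<in> borel_measurable (\<Pi>\<^sub>M i\<in>K. std_normal)" if "A \<subseteq> K" for K
    unfolding t_def using that by (rule measurable_linear_form)
  have Cm: "(\<lambda>x. \<Sum>i\<in>C. (- \<rho>) * x i) \<in> borel_measurable (\<Pi>\<^sub>M i\<in>K. std_normal)" if "C \<subseteq> K" for K
    using that by (rule measurable_linear_form)
  have sumB: "(\<Sum>i\<in>B. (- \<rho>)\<^sup>2) = a - q" and sumC: "(\<Sum>i\<in>C. (- \<rho>)\<^sup>2) = b - q"
    by (simp_all add: aq bq)
  \<comment> \<open>Exponents before and after the integrations over \<open>B\<close> and \<open>C\<close>; both end at \<open>kq\<close>, the exponent for \<open>S \<inter> T\<close>.\<close>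
  define ka where "ka = - 1 / (2 * (1 - a))"
  define kb where "kb = - 1 / (2 * (1 - b))"
  define kq where "kq = - 1 / (2 * (1 - q))"
  define ma where "ma = (1 - q) / (1 - a)"
  define mb where "mb = (1 - q) / (1 - b)"
  have m: "ma = 1 - 2 * ka * (\<Sum>i\<in>B. (- \<rho>)\<^sup>2)" "0 < ma" "kq = ka / ma"
    "mb = 1 - 2 * kb * (\<Sum>i\<in>C. (- \<rho>)\<^sup>2)" "0 < mb" "kq = kb / mb"
    using lt unfolding sumB sumC by (simp_all add: ma_def mb_def ka_def kb_def kq_def divide_simps) (simp_all add: algebra_simps)?
  define m3 where "m3 = (1 + q) / (1 - q)"
  have m3: "m3 = 1 - 2 * (2 * kq) * (\<Sum>i\<in>A. (- \<rho>)\<^sup>2)" "0 < m3" "- 1 / (1 + q) = (2 * kq) / m3"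
    using lt q0 by (simp_all add: m3_def kq_def field_simps) (simp_all add: q_def)
  define m4 where "m4 = (1 - q) / (1 + q)"
  have m4: "m4 = 1 - 2 * (q / (1 + q)) * (\<Sum>i\<in>J. (w i)\<^sup>2)" "0 < m4"
    using lt q0 by (simp_all add: m4_def wJ field_simps)
  define N where "N = 1 / (sqrt (1 - a) * sqrt (1 - b))"
  have N0: "0 \<le> N" using lt by (simp add: N_def)
  have "(\<integral>\<^sup>+x. ennreal (normal_ratio a (\<Sum>i\<in>I. w i * x i) (\<Sum>i\<in>S. \<rho> * x i)
              * normal_ratio b (\<Sum>i\<in>I. w i * x i) (\<Sum>i\<in>T. \<rho> * x i)) \<partial>(\<Pi>\<^sub>M i\<in>I. std_normal))
    = (\<integral>\<^sup>+x. ennreal ((N * exp ((v x)\<^sup>2) * exp (kb * (v x + t x + (\<Sum>i\<in>C. (- \<rho>) * x i))\<^sup>2))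
        * exp (ka * (v x + t x + (\<Sum>i\<in>B. (- \<rho>) * x i))\<^sup>2)) \<partial>(\<Pi>\<^sub>M i\<in>J \<union> A \<union> C \<union> B. std_normal))"
    unfolding un(1)
  proof (rule nn_integral_cong, rule arg_cong[where f = ennreal])
    fix x :: "nat \<Rightarrow> real"
    define yB where "yB = v x + t x + (\<Sum>i\<in>B. (- \<rho>) * x i)"
    define yC where "yC = v x + t x + (\<Sum>i\<in>C. (- \<rho>) * x i)"
    have 1: "normal_ratio a (v x) (\<Sum>i\<in>S. \<rho> * x i) = exp ((v x)\<^sup>2 / 2) * exp (ka * yB\<^sup>2) / sqrt (1 - a)"
      unfolding normal_ratio_def sS yB_def ka_def by (simp add: mult_exp_exp algebra_simps)
    have 2: "normal_ratio b (v x) (\<Sum>i\<in>T. \<rho> * x i) = exp ((v x)\<^sup>2 / 2) * exp (kb * yC\<^sup>2) / sqrt (1 - b)"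
      unfolding normal_ratio_def sT yC_def kb_def by (simp add: mult_exp_exp algebra_simps)
    have 3: "exp ((v x)\<^sup>2) = exp ((v x)\<^sup>2 / 2) * exp ((v x)\<^sup>2 / 2)"
      by (simp add: mult_exp_exp)
    show "normal_ratio a (\<Sum>i\<in>I. w i * x i) (\<Sum>i\<in>S. \<rho> * x i) * normal_ratio b (\<Sum>i\<in>I. w i * x i) (\<Sum>i\<in>T. \<rho> * x i)
      = (N * exp ((v x)\<^sup>2) * exp (kb * (v x + t x + (\<Sum>i\<in>C. (- \<rho>) * x i))\<^sup>2))
        * exp (ka * (v x + t x + (\<Sum>i\<in>B. (- \<rho>) * x i))\<^sup>2)"
      unfolding vI 1 2 3 yB_def[symmetric] yC_def[symmetric] N_def by simp
  qed
  also have "\<dots> = (\<integral>\<^sup>+x. ennreal (N * exp ((v x)\<^sup>2) * exp (kb * (v x + t x + (\<Sum>i\<in>C. (- \<rho>) * x i))\<^sup>2)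
        / sqrt ma * exp (kq * (v x + t x)\<^sup>2)) \<partial>(\<Pi>\<^sub>M i\<in>J \<union> A \<union> C. std_normal))"
    using fin N0 disj
    by (intro nn_integral_exp_square_integrate_out m)
      (auto intro!: borel_measurable_times borel_measurable_exp borel_measurable_add borel_measurable_power vm tm Cm
        simp: v_def t_def linear_form_merge simp del: mult_minus_left)
  also have "\<dots> = (\<integral>\<^sup>+x. ennreal ((N / sqrt ma * exp ((v x)\<^sup>2) * exp (kq * (v x + t x)\<^sup>2))
        * exp (kb * (v x + t x + (\<Sum>i\<in>C. (- \<rho>) * x i))\<^sup>2)) \<partial>(\<Pi>\<^sub>M i\<in>J \<union> A \<union> C. std_normal))"
    by (simp add: ac_simps)
  also have "\<dots> = (\<integral>\<^sup>+x. ennreal ((N / sqrt ma * exp ((v x)\<^sup>2) * exp (kq * (v x + t x)\<^sup>2))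
        / sqrt mb * exp (kq * (v x + t x)\<^sup>2)) \<partial>(\<Pi>\<^sub>M i\<in>J \<union> A. std_normal))"
    using fin N0 disj m(2)
    by (intro nn_integral_exp_square_integrate_out m)
      (auto intro!: borel_measurable_times borel_measurable_exp borel_measurable_add borel_measurable_power vm tm Cm
        simp: v_def t_def linear_form_merge simp del: mult_minus_left)
  also have "\<dots> = (\<integral>\<^sup>+x. ennreal ((N / sqrt ma / sqrt mb * exp ((v x)\<^sup>2))
        * exp (2 * kq * (v x + (\<Sum>i\<in>A. (- \<rho>) * x i))\<^sup>2)) \<partial>(\<Pi>\<^sub>M i\<in>J \<union> A. std_normal))"
    by (simp add: t_def mult_exp_exp ac_simps)
  also have "\<dots> = (\<integral>\<^sup>+x. ennreal ((N / sqrt ma / sqrt mb * exp ((v x)\<^sup>2))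
        / sqrt m3 * exp (- 1 / (1 + q) * (v x)\<^sup>2)) \<partial>(\<Pi>\<^sub>M i\<in>J. std_normal))"
    using fin N0 disj m
    by (intro nn_integral_exp_square_integrate_out m3)
      (auto intro!: borel_measurable_times borel_measurable_exp borel_measurable_add borel_measurable_power vm tm Cm
        simp: v_def linear_form_merge simp del: mult_minus_left)
  also have "\<dots> = (\<integral>\<^sup>+x. ennreal (N / sqrt ma / sqrt mb / sqrt m3)
        * ennreal (exp (q / (1 + q) * (0 + (\<Sum>i\<in>J. w i * x i))\<^sup>2)) \<partial>(\<Pi>\<^sub>M i\<in>J. std_normal))"
  proof (rule nn_integral_cong)
    fix x :: "nat \<Rightarrow> real"
    have "exp ((v x)\<^sup>2) * exp (- 1 / (1 + q) * (v x)\<^sup>2) = exp (q / (1 + q) * (v x)\<^sup>2)"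
    proof -
      have "(v x)\<^sup>2 + - 1 / (1 + q) * (v x)\<^sup>2 = q / (1 + q) * (v x)\<^sup>2"
        using q0 by (simp add: field_simps)
      then show ?thesis by (simp add: mult_exp_exp)
    qed
    then show "ennreal (N / sqrt ma / sqrt mb * exp ((v x)\<^sup>2) / sqrt m3 * exp (- 1 / (1 + q) * (v x)\<^sup>2))
      = ennreal (N / sqrt ma / sqrt mb / sqrt m3) * ennreal (exp (q / (1 + q) * (0 + (\<Sum>i\<in>J. w i * x i))\<^sup>2))"
      using N0 m(2,5) m3(2) by (simp add: v_def[symmetric] ennreal_mult[symmetric])
  qed
  also have "\<dots> = ennreal (N / sqrt ma / sqrt mb / sqrt m3) * ennreal (1 / sqrt m4)"
  proof -
    have 1: "2 * (q / (1 + q)) * (\<Sum>i\<in>J. (w i)\<^sup>2) < 1" using m4 by simp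
    have [measurable]: "(\<lambda>x. \<Sum>i\<in>J. w i * x i) \<in> borel_measurable (\<Pi>\<^sub>M i\<in>J. std_normal)"
      by (rule measurable_linear_form) simp
    show ?thesis
      using nn_integral_exp_square_linear_form[OF fin(4) 1, of 0]
      by (subst nn_integral_cmult) (simp_all add: m4(1) wJ)
  qed
  also have "\<dots> = ennreal (1 / (1 - q))"
  proof -
    have "N / sqrt ma / sqrt mb / sqrt m3 * (1 / sqrt m4) = 1 / (1 - q)"
      using lt q0 by (simp add: N_def ma_def mb_def m3_def m4_def real_sqrt_divide field_simps)
    then show ?thesis
      using N0 m m3 m4 by (simp add: ennreal_mult[symmetric])
  qed
  finally show ?thesis by (simp add: a_def b_def q_def A_def)
qed

section \<open>From a mixture of alternatives to the length of a confidence interval\<close>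

text \<open>
  The mixture of the densities \<open>L f\<close> gives \<open>A\<close> at least \<open>1 - \<alpha>\<close>, and its density has variance at most
  \<open>\<eta>\<^sup>2\<close>, so \<open>M\<close> cannot give \<open>A\<close> less than \<open>1 - \<alpha> - \<eta>\<close>.
\<close>

lemma measure_ge_of_mixture_chi_square:
  fixes L :: "'f \<Rightarrow> 'a \<Rightarrow> real" and c :: "'f \<Rightarrow> 'f \<Rightarrow> real"
  assumes M: "prob_space M" and F: "finite F" "F \<noteq> {}"
    and L[measurable]: "\<And>f. f \<in> F \<Longrightarrow> L f \<in> borel_measurable M" and L0: "\<And>f x. 0 \<le> L f x"
    and L1: "\<And>f. f \<in> F \<Longrightarrow> (\<integral>\<^sup>+x. ennreal (L f x) \<partial>M) = 1"
    and L2: "\<And>f g. f \<in> F \<Longrightarrow> g \<in> F \<Longrightarrow> (\<integral>\<^sup>+x. ennreal (L f x * L g x) \<partial>M) = ennreal (c f g)"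
    and c0: "\<And>f g. 0 \<le> c f g"
    and chi: "(\<Sum>f\<in>F. \<Sum>g\<in>F. c f g) \<le> (real (card F))\<^sup>2 * (1 + \<eta>\<^sup>2)" and \<eta>: "0 < \<eta>"
    and A[measurable]: "A \<in> sets M"
    and PA: "\<And>f. f \<in> F \<Longrightarrow> 1 - \<alpha> \<le> measure (density M (\<lambda>x. ennreal (L f x))) A"
  shows "1 - \<alpha> - \<eta> \<le> measure M A"
proof -
  interpret M: prob_space M by (rule M)
  define N where "N = real (card F)"
  have N: "0 < N" using F by (simp add: N_def card_gt_0_iff)
  define Lb where "Lb x = (\<Sum>f\<in>F. L f x) / N" for x
  have [measurable]: "Lb \<in> borel_measurable M" unfolding Lb_def by measurable
  have iL: "integrable M (L f)" "integral\<^sup>L M (L f) = 1" if "f \<in> F" for f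
    using nn_integral_eq_integrable[of "L f" M 1] L[OF that] L0 L1[OF that] by auto
  have iLL: "integrable M (\<lambda>x. L f x * L g x)" "(\<integral>x. L f x * L g x \<partial>M) = c f g" if "f \<in> F" "g \<in> F" for f g
    using nn_integral_eq_integrable[of "\<lambda>x. L f x * L g x" M "c f g"] L[OF that(1)] L[OF that(2)] L0 L2[OF that] c0
    by auto
  have iLb: "integrable M Lb" "integral\<^sup>L M Lb = 1"
    using iL N by (auto simp: Lb_def[abs_def] N_def)
  have sq: "(Lb x)\<^sup>2 = (\<Sum>f\<in>F. \<Sum>g\<in>F. L f x * L g x) / N\<^sup>2" for x
    by (simp add: Lb_def power_divide) (simp add: power2_eq_square sum_product)
  have iLb2: "integrable M (\<lambda>x. (Lb x)\<^sup>2)"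
    unfolding sq using iLL by (intro integrable_divide Bochner_Integration.integrable_sum) auto
  have "(\<integral>x. (Lb x)\<^sup>2 \<partial>M) = (\<Sum>f\<in>F. \<Sum>g\<in>F. c f g) / N\<^sup>2"
    unfolding sq using iLL by (simp add: Bochner_Integration.integral_sum)
  also have "\<dots> \<le> 1 + \<eta>\<^sup>2"
    using chi N by (simp add: N_def field_simps)
  finally have Lb2: "(\<integral>x. (Lb x)\<^sup>2 \<partial>M) \<le> 1 + \<eta>\<^sup>2" .
  have iA: "integrable M (\<lambda>x. L f x * indicator A x)" if "f \<in> F" for f
    using iL(1)[OF that] by (rule integrable_real_mult_indicator[rotated]) simp
  have mA: "measure (density M (\<lambda>x. ennreal (L f x))) A = (\<integral>x. L f x * indicator A x \<partial>M)" if "f \<in> F" for f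
  proof -
    have "emeasure (density M (\<lambda>x. ennreal (L f x))) A = (\<integral>\<^sup>+x. ennreal (L f x * indicator A x) \<partial>M)"
      using L[OF that] L0 by (subst emeasure_density) (auto intro!: nn_integral_cong split: split_indicator)
    also have "\<dots> = ennreal (\<integral>x. L f x * indicator A x \<partial>M)"
      using iA[OF that] L0 by (intro nn_integral_eq_integral) auto
    finally show ?thesis
      using L0 by (simp add: measure_def integral_nonneg_AE)
  qed
  have iLbA: "integrable M (\<lambda>x. Lb x * indicator A x)"
    using iLb(1) by (rule integrable_real_mult_indicator[rotated]) simp
  have "(\<Sum>f\<in>F. 1 - \<alpha>) \<le> (\<Sum>f\<in>F. \<integral>x. L f x * indicator A x \<partial>M)"
    using PA mA by (intro sum_mono) auto
  also have "\<dots> = (\<integral>x. N * (Lb x * indicator A x) \<partial>M)"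
    using iA N by (subst Bochner_Integration.integral_sum[symmetric])
      (auto simp: Lb_def sum_distrib_right)
  finally have LbA: "1 - \<alpha> \<le> (\<integral>x. Lb x * indicator A x \<partial>M)"
    using N by (simp add: N_def)
  have iI: "integrable M (indicator A :: 'a \<Rightarrow> real)"
    by (intro integrable_real_indicator A) (simp add: M.emeasure_eq_measure)
  have "(\<integral>x. Lb x * indicator A x \<partial>M) - measure M A = (\<integral>x. Lb x * indicator A x - indicator A x \<partial>M)"
    using iLbA iI by (subst Bochner_Integration.integral_diff) auto
  also have "\<dots> \<le> (\<integral>x. ((Lb x)\<^sup>2 - 2 * Lb x + 1) / (2 * \<eta>) + \<eta> / 2 \<partial>M)"
  proof (rule integral_mono)
    show "integrable M (\<lambda>x. Lb x * indicator A x - indicator A x)"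
      using iLbA iI by (rule Bochner_Integration.integrable_diff)
    show "integrable M (\<lambda>x. ((Lb x)\<^sup>2 - 2 * Lb x + 1) / (2 * \<eta>) + \<eta> / 2)"
      using iLb iLb2 by auto
    fix x
    \<comment> \<open>Pointwise form of the Cauchy-Schwarz inequality: \<open>t \<le> t\<^sup>2 / (2 \<eta>) + \<eta> / 2\<close> for \<open>t = Lb x - 1\<close>.\<close>
    have "0 \<le> (Lb x - 1 - \<eta>)\<^sup>2 / (2 * \<eta>)" "0 \<le> (Lb x - 1)\<^sup>2 / (2 * \<eta>)"
      using \<eta> by auto
    moreover have "(Lb x - 1 - \<eta>)\<^sup>2 / (2 * \<eta>) = ((Lb x)\<^sup>2 - 2 * Lb x + 1) / (2 * \<eta>) + \<eta> / 2 - (Lb x - 1)"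
      "(Lb x - 1)\<^sup>2 / (2 * \<eta>) = ((Lb x)\<^sup>2 - 2 * Lb x + 1) / (2 * \<eta>)"
      using \<eta> by (simp_all add: field_simps power2_eq_square)
    ultimately show "Lb x * indicator A x - indicator A x \<le> ((Lb x)\<^sup>2 - 2 * Lb x + 1) / (2 * \<eta>) + \<eta> / 2"
      using \<eta> by (auto split: split_indicator)
  qed
  also have "\<dots> = ((\<integral>x. (Lb x)\<^sup>2 \<partial>M) - 1) / (2 * \<eta>) + \<eta> / 2"
    using iLb iLb2 by (simp add: M.prob_space)
  also have "\<dots> \<le> \<eta>\<^sup>2 / (2 * \<eta>) + \<eta> / 2"
    using Lb2 \<eta> by (intro add_right_mono divide_right_mono) auto
  also have "\<dots> = \<eta>" using \<eta> by (simp add: power2_eq_square)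
  finally show ?thesis using LbA by simp
qed

text \<open>
  All alternatives must share the value \<open>t1\<close> of the functional, so that one and the same event
  \<open>l \<le> t1 \<le> u\<close> has large probability under each of them, hence under their mixture and under \<open>\<theta>0\<close>.
\<close>

lemma expected_length_ge:
  fixes L :: "'f \<Rightarrow> sample \<Rightarrow> real" and c :: "'f \<Rightarrow> 'f \<Rightarrow> real" and T :: "real Matrix.vec \<Rightarrow> real"
  assumes CI: "CI \<in> conf_intervals n p \<alpha> \<Theta> T"
    and prob0: "prob_space (sample_law n p \<theta>0)" and \<theta>0: "\<theta>0 \<in> \<Theta>"
    and F: "finite F" "F \<noteq> {}" and \<theta>: "\<And>f. f \<in> F \<Longrightarrow> \<theta> f \<in> \<Theta>"
    and t: "\<And>f. f \<in> F \<Longrightarrow> T (fst (\<theta> f)) = t1"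
    and L: "\<And>f. f \<in> F \<Longrightarrow> L f \<in> borel_measurable (sample_space n p)" and L0: "\<And>f x. 0 \<le> L f x"
    and law: "\<And>f. f \<in> F \<Longrightarrow> sample_law n p (\<theta> f) = density (sample_law n p \<theta>0) (\<lambda>z. ennreal (L f z))"
    and L1: "\<And>f. f \<in> F \<Longrightarrow> (\<integral>\<^sup>+z. ennreal (L f z) \<partial>sample_law n p \<theta>0) = 1"
    and L2: "\<And>f g. f \<in> F \<Longrightarrow> g \<in> F \<Longrightarrow> (\<integral>\<^sup>+z. ennreal (L f z * L g z) \<partial>sample_law n p \<theta>0) = ennreal (c f g)"
    and c0: "\<And>f g. 0 \<le> c f g"
    and chi: "(\<Sum>f\<in>F. \<Sum>g\<in>F. c f g) \<le> (real (card F))\<^sup>2 * (1 + \<eta>\<^sup>2)" and \<eta>: "0 < \<eta>"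
  shows "ennreal (\<bar>t1 - T (fst \<theta>0)\<bar> * (1 - 2 * \<alpha> - \<eta>)) \<le> expected_length n p \<theta>0 CI"
proof -
  obtain l u where lu: "CI = (l, u)" by (cases CI)
  let ?S = "sample_space n p"
  let ?P = "sample_law n p \<theta>0"
  have lm[measurable]: "l \<in> borel_measurable ?S" and um[measurable]: "u \<in> borel_measurable ?S"
    and le: "\<And>z. z \<in> space ?S \<Longrightarrow> l z \<le> u z"
    and cov: "1 - \<alpha> \<le> (INF \<theta>\<in>\<Theta>. measure (sample_law n p \<theta>) {z \<in> space ?S. l z \<le> T (fst \<theta>) \<and> T (fst \<theta>) \<le> u z})"
    using CI by (auto simp: conf_intervals_def lu)
  interpret P: prob_space ?P by (rule prob0)
  have sets: "sets (sample_law n p \<theta>) = sets ?S" for \<theta>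
    by (cases \<theta>) (simp add: sample_law_def)
  have space: "space (sample_law n p \<theta>) = space ?S" for \<theta>
    by (rule sets_eq_imp_space_eq[OF sets])
  define A where "A t = {z \<in> space ?S. l z \<le> t \<and> t \<le> u z}" for t
  have A[measurable]: "A t \<in> sets ?S" for t unfolding A_def by measurable
  have AP: "A t \<in> sets ?P" for t using A sets by simp
  have cover: "1 - \<alpha> \<le> measure (sample_law n p \<theta>) (A (T (fst \<theta>)))" if "\<theta> \<in> \<Theta>" for \<theta>
  proof -
    have "bdd_below ((\<lambda>\<theta>. measure (sample_law n p \<theta>) (A (T (fst \<theta>)))) ` \<Theta>)"
      by (intro bdd_belowI2[of _ 0]) simp
    from cINF_lower[OF this that] show ?thesis using cov by (simp add: A_def)
  qed
  define t0 where "t0 = T (fst \<theta>0)"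
  have P0: "1 - \<alpha> \<le> measure ?P (A t0)" using cover[OF \<theta>0] by (simp add: t0_def)
  have P1: "1 - \<alpha> - \<eta> \<le> measure ?P (A t1)"
  proof (rule measure_ge_of_mixture_chi_square[OF prob0 F _ L0 L1 L2 c0 chi \<eta> AP])
    show "L f \<in> borel_measurable ?P" if "f \<in> F" for f
      using L[OF that] by (simp cong: measurable_cong_sets add: sets)
    show "1 - \<alpha> \<le> measure (density ?P (\<lambda>x. ennreal (L f x))) (A t1)" if "f \<in> F" for f
      using cover[OF \<theta>[OF that]] law[OF that] t[OF that] by simp
  qed auto
  have "measure ?P (A t0) + measure ?P (A t1) = measure ?P (A t0 \<union> A t1) + measure ?P (A t0 \<inter> A t1)"
    using measure_Un3[of "A t0" ?P "A t1"] AP P.fmeasurable_eq_sets by simp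
  then have P2: "1 - 2 * \<alpha> - \<eta> \<le> measure ?P (A t0 \<inter> A t1)"
    using P0 P1 P.prob_le_1[of "A t0 \<union> A t1"] by linarith
  have "ennreal (\<bar>t1 - t0\<bar> * (1 - 2 * \<alpha> - \<eta>)) \<le> ennreal (\<bar>t1 - t0\<bar> * measure ?P (A t0 \<inter> A t1))"
    using P2 by (intro ennreal_leI mult_left_mono) auto
  also have "\<dots> = (\<integral>\<^sup>+z. ennreal \<bar>t1 - t0\<bar> * indicator (A t0 \<inter> A t1) z \<partial>?P)"
    using AP by (subst nn_integral_cmult_indicator) (auto simp: P.emeasure_eq_measure ennreal_mult)
  also have "\<dots> \<le> (\<integral>\<^sup>+z. ennreal (u z - l z) \<partial>?P)"
    by (intro nn_integral_mono) (auto simp: A_def le space split: split_indicator intro!: ennreal_leI)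
  finally show ?thesis by (simp add: expected_length_def lu t0_def)
qed

section \<open>Spiked covariance matrices\<close>

text \<open>
  The covariance of covariates that are standard normal and independent except that coordinate \<open>0\<close>
  has covariance \<open>d j\<close> with coordinate \<open>j\<close>; this reading needs \<open>d 0 = 0\<close>.
\<close>

definition spiked_cov :: "nat \<Rightarrow> (nat \<Rightarrow> real) \<Rightarrow> real mat" where
  "spiked_cov p d = mat p p (\<lambda>(i, j). of_bool (i = j) + of_bool (i = 0) * d j + of_bool (j = 0) * d i)"

text \<open>
  The inverse of \<open>spiked_cov p d\<close> is \<open>I - e\<^sub>0 e\<^sub>0\<^sup>T + (e\<^sub>0 - d) (e\<^sub>0 - d)\<^sup>T / D\<close>, where \<open>D = 1 - |d|\<^sup>2\<close> is the conditional
  variance of coordinate \<open>0\<close> given the others.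
\<close>

definition spiked_prec :: "nat \<Rightarrow> (nat \<Rightarrow> real) \<Rightarrow> real mat" where
  "spiked_prec p d = mat p p (\<lambda>(i, j). of_bool (i = j) - of_bool (i = 0) * of_bool (j = 0)
     + (of_bool (i = 0) - d i) * (of_bool (j = 0) - d j) / (1 - (\<Sum>k<p. (d k)\<^sup>2)))"

lemma sum_of_bool_mult:
  fixes g :: "nat \<Rightarrow> real"
  assumes "i < p"
  shows "(\<Sum>k<p. of_bool (k = i) * g k) = g i" "(\<Sum>k<p. of_bool (i = k) * g k) = g i"
proof -
  show *: "(\<Sum>k<p. of_bool (k = i) * g k) = g i"
    using assms by (simp add: of_bool_def if_distrib[of "\<lambda>x. x * _"] cong: if_cong)
  show "(\<Sum>k<p. of_bool (i = k) * g k) = g i"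
    using * by (simp only: eq_commute[of i])
qed

lemma spiked_cov_mult:
  assumes "i < p" and "0 < p"
  shows "(\<Sum>k<p. spiked_cov p d $$ (i, k) * g k) = g i + of_bool (i = 0) * (\<Sum>k<p. d k * g k) + d i * g 0"
proof -
  have "(\<Sum>k<p. spiked_cov p d $$ (i, k) * g k)
      = (\<Sum>k<p. of_bool (i = k) * g k + of_bool (i = 0) * (d k * g k) + d i * (of_bool (k = 0) * g k))"
    using assms by (intro sum.cong) (auto simp: spiked_cov_def algebra_simps)
  then show ?thesis
    using assms by (simp add: sum.distrib sum_distrib_left[symmetric] sum_of_bool_mult del: of_bool_eq_iff)
qed

lemma spiked_prec_mult:
  assumes "i < p" and "0 < p"
  shows "(\<Sum>k<p. spiked_prec p d $$ (i, k) * g k) = g i - of_bool (i = 0) * g 0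
    + (of_bool (i = 0) - d i) * (g 0 - (\<Sum>k<p. d k * g k)) / (1 - (\<Sum>k<p. (d k)\<^sup>2))"
proof -
  define D where "D = 1 - (\<Sum>k<p. (d k)\<^sup>2)"
  have "(\<Sum>k<p. spiked_prec p d $$ (i, k) * g k)
      = (\<Sum>k<p. of_bool (i = k) * g k - of_bool (i = 0) * (of_bool (k = 0) * g k)
          + (of_bool (i = 0) - d i) / D * (of_bool (k = 0) * g k - d k * g k))"
    using assms by (intro sum.cong) (auto simp: spiked_prec_def D_def[symmetric] algebra_simps diff_divide_distrib add_divide_distrib)
  also have "\<dots> = g i - of_bool (i = 0) * g 0 + (of_bool (i = 0) - d i) / D * (g 0 - (\<Sum>k<p. d k * g k))"
    using assms by (simp only: sum.distrib sum_subtractf sum_distrib_left[symmetric] sum_of_bool_mult)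
  finally show ?thesis by (simp add: D_def)
qed

lemma spiked_carrier[simp]:
  "spiked_cov p d \<in> carrier_mat p p" "spiked_prec p d \<in> carrier_mat p p"
  "dim_row (spiked_cov p d) = p" "dim_col (spiked_cov p d) = p"
  "dim_row (spiked_prec p d) = p" "dim_col (spiked_prec p d) = p"
  by (auto simp: spiked_cov_def spiked_prec_def)

lemma spiked_cov_mult_prec:
  assumes p: "0 < p" and d0: "d 0 = 0" and R: "(\<Sum>k<p. (d k)\<^sup>2) < 1"
  shows "spiked_cov p d * spiked_prec p d = 1\<^sub>m p"
proof (rule eq_matI)
  fix i j assume "i < dim_row (1\<^sub>m p :: real mat)" "j < dim_col (1\<^sub>m p :: real mat)"
  then have ij: "i < p" "j < p" by auto
  define R where "R = (\<Sum>k<p. (d k)\<^sup>2)"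
  define e where "e = (of_bool (j = 0) - d j) / (1 - R)"
  have sumg: "(\<Sum>k<p. d k * spiked_prec p d $$ (k, j)) = d j - R * e"
  proof -
    have "(\<Sum>k<p. d k * spiked_prec p d $$ (k, j))
        = (\<Sum>k<p. of_bool (k = j) * d k - of_bool (j = 0) * (of_bool (k = 0) * d k)
            + e * (of_bool (k = 0) * d k - (d k)\<^sup>2))"
    proof (rule sum.cong[OF refl])
      fix k assume "k \<in> {..<p}"
      then have eq: "spiked_prec p d $$ (k, j) = of_bool (k = j) - of_bool (k = 0) * of_bool (j = 0) + (of_bool (k = 0) - d k) * e"
        using ij by (simp add: spiked_prec_def e_def R_def)
      show "d k * spiked_prec p d $$ (k, j) = of_bool (k = j) * d k - of_bool (j = 0) * (of_bool (k = 0) * d k)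
            + e * (of_bool (k = 0) * d k - (d k)\<^sup>2)"
        unfolding eq by (simp add: algebra_simps power2_eq_square)
    qed
    also have "\<dots> = d j - of_bool (j = 0) * d 0 + e * (d 0 - R)"
      using ij p unfolding R_def by (simp only: sum.distrib sum_subtractf sum_distrib_left[symmetric] sum_of_bool_mult)
    finally show ?thesis by (simp add: d0)
  qed
  have "(spiked_cov p d * spiked_prec p d) $$ (i, j) = (\<Sum>k<p. spiked_cov p d $$ (i, k) * spiked_prec p d $$ (k, j))"
    using ij by (simp add: scalar_prod_def atLeast0LessThan)
  also have "\<dots> = spiked_prec p d $$ (i, j) + of_bool (i = 0) * (d j - R * e) + d i * spiked_prec p d $$ (0, j)"
    using ij p by (simp only: spiked_cov_mult sumg)
  also have "spiked_prec p d $$ (0, j) = e"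
    using ij p by (simp add: spiked_prec_def e_def R_def d0)
  also have "spiked_prec p d $$ (i, j) = of_bool (i = j) - of_bool (i = 0) * of_bool (j = 0) + (of_bool (i = 0) - d i) * e"
    using ij by (simp add: spiked_prec_def e_def R_def)
  also have "of_bool (i = j) - of_bool (i = 0) * of_bool (j = 0) + (of_bool (i = 0) - d i) * e
      + of_bool (i = 0) * (d j - R * e) + d i * e
      = of_bool (i = j) + of_bool (i = 0) * ((1 - R) * e - (of_bool (j = 0) - d j))"
    by (simp add: algebra_simps)
  also have "(1 - R) * e = of_bool (j = 0) - d j"
    using R by (simp add: e_def R_def)
  finally show "(spiked_cov p d * spiked_prec p d) $$ (i, j) = 1\<^sub>m p $$ (i, j)"
    using ij by simp
qed auto

lemma inv_mat_eqI:
  assumes A: "A \<in> carrier_mat n n" and B: "B \<in> carrier_mat n n" and AB: "A * B = 1\<^sub>m n"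
  shows "inv_mat A = B"
proof -
  have BA: "B * A = 1\<^sub>m n" by (rule mat_mult_left_right_inverse[OF A B AB])
  have "A \<in> Units (ring_mat TYPE(real) n ())"
    using A B AB BA by (auto simp: Units_def ring_mat_simps)
  then obtain C where C: "mat_inverse A = Some C"
    using mat_inverse(1)[OF A, where b = "()"] by (cases "mat_inverse A") auto
  from mat_inverse(2)[OF A C] have CA: "C * A = 1\<^sub>m n" and Cc: "C \<in> carrier_mat n n" by auto
  have "C = C * (A * B)" using AB Cc by simp
  also have "\<dots> = (C * A) * B" using A B Cc by (simp add: assoc_mult_mat)
  also have "\<dots> = B" using B CA by simp
  finally show ?thesis by (simp add: inv_mat_def C)
qed

lemma inv_spiked:
  assumes "0 < p" "d 0 = 0" "(\<Sum>k<p. (d k)\<^sup>2) < 1"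
  shows "inv_mat (spiked_cov p d) = spiked_prec p d" "inv_mat (spiked_prec p d) = spiked_cov p d"
  using spiked_cov_mult_prec[OF assms]
  by (auto intro!: inv_mat_eqI mat_mult_left_right_inverse[of "spiked_cov p d"])

text \<open>
  Conditioning coordinate \<open>0\<close> on the others factors the covariance into triangular matrices.
\<close>

lemma det_spiked_cov:
  assumes p: "0 < p" and d0: "d 0 = 0"
  shows "Determinant.det (spiked_cov p d) = 1 - (\<Sum>k<p. (d k)\<^sup>2)"
proof -
  define R where "R = (\<Sum>k<p. (d k)\<^sup>2)"
  define U where "U = mat p p (\<lambda>(i, j). of_bool (i = j) * (if i = 0 then 1 - R else 1) + of_bool (i = 0) * d j)"
  define V where "V = mat p p (\<lambda>(i, j). of_bool (i = j) + d i * of_bool (j = 0))"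
  have U: "U \<in> carrier_mat p p" and V: "V \<in> carrier_mat p p" by (auto simp: U_def V_def)
  have UV: "spiked_cov p d = U * V"
  proof (rule eq_matI)
    fix i j assume "i < dim_row (U * V)" "j < dim_col (U * V)"
    then have ij: "i < p" "j < p" by (auto simp: U_def V_def)
    \<comment> \<open>The corner entry is \<open>(1 - R) + R = 1\<close>; every other entry is immediate.\<close>
    have "(U * V) $$ (i, j) = (\<Sum>k<p. U $$ (i, k) * V $$ (k, j))"
      using ij by (simp add: scalar_prod_def U_def V_def atLeast0LessThan)
    also have "\<dots> = (\<Sum>k<p. of_bool (k = j) * U $$ (i, k)
        + of_bool (j = 0) * ((if i = 0 then 1 - R else 1) * (of_bool (i = k) * d k) + of_bool (i = 0) * (d k)\<^sup>2))"
      using ij by (intro sum.cong) (auto simp: U_def V_def algebra_simps power2_eq_square)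
    also have "\<dots> = U $$ (i, j) + of_bool (j = 0) * ((if i = 0 then 1 - R else 1) * d i + of_bool (i = 0) * R)"
      using ij unfolding R_def by (simp only: sum.distrib sum_distrib_left[symmetric] sum_of_bool_mult)
    also have "\<dots> = spiked_cov p d $$ (i, j)"
      using ij d0 by (auto simp: U_def spiked_cov_def)
    finally show "spiked_cov p d $$ (i, j) = (U * V) $$ (i, j)" by simp
  qed (auto simp: U_def V_def)
  have "Determinant.det U = prod_list (diag_mat U)"
    by (rule det_upper_triangular[OF _ U]) (auto simp: U_def)
  also have "\<dots> = (\<Prod>i\<in>{0..<p}. if i = 0 then 1 - R else 1)"
  proof -
    have "U $$ (i, i) = (if i = 0 then 1 - R else 1)" if "i < p" for i
      using that d0 by (cases "i = 0") (auto simp: U_def)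
    then show ?thesis
      using U by (auto simp: prod_list_diag_prod intro!: prod.cong)
  qed

  also have "\<dots> = 1 - R" using p by simp
  finally have dU: "Determinant.det U = 1 - R" .
  have "Determinant.det V = prod_list (diag_mat V)"
    by (rule det_lower_triangular[OF _ V]) (auto simp: V_def)
  also have "\<dots> = 1"
    using d0 by (simp add: prod_list_diag_prod V_def) (intro prod.neutral, auto)
  finally show ?thesis
    using UV dU det_mult[OF U V] by (simp add: R_def)
qed

lemma scalar_prod_vec: "Matrix.vec p x \<bullet> Matrix.vec p y = (\<Sum>i<p. x i * y i)"
  by (simp add: scalar_prod_def atLeast0LessThan)

lemma mult_mat_vec_vec:
  assumes "A \<in> carrier_mat p p"
  shows "A *\<^sub>v Matrix.vec p x = Matrix.vec p (\<lambda>i. \<Sum>k<p. A $$ (i, k) * x k)"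
  using assms by (intro eq_vecI) (auto simp: scalar_prod_def atLeast0LessThan)

lemma mvn_density_spiked_cov:
  assumes p: "0 < p" and d0: "d 0 = 0" and R: "(\<Sum>k<p. (d k)\<^sup>2) < 1"
  shows "mvn_density p (spiked_cov p d) x
    = exp (- ((\<Sum>j<p. (x j)\<^sup>2) - (x 0)\<^sup>2 + (x 0 - (\<Sum>j<p. d j * x j))\<^sup>2 / (1 - (\<Sum>k<p. (d k)\<^sup>2))) / 2)
        / sqrt ((2 * pi) ^ p * (1 - (\<Sum>k<p. (d k)\<^sup>2)))"
proof -
  define D where "D = 1 - (\<Sum>k<p. (d k)\<^sup>2)"
  define y where "y = x 0 - (\<Sum>j<p. d j * x j)"
  have "Matrix.vec p x \<bullet> (spiked_prec p d *\<^sub>v Matrix.vec p x)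
      = (\<Sum>i<p. x i * (x i - of_bool (i = 0) * x 0 + (of_bool (i = 0) - d i) * y / D))"
    unfolding mult_mat_vec_vec[OF spiked_carrier(2)] scalar_prod_vec
    using p by (intro sum.cong refl) (simp add: spiked_prec_mult y_def D_def)
  also have "\<dots> = (\<Sum>i<p. (x i)\<^sup>2 - x 0 * (of_bool (i = 0) * x i) + y / D * (of_bool (i = 0) * x i - d i * x i))"
    by (intro sum.cong refl) (simp add: algebra_simps power2_eq_square diff_divide_distrib add_divide_distrib)
  also have "\<dots> = (\<Sum>j<p. (x j)\<^sup>2) - x 0 * x 0 + y / D * (x 0 - (\<Sum>j<p. d j * x j))"
    using p by (simp only: sum.distrib sum_subtractf sum_distrib_left[symmetric] sum_of_bool_mult)
  also have "\<dots> = (\<Sum>j<p. (x j)\<^sup>2) - (x 0)\<^sup>2 + y\<^sup>2 / D"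
    by (simp add: y_def power2_eq_square)
  finally show ?thesis
    unfolding mvn_density_def inv_spiked(1)[OF assms] det_spiked_cov[where d = d, OF p d0] by (simp add: D_def y_def)
qed

text \<open>
  The eigenvalues of the covariance lie among \<open>1\<close> and \<open>1 \<plusminus> |d|\<close>.  The bound on \<open>|d|\<close> puts \<open>1 - |d|\<close> above
  \<open>1 / M1\<close>, and \<open>1 + |d| \<le> 2 - 1 / M1 \<le> M1\<close>.
\<close>

lemma spiked_prec_eigenvalue_bounds:
  assumes p: "0 < p" and d0: "d 0 = 0" and M1: "1 < M1" and R: "(\<Sum>k<p. (d k)\<^sup>2) \<le> (1 - 1 / M1)\<^sup>2"
    and ev: "eigenvalue (spiked_prec p d) lam"
  shows "1 / M1 \<le> lam" "lam \<le> M1"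
proof -
  define r where "r = (\<Sum>k<p. (d k)\<^sup>2)"
  have k: "0 \<le> 1 - 1 / M1" "1 - 1 / M1 < 1" using M1 by auto
  then have "(1 - 1 / M1)\<^sup>2 < 1" by (simp add: power_less_one_iff abs_square_less_1)
  then have R1: "(\<Sum>k<p. (d k)\<^sup>2) < 1" using R by simp
  from ev obtain v where v: "v \<in> carrier_vec p" "v \<noteq> 0\<^sub>v p" and eq: "spiked_prec p d *\<^sub>v v = lam \<cdot>\<^sub>v v"
    by (auto simp: eigenvalue_def eigenvector_def)
  have "v = (spiked_cov p d * spiked_prec p d) *\<^sub>v v"
    using v spiked_cov_mult_prec[OF p d0 R1] by simp
  also have "\<dots> = spiked_cov p d *\<^sub>v (lam \<cdot>\<^sub>v v)"
    using v eq by (subst assoc_mult_mat_vec[of _ p p _ p]) auto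
  finally have v_eq: "v = spiked_cov p d *\<^sub>v (lam \<cdot>\<^sub>v v)" .
  \<comment> \<open>On the span of \<open>e\<^sub>0\<close> and \<open>d\<close> the eigenvalue equation is a system in \<open>v\<^sub>0\<close> and \<open>t = d \<bullet> v\<close>.\<close>
  define t where "t = (\<Sum>k<p. d k * v $ k)"
  have vi: "v $ i = lam * (v $ i + of_bool (i = 0) * t + d i * v $ 0)" if i: "i < p" for i
  proof -
    have "v $ i = (spiked_cov p d *\<^sub>v (lam \<cdot>\<^sub>v v)) $ i" using v_eq by simp
    also have "\<dots> = (\<Sum>k<p. spiked_cov p d $$ (i, k) * (lam * v $ k))"
      using i v by (simp add: scalar_prod_def atLeast0LessThan)
    also have "\<dots> = lam * v $ i + of_bool (i = 0) * (\<Sum>k<p. d k * (lam * v $ k)) + d i * (lam * v $ 0)"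
      using i p by (rule spiked_cov_mult)
    also have "(\<Sum>k<p. d k * (lam * v $ k)) = lam * t"
      by (simp add: t_def sum_distrib_left algebra_simps)
    finally show ?thesis by (simp add: algebra_simps)
  qed
  have v0: "v $ 0 = lam * (v $ 0 + t)" using vi[OF p] d0 by simp
  have t: "t = lam * (t + r * v $ 0)"
  proof -
    have "t = (\<Sum>k<p. lam * (d k * v $ k) + lam * t * (of_bool (k = 0) * d k) + lam * v $ 0 * (d k)\<^sup>2)"
      unfolding t_def
    proof (rule sum.cong[OF refl])
      fix k assume "k \<in> {..<p}"
      then have "v $ k = lam * (v $ k + of_bool (k = 0) * t + d k * v $ 0)" using vi by simp
      then have "d k * v $ k = d k * (lam * (v $ k + of_bool (k = 0) * t + d k * v $ 0))" by simp
      then show "d k * v $ k = lam * (d k * v $ k) + lam * (\<Sum>k<p. d k * v $ k) * (of_bool (k = 0) * d k) + lam * v $ 0 * (d k)\<^sup>2"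
        unfolding t_def[symmetric] by (simp only: power2_eq_square distrib_left ac_simps)
    qed
    also have "\<dots> = lam * t + lam * t * d 0 + lam * v $ 0 * r"
      using p unfolding t_def r_def by (simp only: sum.distrib sum_distrib_left[symmetric] sum_of_bool_mult)
    finally show ?thesis by (simp add: d0 algebra_simps)
  qed
  have "1 / M1 \<le> lam \<and> lam \<le> M1"
  proof (cases "lam = 1")
    case True
    then show ?thesis using M1 by simp
  next
    case False
    have "v $ 0 \<noteq> 0"
    proof
      assume z: "v $ 0 = 0"
      have "v $ i = 0" if i: "i < p" for i
      proof (cases "i = 0")
        case False
        then have "v $ i = lam * v $ i" using vi[OF i] z by simp
        then show ?thesis using \<open>lam \<noteq> 1\<close> by simp
      qed (use z in simp)
      then have "v = 0\<^sub>v p" using v by (intro eq_vecI) auto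
      then show False using v by simp
    qed
    moreover have "v $ 0 * (1 - lam)\<^sup>2 = v $ 0 * (lam\<^sup>2 * r)"
    proof -
      have 1: "v $ 0 * (1 - lam) = lam * t" using v0 by (simp add: algebra_simps)
      have 2: "t * (1 - lam) = lam * r * v $ 0" using t by (simp add: algebra_simps)
      have "v $ 0 * (1 - lam)\<^sup>2 = lam * (t * (1 - lam))"
        by (simp add: power2_eq_square 1[symmetric] ac_simps)
      then show ?thesis by (simp add: 2 power2_eq_square ac_simps)
    qed
    ultimately have sq: "(1 - lam)\<^sup>2 = lam\<^sup>2 * r" by simp
    then have l0: "lam \<noteq> 0" by auto
    have "(1 / lam - 1)\<^sup>2 = r"
    proof -
      have "(1 / lam - 1)\<^sup>2 = (1 - lam)\<^sup>2 / lam\<^sup>2"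
        using l0 by (simp add: power_divide[symmetric] diff_divide_distrib)
      then show ?thesis using sq l0 by simp
    qed
    then have "(1 / lam - 1)\<^sup>2 \<le> (1 - 1 / M1)\<^sup>2" using R by (simp add: r_def)
    then have "\<bar>1 / lam - 1\<bar> \<le> 1 - 1 / M1" using k by (simp add: abs_le_square_iff[symmetric])
    then have b: "1 / M1 \<le> 1 / lam" "1 / lam \<le> 2 - 1 / M1" by auto
    have M1p: "0 < 1 / M1" using M1 by simp
    then have "0 < 1 / lam" using b by linarith
    then have lp: "0 < lam" by simp
    have "lam \<le> M1" using b(1) lp M1 by (simp add: field_simps)
    have "2 - 1 / M1 \<le> M1"
    proof -
      have "0 \<le> (M1 - 1)\<^sup>2 / M1" using M1 by simp
      also have "(M1 - 1)\<^sup>2 / M1 = M1 - (2 - 1 / M1)" using M1 by (simp add: field_simps power2_eq_square)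
      finally show ?thesis by simp
    qed
    then have "1 / lam \<le> M1" using b by linarith
    then have "1 / M1 \<le> lam" using lp M1 by (simp add: field_simps)
    then show ?thesis using \<open>lam \<le> M1\<close> by simp
  qed
  then show "1 / M1 \<le> lam" "lam \<le> M1" by auto
qed

text \<open>
  A real matrix may have empty spectrum, and then the minimum and the maximum over the spectrum would
  say nothing; an eigenvector of the covariance is \<open>|d| e\<^sub>0 + d\<close>, or \<open>e\<^sub>0\<close> if \<open>d\<close> vanishes.
\<close>

lemma spiked_prec_has_eigenvalue:
  assumes p: "0 < p" and d0: "d 0 = 0" and R: "(\<Sum>k<p. (d k)\<^sup>2) < 1"
  shows "\<exists>lam. eigenvalue (spiked_prec p d) lam"
proof -
  define r where "r = sqrt (\<Sum>k<p. (d k)\<^sup>2)"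
  have r: "0 \<le> r" "r < 1" and r2: "(\<Sum>k<p. (d k)\<^sup>2) = r\<^sup>2"
    using R by (auto simp: r_def sum_nonneg)
  define a where "a = (if r = 0 then 1 else r)"
  define u where "u i = of_bool (i = 0) * a + d i" for i
  have dz: "d i = 0" if "r = 0" "i < p" for i
    using r2 that by (simp add: sum_nonneg_eq_0_iff)
  have du: "(\<Sum>k<p. d k * u k) = r\<^sup>2"
  proof -
    have "(\<Sum>k<p. d k * u k) = (\<Sum>k<p. a * (of_bool (k = 0) * d k) + (d k)\<^sup>2)"
      by (intro sum.cong refl) (simp add: u_def algebra_simps power2_eq_square)
    also have "\<dots> = a * d 0 + r\<^sup>2"
      using p by (simp only: sum.distrib sum_distrib_left[symmetric] sum_of_bool_mult r2)
    finally show ?thesis by (simp add: d0)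
  qed
  have D: "1 - r\<^sup>2 = (1 - r) * (1 + r)" by (simp add: power2_eq_square algebra_simps)
  have "spiked_prec p d *\<^sub>v Matrix.vec p u = (1 / (1 + r)) \<cdot>\<^sub>v Matrix.vec p u"
  proof (rule eq_vecI)
    fix i assume "i < dim_vec ((1 / (1 + r)) \<cdot>\<^sub>v Matrix.vec p u)"
    then have i: "i < p" by simp
    have "(spiked_prec p d *\<^sub>v Matrix.vec p u) $ i = (\<Sum>k<p. spiked_prec p d $$ (i, k) * u k)"
      using i by (simp add: mult_mat_vec_vec[OF spiked_carrier(2)])
    also have "\<dots> = u i - of_bool (i = 0) * u 0 + (of_bool (i = 0) - d i) * (u 0 - r\<^sup>2) / (1 - r\<^sup>2)"
      using i p by (simp only: spiked_prec_mult du r2)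
    also have "\<dots> = 1 / (1 + r) * u i"
    proof (cases "r = 0")
      case True
      then show ?thesis using dz[OF True i] by (simp add: u_def d0)
    next
      case False
      have "(u 0 - r\<^sup>2) / (1 - r\<^sup>2) = r / (1 + r)"
        unfolding D using r False by (simp add: u_def d0 a_def) (simp add: power2_eq_square divide_simps, simp add: algebra_simps)
      then have "u i - of_bool (i = 0) * u 0 + (of_bool (i = 0) - d i) * (u 0 - r\<^sup>2) / (1 - r\<^sup>2)
          = u i - of_bool (i = 0) * u 0 + (of_bool (i = 0) - d i) * (r / (1 + r))"
        by (metis times_divide_eq_right)
      also have "\<dots> = 1 / (1 + r) * u i"
        using r False by (simp add: u_def d0 a_def divide_simps) (simp add: algebra_simps)
      finally show ?thesis .
    qed
    finally show "(spiked_prec p d *\<^sub>v Matrix.vec p u) $ i = ((1 / (1 + r)) \<cdot>\<^sub>v Matrix.vec p u) $ i"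
      using i by simp
  qed simp
  moreover have "Matrix.vec p u \<noteq> 0\<^sub>v p"
  proof
    assume "Matrix.vec p u = 0\<^sub>v p"
    then have "u 0 = 0" using p by (metis index_vec index_zero_vec(1))
    then show False using r by (auto simp: u_def d0 a_def split: if_splits)
  qed
  ultimately have "eigenvector (spiked_prec p d) (Matrix.vec p u) (1 / (1 + r))"
    by (simp add: eigenvector_def)
  then show ?thesis by (auto simp: eigenvalue_def)
qed

lemma spiked_prec_spectrum_bounds:
  assumes p: "0 < p" and d0: "d 0 = 0" and M1: "1 < M1" and R: "(\<Sum>k<p. (d k)\<^sup>2) \<le> (1 - 1 / M1)\<^sup>2"
  shows "1 / M1 \<le> lambda_min (spiked_prec p d)" "lambda_min (spiked_prec p d) \<le> lambda_max (spiked_prec p d)"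
    "lambda_max (spiked_prec p d) \<le> M1"
proof -
  have "0 \<le> 1 - 1 / M1" "1 - 1 / M1 < 1" using M1 by auto
  then have "(1 - 1 / M1)\<^sup>2 < 1" by (simp add: power_less_one_iff abs_square_less_1)
  then have R1: "(\<Sum>k<p. (d k)\<^sup>2) < 1" using R by simp
  have fin: "finite (spectrum (spiked_prec p d))"
    by (rule card_finite_spectrum[OF spiked_carrier(2)])
  have ne: "spectrum (spiked_prec p d) \<noteq> {}"
    using spiked_prec_has_eigenvalue[OF p d0 R1] by (auto simp: spectrum_def)
  have b: "1 / M1 \<le> x \<and> x \<le> M1" if "x \<in> spectrum (spiked_prec p d)" for x
    using spiked_prec_eigenvalue_bounds[OF p d0 M1 R] that by (auto simp: spectrum_def)
  show "1 / M1 \<le> lambda_min (spiked_prec p d)" "lambda_max (spiked_prec p d) \<le> M1"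
    using fin ne b by (auto simp: lambda_min_def lambda_max_def)
  show "lambda_min (spiked_prec p d) \<le> lambda_max (spiked_prec p d)"
    unfolding lambda_min_def lambda_max_def using fin ne by (meson Max_ge Min_in)
qed

lemma transpose_spiked_prec: "(spiked_prec p d)\<^sup>T = spiked_prec p d"
  by (rule eq_matI) (auto simp: spiked_prec_def)

section \<open>The law of the sample\<close>

abbreviation centered_normal :: "real \<Rightarrow> real measure" where
  "centered_normal \<sigma> \<equiv> density lborel (\<lambda>x. ennreal (normal_density 0 \<sigma> x))"

lemma mvn_scaled_identity:
  assumes \<sigma>: "0 < \<sigma>"
  shows "mvn n (\<sigma>\<^sup>2 \<cdot>\<^sub>m 1\<^sub>m n) = (\<Pi>\<^sub>M i\<in>{..<n}. centered_normal \<sigma>)"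
proof -
  have inv: "inv_mat (\<sigma>\<^sup>2 \<cdot>\<^sub>m 1\<^sub>m n) = (1 / \<sigma>\<^sup>2) \<cdot>\<^sub>m 1\<^sub>m n"
    using \<sigma> by (intro inv_mat_eqI[of _ n]) (auto simp: mult_smult_distrib mult_smult_assoc_mat intro!: eq_matI)
  have dens: "mvn_density n (\<sigma>\<^sup>2 \<cdot>\<^sub>m 1\<^sub>m n) x = (\<Prod>i<n. normal_density 0 \<sigma> (x i))" for x
  proof -
    have "Matrix.vec n x \<bullet> (inv_mat (\<sigma>\<^sup>2 \<cdot>\<^sub>m 1\<^sub>m n) *\<^sub>v Matrix.vec n x) = (\<Sum>i<n. (x i)\<^sup>2) / \<sigma>\<^sup>2"
    proof -
      have "((1 / \<sigma>\<^sup>2) \<cdot>\<^sub>m 1\<^sub>m n) *\<^sub>v Matrix.vec n x = Matrix.vec n (\<lambda>i. x i / \<sigma>\<^sup>2)"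
      proof (rule eq_vecI)
        fix i assume "i < dim_vec (Matrix.vec n (\<lambda>i. x i / \<sigma>\<^sup>2))"
        then have i: "i < n" by simp
        have "(((1 / \<sigma>\<^sup>2) \<cdot>\<^sub>m 1\<^sub>m n) *\<^sub>v Matrix.vec n x) $ i = (\<Sum>k<n. of_bool (i = k) * (x k / \<sigma>\<^sup>2))"
          using i by (simp add: scalar_prod_def atLeast0LessThan one_mat_def of_bool_def cong: if_cong)
        then show "(((1 / \<sigma>\<^sup>2) \<cdot>\<^sub>m 1\<^sub>m n) *\<^sub>v Matrix.vec n x) $ i = Matrix.vec n (\<lambda>i. x i / \<sigma>\<^sup>2) $ i"
          using i by (simp only: sum_of_bool_mult index_vec)
      qed simp
      then show ?thesis
        unfolding inv by (simp add: scalar_prod_vec sum_divide_distrib) (simp add: power2_eq_square)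
    qed
    moreover have "(\<Prod>i<n. normal_density 0 \<sigma> (x i)) = (1 / sqrt (2 * pi * \<sigma>\<^sup>2)) ^ n * exp (- ((\<Sum>i<n. (x i)\<^sup>2) / (2 * \<sigma>\<^sup>2)))"
      by (simp add: normal_density_def prod.distrib prod_dividef exp_sum[symmetric] sum_negf[symmetric] sum_divide_distrib power_one_over)
    ultimately show ?thesis
      by (simp add: mvn_density_def power_mult_distrib real_sqrt_mult real_sqrt_power power_one_over)
  qed
  show ?thesis
    unfolding mvn_def dens by (subst PiM_density) (auto simp: lborel.sigma_finite_measure_axioms)
qed

lemma mvn_one: "mvn p (1\<^sub>m p) = (\<Pi>\<^sub>M i\<in>{..<p}. std_normal)"
proof -
  have "(1::real)\<^sup>2 \<cdot>\<^sub>m 1\<^sub>m p = 1\<^sub>m p" by (intro eq_matI) auto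
  then show ?thesis using mvn_scaled_identity[of 1 p] by simp
qed

text \<open>
  How one observation is made from its covariates and its noise.
\<close>

definition row_map :: "nat \<Rightarrow> real Matrix.vec \<Rightarrow> (nat \<Rightarrow> real) \<times> real \<Rightarrow> real \<times> (nat \<Rightarrow> real)" where
  "row_map p \<beta> = (\<lambda>(x, e). ((\<Sum>j<p. x j * \<beta> $ j) + e, x))"

abbreviation row_space :: "nat \<Rightarrow> (real \<times> (nat \<Rightarrow> real)) measure" where
  "row_space p \<equiv> borel \<Otimes>\<^sub>M (\<Pi>\<^sub>M j\<in>{..<p}. borel)"

definition row_law :: "nat \<Rightarrow> real Matrix.vec \<Rightarrow> real mat \<Rightarrow> real \<Rightarrow> (real \<times> (nat \<Rightarrow> real)) measure" where
  "row_law p \<beta> \<Sigma> \<sigma> = distr (mvn p \<Sigma> \<Otimes>\<^sub>M centered_normal \<sigma>) (row_space p) (row_map p \<beta>)"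

lemma sets_row_law[simp, measurable_cong]: "sets (row_law p \<beta> \<Sigma> \<sigma>) = sets (row_space p)"
  by (simp add: row_law_def)

lemma sets_PiM_lborel: "sets (\<Pi>\<^sub>M j\<in>I. lborel :: real measure) = sets (\<Pi>\<^sub>M j\<in>I. borel)"
  by (rule sets_PiM_cong) auto

lemma sets_mvn: "sets (mvn p \<Sigma>) = sets (\<Pi>\<^sub>M j\<in>{..<p}. borel :: real measure)"
  by (simp add: mvn_def sets_PiM_lborel)

lemma measurable_row_map: "row_map p \<beta> \<in> mvn p \<Sigma> \<Otimes>\<^sub>M centered_normal \<sigma> \<rightarrow>\<^sub>M row_space p"
proof -
  have "sets (mvn p \<Sigma> \<Otimes>\<^sub>M centered_normal \<sigma>) = sets ((\<Pi>\<^sub>M j\<in>{..<p}. borel) \<Otimes>\<^sub>M (borel :: real measure))"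
    by (intro sets_pair_measure_cong) (auto simp: sets_mvn)
  moreover have "row_map p \<beta> \<in> (\<Pi>\<^sub>M j\<in>{..<p}. borel) \<Otimes>\<^sub>M borel \<rightarrow>\<^sub>M row_space p"
    unfolding row_map_def by measurable
  ultimately show ?thesis by (simp cong: measurable_cong_sets)
qed

lemma sigma_finite_centered_normal: "sigma_finite_measure (centered_normal \<sigma>)"
  by (intro sigma_finite_density_real lborel.sigma_finite_measure_axioms) auto

lemma sigma_finite_PiM_lborel: "sigma_finite_measure (\<Pi>\<^sub>M j\<in>{..<p::nat}. lborel :: real measure)"
proof -
  interpret L: product_sigma_finite "\<lambda>_::nat. lborel :: real measure" by standard
  show ?thesis by (rule L.sigma_finite) simp
qed

text \<open>
  A translation of the noise variable by \<open>x \<bullet> \<beta>\<close> gives the joint density of response and covariates.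
\<close>

lemma nn_integral_row_law:
  assumes f: "mvn_density p \<Sigma> \<in> borel_measurable (\<Pi>\<^sub>M j\<in>{..<p}. borel)" and f0: "\<And>x. 0 \<le> mvn_density p \<Sigma> x"
    and g[measurable]: "g \<in> borel_measurable (row_space p)"
  shows "(\<integral>\<^sup>+z. g z \<partial>row_law p \<beta> \<Sigma> \<sigma>)
    = (\<integral>\<^sup>+x. \<integral>\<^sup>+y. ennreal (mvn_density p \<Sigma> x * normal_density 0 \<sigma> (y - (\<Sum>j<p. x j * \<beta> $ j))) * g (y, x)
        \<partial>lborel \<partial>(\<Pi>\<^sub>M j\<in>{..<p}. lborel))"
proof -
  let ?N = "centered_normal \<sigma>"
  have gm: "(\<lambda>z. g (row_map p \<beta> z)) \<in> borel_measurable (mvn p \<Sigma> \<Otimes>\<^sub>M ?N)"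
    by (rule measurable_compose[OF measurable_row_map g])
  have fm: "(\<lambda>x. ennreal (mvn_density p \<Sigma> x)) \<in> borel_measurable (\<Pi>\<^sub>M j\<in>{..<p}. lborel)"
    using f by (simp cong: measurable_cong_sets add: sets_PiM_lborel)
  have im: "(\<lambda>x. \<integral>\<^sup>+e. g (row_map p \<beta> (x, e)) \<partial>?N) \<in> borel_measurable (\<Pi>\<^sub>M j\<in>{..<p}. lborel)"
    using sigma_finite_measure.borel_measurable_nn_integral_fst[OF sigma_finite_centered_normal gm]
    by (simp cong: measurable_cong_sets add: sets_PiM_lborel sets_mvn)
  have "(\<integral>\<^sup>+z. g z \<partial>row_law p \<beta> \<Sigma> \<sigma>) = (\<integral>\<^sup>+z. g (row_map p \<beta> z) \<partial>(mvn p \<Sigma> \<Otimes>\<^sub>M ?N))"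
    unfolding row_law_def by (rule nn_integral_distr[OF measurable_row_map]) simp
  also have "\<dots> = (\<integral>\<^sup>+x. \<integral>\<^sup>+e. g (row_map p \<beta> (x, e)) \<partial>?N \<partial>mvn p \<Sigma>)"
    by (rule sigma_finite_measure.nn_integral_fst[OF sigma_finite_centered_normal gm, symmetric])
  also have "\<dots> = (\<integral>\<^sup>+x. ennreal (mvn_density p \<Sigma> x) * (\<integral>\<^sup>+e. g (row_map p \<beta> (x, e)) \<partial>?N) \<partial>(\<Pi>\<^sub>M j\<in>{..<p}. lborel))"
    unfolding mvn_def by (rule nn_integral_density[OF fm im])
  also have "\<dots> = (\<integral>\<^sup>+x. \<integral>\<^sup>+y. ennreal (mvn_density p \<Sigma> x * normal_density 0 \<sigma> (y - (\<Sum>j<p. x j * \<beta> $ j))) * g (y, x)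
        \<partial>lborel \<partial>(\<Pi>\<^sub>M j\<in>{..<p}. lborel))"
  proof (rule nn_integral_cong)
    fix x :: "nat \<Rightarrow> real" assume "x \<in> space (\<Pi>\<^sub>M j\<in>{..<p}. lborel)"
    then have [measurable]: "x \<in> space (\<Pi>\<^sub>M j\<in>{..<p}. borel)"
      by (simp add: space_PiM)
    define b where "b = (\<Sum>j<p. x j * \<beta> $ j)"
    have "(\<integral>\<^sup>+e. g (row_map p \<beta> (x, e)) \<partial>?N) = (\<integral>\<^sup>+e. ennreal (normal_density 0 \<sigma> e) * g (b + e, x) \<partial>lborel)"
      unfolding row_map_def split_conv b_def[symmetric] by (subst nn_integral_density) auto
    also have "\<dots> = (\<integral>\<^sup>+y. ennreal (normal_density 0 \<sigma> (y - b)) * g (y, x) \<partial>lborel)"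
      by (subst nn_integral_real_affine[where c = 1 and t = "- b"]) (auto simp: algebra_simps)
    finally show "ennreal (mvn_density p \<Sigma> x) * (\<integral>\<^sup>+e. g (row_map p \<beta> (x, e)) \<partial>?N)
      = (\<integral>\<^sup>+y. ennreal (mvn_density p \<Sigma> x * normal_density 0 \<sigma> (y - (\<Sum>j<p. x j * \<beta> $ j))) * g (y, x) \<partial>lborel)"
      using f0 by (simp add: b_def[symmetric] ennreal_mult mult.assoc nn_integral_cmult)
  qed
  finally show ?thesis .
qed

lemma row_law_eq_density:
  assumes f: "mvn_density p \<Sigma> \<in> borel_measurable (\<Pi>\<^sub>M j\<in>{..<p}. borel)" "\<And>x. 0 \<le> mvn_density p \<Sigma> x"
    and f': "mvn_density p \<Sigma>' \<in> borel_measurable (\<Pi>\<^sub>M j\<in>{..<p}. borel)" "\<And>x. 0 \<le> mvn_density p \<Sigma>' x"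
    and K[measurable]: "K \<in> borel_measurable (row_space p)" and K0: "\<And>z. 0 \<le> K z"
    and eq: "\<And>x y. mvn_density p \<Sigma>' x * normal_density 0 \<sigma>' (y - (\<Sum>j<p. x j * \<beta>' $ j))
      = mvn_density p \<Sigma> x * normal_density 0 \<sigma> (y - (\<Sum>j<p. x j * \<beta> $ j)) * K (y, x)"
  shows "row_law p \<beta>' \<Sigma>' \<sigma>' = density (row_law p \<beta> \<Sigma> \<sigma>) (\<lambda>z. ennreal (K z))"
proof (rule measure_eqI)
  fix E assume "E \<in> sets (row_law p \<beta>' \<Sigma>' \<sigma>')"
  then have E[measurable]: "E \<in> sets (row_space p)" by simp
  have "emeasure (row_law p \<beta>' \<Sigma>' \<sigma>') E = (\<integral>\<^sup>+z. indicator E z \<partial>row_law p \<beta>' \<Sigma>' \<sigma>')"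
    by (simp add: E)
  also have "\<dots> = (\<integral>\<^sup>+z. ennreal (K z) * indicator E z \<partial>row_law p \<beta> \<Sigma> \<sigma>)"
  proof -
    have "indicator E \<in> borel_measurable (row_space p)"
      "(\<lambda>z. ennreal (K z) * indicator E z) \<in> borel_measurable (row_space p)"
      by measurable
    then show ?thesis
      unfolding nn_integral_row_law[OF f' \<open>indicator E \<in> _\<close>] nn_integral_row_law[OF f \<open>(\<lambda>z. ennreal (K z) * indicator E z) \<in> _\<close>]
      using f(2) K0 by (simp add: eq ennreal_mult mult.assoc)
  qed
  also have "\<dots> = emeasure (density (row_law p \<beta> \<Sigma> \<sigma>) (\<lambda>z. ennreal (K z))) E"
    by (subst emeasure_density) auto
  finally show "emeasure (row_law p \<beta>' \<Sigma>' \<sigma>') E = emeasure (density (row_law p \<beta> \<Sigma> \<sigma>) (\<lambda>z. ennreal (K z))) E" .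
qed simp

lemma prob_space_row_law_one:
  assumes "0 < \<sigma>"
  shows "prob_space (row_law p \<beta> (1\<^sub>m p) \<sigma>)"
proof -
  interpret X: product_prob_space "\<lambda>_::nat. std_normal" "{..<p}"
    by (intro product_prob_space.intro product_sigma_finite.intro product_prob_space_axioms.intro
        prob_space_imp_sigma_finite prob_space_std_normal)
  interpret N: prob_space "centered_normal \<sigma>" using assms by (rule prob_space_normal_density)
  interpret P: pair_prob_space "\<Pi>\<^sub>M i\<in>{..<p}. std_normal" "centered_normal \<sigma>" ..
  show ?thesis
    unfolding row_law_def
    by (rule prob_space.prob_space_distr[OF _ measurable_row_map]) (simp add: mvn_one P.prob_space_axioms)
qed

text \<open>
  The noise vector is drawn jointly, but its covariance is scalar, so the rows are independent and
  identically distributed.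
\<close>

lemma sample_law_eq_PiM:
  assumes \<beta>: "\<beta> \<in> carrier_vec p" and \<sigma>: "0 < \<sigma>" and fin: "sigma_finite_measure (row_law p \<beta> (inv_mat \<Omega>) \<sigma>)"
    and f: "mvn_density p (inv_mat \<Omega>) \<in> borel_measurable (\<Pi>\<^sub>M j\<in>{..<p}. borel)"
  shows "sample_law n p (\<beta>, \<Omega>, \<sigma>) = (\<Pi>\<^sub>M i\<in>{..<n}. row_law p \<beta> (inv_mat \<Omega>) \<sigma>)"
proof -
  have sf: "sigma_finite_measure (mvn p (inv_mat \<Omega>))"
    using f unfolding mvn_def
    by (intro sigma_finite_density_real sigma_finite_PiM_lborel) (simp cong: measurable_cong_sets add: sets_PiM_lborel)
  have "regression_sample n p \<beta> = (\<lambda>(X, \<epsilon>). \<lambda>i\<in>{..<n}. row_map p \<beta> (X i, \<epsilon> i))"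
    using \<beta> by (auto simp: regression_sample_def row_map_def scalar_prod_def atLeast0LessThan fun_eq_iff)
  then show ?thesis
    unfolding sample_law_def sample_space_def row_law_def split_conv mvn_scaled_identity[OF \<sigma>]
    using distr_pair_PiM_eq_PiM_distr[OF finite_lessThan sf sigma_finite_centered_normal fin[unfolded row_law_def] measurable_row_map]
    by simp
qed

text \<open>
  At identity covariance a row is an image of \<open>p + 1\<close> independent standard normal variables.  The
  normalised noise is stored as coordinate \<open>p\<close>, behind the covariates.
\<close>

lemma nn_integral_row_law_one:
  assumes \<sigma>: "0 < \<sigma>" and G[measurable]: "G \<in> borel_measurable (row_space p)"
  shows "(\<integral>\<^sup>+z. G z \<partial>row_law p \<beta> (1\<^sub>m p) \<sigma>)
    = (\<integral>\<^sup>+x. G (row_map p \<beta> (restrict x {..<p}, \<sigma> * x p)) \<partial>(\<Pi>\<^sub>M i\<in>insert p {..<p}. std_normal))"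
proof -
  have scale: "(\<integral>\<^sup>+e. h e \<partial>centered_normal \<sigma>) = (\<integral>\<^sup>+u. h (\<sigma> * u) \<partial>std_normal)"
    if [measurable]: "h \<in> borel_measurable borel" for h :: "real \<Rightarrow> ennreal"
  proof -
    have "(\<integral>\<^sup>+e. h e \<partial>centered_normal \<sigma>) = (\<integral>\<^sup>+e. ennreal (normal_density 0 \<sigma> e) * h e \<partial>lborel)"
      by (subst nn_integral_density) auto
    also have "\<dots> = (\<integral>\<^sup>+u. ennreal \<sigma> * (ennreal (normal_density 0 \<sigma> (\<sigma> * u)) * h (\<sigma> * u)) \<partial>lborel)"
      using \<sigma> by (subst nn_integral_real_affine[where c = \<sigma> and t = 0]) (auto simp: nn_integral_cmult)
    also have "\<dots> = (\<integral>\<^sup>+u. ennreal (std_normal_density u) * h (\<sigma> * u) \<partial>lborel)"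
    proof (rule nn_integral_cong)
      fix u :: real
      have "\<sigma> * normal_density 0 \<sigma> (\<sigma> * u) = std_normal_density u"
        using \<sigma> by (simp add: normal_density_def power_mult_distrib real_sqrt_mult)
      then show "ennreal \<sigma> * (ennreal (normal_density 0 \<sigma> (\<sigma> * u)) * h (\<sigma> * u)) = ennreal (std_normal_density u) * h (\<sigma> * u)"
        using \<sigma> by (simp add: mult.assoc[symmetric] ennreal_mult[symmetric])
    qed
    also have "\<dots> = (\<integral>\<^sup>+u. h (\<sigma> * u) \<partial>std_normal)"
      by (subst nn_integral_density) auto
    finally show ?thesis .
  qed
  have sets: "sets (\<Pi>\<^sub>M i\<in>I. std_normal) = sets (\<Pi>\<^sub>M i\<in>I. borel)" for I :: "nat set"
    by (rule sets_PiM_cong) auto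
  have rm: "row_map p \<beta> \<in> (\<Pi>\<^sub>M j\<in>{..<p}. borel) \<Otimes>\<^sub>M borel \<rightarrow>\<^sub>M row_space p"
    unfolding row_map_def by measurable
  have Gm: "(\<lambda>x. G (row_map p \<beta> (restrict x {..<p}, \<sigma> * x p))) \<in> borel_measurable (\<Pi>\<^sub>M i\<in>insert p {..<p}. std_normal)"
  proof -
    have "(\<lambda>x. (restrict x {..<p}, \<sigma> * x p)) \<in> (\<Pi>\<^sub>M i\<in>insert p {..<p}. borel) \<rightarrow>\<^sub>M (\<Pi>\<^sub>M j\<in>{..<p}. borel) \<Otimes>\<^sub>M borel"
      by (intro measurable_Pair measurable_restrict_subset) (auto intro: measurable_component_singleton)
    from measurable_compose[OF measurable_compose[OF this rm] G]
    show ?thesis by (simp cong: measurable_cong_sets add: sets)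
  qed
  have "(\<integral>\<^sup>+z. G z \<partial>row_law p \<beta> (1\<^sub>m p) \<sigma>) = (\<integral>\<^sup>+z. G (row_map p \<beta> z) \<partial>(mvn p (1\<^sub>m p) \<Otimes>\<^sub>M centered_normal \<sigma>))"
    unfolding row_law_def by (rule nn_integral_distr[OF measurable_row_map]) simp
  also have "\<dots> = (\<integral>\<^sup>+x. \<integral>\<^sup>+e. G (row_map p \<beta> (x, e)) \<partial>centered_normal \<sigma> \<partial>mvn p (1\<^sub>m p))"
    by (rule sigma_finite_measure.nn_integral_fst[OF sigma_finite_centered_normal, symmetric])
      (rule measurable_compose[OF measurable_row_map G])
  also have "\<dots> = (\<integral>\<^sup>+x. \<integral>\<^sup>+u. G (row_map p \<beta> (x, \<sigma> * u)) \<partial>std_normal \<partial>(\<Pi>\<^sub>M i\<in>{..<p}. std_normal))"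
    unfolding mvn_one
  proof (rule nn_integral_cong, rule scale)
    fix x :: "nat \<Rightarrow> real" assume "x \<in> space (\<Pi>\<^sub>M i\<in>{..<p}. std_normal)"
    then have "x \<in> space (\<Pi>\<^sub>M i\<in>{..<p}. borel)" by (simp add: space_PiM)
    then have "(\<lambda>e. (x, e)) \<in> borel \<rightarrow>\<^sub>M (\<Pi>\<^sub>M j\<in>{..<p}. borel) \<Otimes>\<^sub>M borel" by measurable
    from measurable_compose[OF measurable_compose[OF this rm] G]
    show "(\<lambda>e. G (row_map p \<beta> (x, e))) \<in> borel_measurable borel" .
  qed
  also have "\<dots> = (\<integral>\<^sup>+x. \<integral>\<^sup>+u. G (row_map p \<beta> (restrict (x(p := u)) {..<p}, \<sigma> * (x(p := u)) p)) \<partial>std_normal \<partial>(\<Pi>\<^sub>M i\<in>{..<p}. std_normal))"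
  proof (rule nn_integral_cong)
    fix x :: "nat \<Rightarrow> real" assume "x \<in> space (\<Pi>\<^sub>M i\<in>{..<p}. std_normal)"
    then have "restrict (x(p := u)) {..<p} = x" for u
      by (auto simp: space_PiM PiE_iff extensional_def fun_eq_iff restrict_def)
    then show "(\<integral>\<^sup>+u. G (row_map p \<beta> (x, \<sigma> * u)) \<partial>std_normal)
        = (\<integral>\<^sup>+u. G (row_map p \<beta> (restrict (x(p := u)) {..<p}, \<sigma> * (x(p := u)) p)) \<partial>std_normal)"
      by simp
  qed
  also have "\<dots> = (\<integral>\<^sup>+x. G (row_map p \<beta> (restrict x {..<p}, \<sigma> * x p)) \<partial>(\<Pi>\<^sub>M i\<in>insert p {..<p}. std_normal))"
    by (rule std_normals.product_nn_integral_insert[OF _ _ Gm, symmetric]) auto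
  finally show ?thesis .
qed

section \<open>The alternatives\<close>

text \<open>
  The variable \<open>v = w1 u + w2 x\<^sub>0\<close> that the alternatives correlate with further covariates.
\<close>

definition row_score :: "nat \<Rightarrow> real Matrix.vec \<Rightarrow> real \<Rightarrow> real \<Rightarrow> real \<Rightarrow> real \<times> (nat \<Rightarrow> real) \<Rightarrow> real" where
  "row_score p \<beta> \<sigma> w1 w2 = (\<lambda>(y, x). w1 * ((y - (\<Sum>j<p. x j * \<beta> $ j)) / \<sigma>) + w2 * x 0)"

definition row_ratio ::
  "nat \<Rightarrow> real Matrix.vec \<Rightarrow> real \<Rightarrow> real \<Rightarrow> real \<Rightarrow> real \<Rightarrow> nat set \<Rightarrow> real \<times> (nat \<Rightarrow> real) \<Rightarrow> real" where
  "row_ratio p \<beta> \<sigma> w1 w2 \<rho> S z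
    = normal_ratio (\<rho>\<^sup>2 * card S) (row_score p \<beta> \<sigma> w1 w2 z) (\<Sum>j\<in>S. \<rho> * snd z j)"

definition spike_dir :: "real \<Rightarrow> real \<Rightarrow> nat set \<Rightarrow> nat \<Rightarrow> real" where
  "spike_dir w2 \<rho> S j = of_bool (j \<in> S) * (w2 * \<rho>)"

text \<open>
  The coefficients of \<open>y\<close> on \<open>x\<close> once \<open>v\<close> has covariance \<open>\<rho>\<close> with each \<open>x\<^sub>j\<close>, \<open>j \<in> S\<close>; they solve the normal
  equations for \<open>u\<close>, whose covariance with \<open>x\<^sub>j\<close> is \<open>w1 \<rho>\<close> for \<open>j \<in> S\<close> and \<open>0\<close> for other \<open>j\<close>.
\<close>

definition alt_coef :: "nat \<Rightarrow> real Matrix.vec \<Rightarrow> real \<Rightarrow> real \<Rightarrow> real \<Rightarrow> real \<Rightarrow> nat set \<Rightarrow> real Matrix.vec" where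
  "alt_coef p \<beta> \<sigma> w1 w2 \<rho> S = Matrix.vec p (\<lambda>j. \<beta> $ j
     + \<sigma> * (w1 / (1 - w2\<^sup>2 * (\<rho>\<^sup>2 * card S)))
         * (of_bool (j \<in> S) * \<rho> - of_bool (j = 0) * (w2 * (\<rho>\<^sup>2 * card S))))"

definition alt_param :: "nat \<Rightarrow> real Matrix.vec \<Rightarrow> real \<Rightarrow> real \<Rightarrow> real \<Rightarrow> real \<Rightarrow> nat set \<Rightarrow> param" where
  "alt_param p \<beta> \<sigma> w1 w2 \<rho> S = (alt_coef p \<beta> \<sigma> w1 w2 \<rho> S, spiked_prec p (spike_dir w2 \<rho> S),
     \<sigma> * sqrt ((1 - \<rho>\<^sup>2 * card S) / (1 - w2\<^sup>2 * (\<rho>\<^sup>2 * card S))))"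

text \<open>
  With \<open>x0\<^sup>2\<close> added, both sides are the quadratic form of \<open>(x0, u)\<close> given \<open>s\<close> under the alternative.  On the left, \<open>x0\<close> is
  conditioned on \<open>s\<close> first and then \<open>u\<close> on both; on the right, the form is split along \<open>v\<close> and the
  direction orthogonal to it, where nothing changes.
\<close>

lemma normal_ratio_exponent_identity:
  fixes x0 u s w1 w2 r :: real
  assumes w: "w1\<^sup>2 + w2\<^sup>2 = 1" and r: "r < 1" and D: "0 < 1 - w2\<^sup>2 * r"
  shows "(x0 - w2 * s)\<^sup>2 / (1 - w2\<^sup>2 * r) - x0\<^sup>2
      + (u + w1 / (1 - w2\<^sup>2 * r) * (w2 * r * x0 - s))\<^sup>2 / ((1 - r) / (1 - w2\<^sup>2 * r))
    = u\<^sup>2 - (w1 * u + w2 * x0)\<^sup>2 + (w1 * u + w2 * x0 - s)\<^sup>2 / (1 - r)"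
proof -
  define D where "D = 1 - w2\<^sup>2 * r"
  define E where "E = 1 - r"
  define v where "v = w1 * u + w2 * x0"
  define k where "k = w1 * (w2 * r * x0 - s)"
  have pos: "0 < D" "0 < E" using r D by (simp_all add: D_def E_def)
  have "E * (x0 - w2 * s)\<^sup>2 - D * E * x0\<^sup>2 + (D * u + k)\<^sup>2
      = D * E * u\<^sup>2 - D * E * v\<^sup>2 + D * (v - s)\<^sup>2"
  proof -
    \<comment> \<open>After \<open>w1\<^sup>2 = 1 - w2\<^sup>2\<close> both sides are linear in \<open>w1\<close> and agree as polynomials.\<close>
    have w1: "w1 * w1 = 1 - w2 * w2" using w by (simp add: power2_eq_square)
    define m where "m = w2 * r * x0 - s"
    have km: "k = w1 * m" by (simp add: k_def m_def)
    have k2: "(D * u + k)\<^sup>2 = D * D * (u * u) + 2 * D * u * w1 * m + (w1 * w1) * (m * m)"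
      unfolding km by (simp add: power2_eq_square algebra_simps)
    have v2: "v\<^sup>2 = (w1 * w1) * (u * u) + 2 * w1 * w2 * u * x0 + w2 * w2 * (x0 * x0)"
      by (simp add: v_def power2_eq_square algebra_simps)
    have vs: "(v - s)\<^sup>2 = v\<^sup>2 - 2 * s * (w1 * u + w2 * x0) + s * s"
      by (simp add: v_def power2_eq_square algebra_simps)
    show ?thesis
      unfolding k2 vs v2 w1 unfolding D_def E_def m_def by (simp add: power2_eq_square algebra_simps)
  qed
  then have "(E * (x0 - w2 * s)\<^sup>2 - D * E * x0\<^sup>2 + (D * u + k)\<^sup>2) / (D * E)
      = (D * E * u\<^sup>2 - D * E * v\<^sup>2 + D * (v - s)\<^sup>2) / (D * E)"
    by simp
  moreover have "(E * (x0 - w2 * s)\<^sup>2 - D * E * x0\<^sup>2 + (D * u + k)\<^sup>2) / (D * E)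
      = (x0 - w2 * s)\<^sup>2 / D - x0\<^sup>2 + (u + k / D)\<^sup>2 / (E / D)"
  proof -
    have "u + k / D = (D * u + k) / D" using pos by (simp add: field_simps)
    then have "(u + k / D)\<^sup>2 / (E / D) = (D * u + k)\<^sup>2 / (D * E)"
      using pos by (simp add: power_divide power2_eq_square)
    then show ?thesis using pos by (simp add: add_divide_distrib diff_divide_distrib)
  qed
  moreover have "(D * E * u\<^sup>2 - D * E * v\<^sup>2 + D * (v - s)\<^sup>2) / (D * E) = u\<^sup>2 - v\<^sup>2 + (v - s)\<^sup>2 / E"
    using pos by (simp add: add_divide_distrib diff_divide_distrib)
  moreover have "k / D = w1 / D * (w2 * r * x0 - s)" by (simp add: k_def)
  ultimately show ?thesis
    unfolding D_def[symmetric] E_def[symmetric] v_def[symmetric] by simp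
qed

lemma mvn_density_one:
  assumes "0 < p"
  shows "mvn_density p (1\<^sub>m p) x = exp (- (\<Sum>j<p. (x j)\<^sup>2) / 2) / sqrt ((2 * pi) ^ p)"
proof -
  have "spiked_cov p (\<lambda>_. 0) = 1\<^sub>m p" by (rule eq_matI) (auto simp: spiked_cov_def)
  then show ?thesis using mvn_density_spiked_cov[of p "\<lambda>_. 0" x] assms by simp
qed

lemma measurable_mvn_density_spiked_cov:
  assumes "0 < p" "d 0 = 0" "(\<Sum>k<p. (d k)\<^sup>2) < 1"
  shows "mvn_density p (spiked_cov p d) \<in> borel_measurable (\<Pi>\<^sub>M j\<in>{..<p}. borel)"
proof -
  have [measurable]: "(\<lambda>x. x 0) \<in> borel_measurable (\<Pi>\<^sub>M j\<in>{..<p}. borel :: real measure)"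
    using assms(1) by (intro measurable_component_singleton) simp
  show ?thesis
    unfolding mvn_density_spiked_cov[where d = d, OF assms, abs_def] by measurable
qed

lemma measurable_mvn_density_one:
  assumes "0 < p"
  shows "mvn_density p (1\<^sub>m p) \<in> borel_measurable (\<Pi>\<^sub>M j\<in>{..<p}. borel)"
  unfolding mvn_density_one[OF assms, abs_def] by measurable

lemma inv_mat_one: "inv_mat (1\<^sub>m p) = 1\<^sub>m p"
  by (rule inv_mat_eqI) auto

lemma sum_subset_of_bool:
  fixes g :: "nat \<Rightarrow> real"
  assumes "S \<subseteq> {..<p}"
  shows "(\<Sum>j<p. of_bool (j \<in> S) * g j) = (\<Sum>j\<in>S. g j)"
proof -
  have "(\<Sum>j<p. of_bool (j \<in> S) * g j) = (\<Sum>j\<in>S. of_bool (j \<in> S) * g j)"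
    using assms by (intro sum.mono_neutral_right) auto
  then show ?thesis by simp
qed

lemma measurable_sample_prod:
  assumes "K \<in> borel_measurable (row_space p)"
  shows "(\<lambda>z. \<Prod>i<n. K (z i) :: real) \<in> borel_measurable (sample_space n p)"
  unfolding sample_space_def
proof (rule borel_measurable_prod)
  fix i assume "i \<in> {..<n}"
  then have "(\<lambda>z. z i) \<in> (\<Pi>\<^sub>M i\<in>{..<n}. row_space p) \<rightarrow>\<^sub>M row_space p"
    by (rule measurable_component_singleton)
  from measurable_compose[OF this assms]
  show "(\<lambda>z. K (z i)) \<in> borel_measurable (\<Pi>\<^sub>M i\<in>{..<n}. row_space p)" .
qed

text \<open>
  The alternatives to \<open>(\<beta>, I, \<sigma>)\<close> in the direction \<open>(w1, w2)\<close> and of strength \<open>\<rho>\<close>.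
\<close>

locale spiked_alternative =
  fixes p :: nat and \<beta> :: "real Matrix.vec" and \<sigma> w1 w2 \<rho> :: real
  assumes p: "0 < p" and \<beta>: "\<beta> \<in> carrier_vec p" and \<sigma>: "0 < \<sigma>" and w: "w1\<^sup>2 + w2\<^sup>2 = 1"
begin

text \<open>
  A covariate that enters \<open>v\<close> must not be in \<open>S\<close>: \<open>v\<close> and the sum over \<open>S\<close> have to be independent before
  the correlation is introduced.
\<close>

definition admissible :: "nat set \<Rightarrow> bool" where
  "admissible S \<longleftrightarrow> S \<subseteq> {..<p} \<and> (w2 = 0 \<or> 0 \<notin> S) \<and> \<rho>\<^sup>2 * card S < 1"

lemma w2_le: "w2\<^sup>2 \<le> 1"
  using w by (metis le_add_same_cancel2 zero_le_power2)

lemma denominator_pos: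
  assumes "admissible S"
  shows "0 < 1 - w2\<^sup>2 * (\<rho>\<^sup>2 * card S)" "1 - \<rho>\<^sup>2 * card S \<le> 1 - w2\<^sup>2 * (\<rho>\<^sup>2 * card S)"
proof -
  have "w2\<^sup>2 * (\<rho>\<^sup>2 * card S) \<le> 1 * (\<rho>\<^sup>2 * card S)"
    using w2_le by (intro mult_right_mono) auto
  then show "1 - \<rho>\<^sup>2 * card S \<le> 1 - w2\<^sup>2 * (\<rho>\<^sup>2 * card S)" by simp
  then show "0 < 1 - w2\<^sup>2 * (\<rho>\<^sup>2 * card S)" using assms by (simp add: admissible_def)
qed

lemma spike_dir_admissible:
  assumes "admissible S"
  shows "spike_dir w2 \<rho> S 0 = 0" "(\<Sum>k<p. (spike_dir w2 \<rho> S k)\<^sup>2) = w2\<^sup>2 * (\<rho>\<^sup>2 * card S)"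
    "(\<Sum>k<p. spike_dir w2 \<rho> S k * x k) = w2 * (\<Sum>j\<in>S. \<rho> * x j)"
proof -
  have S: "S \<subseteq> {..<p}" using assms by (simp add: admissible_def)
  show "spike_dir w2 \<rho> S 0 = 0" using assms by (auto simp: spike_dir_def admissible_def)
  have "(\<Sum>k<p. (spike_dir w2 \<rho> S k)\<^sup>2) = (\<Sum>k<p. of_bool (k \<in> S) * (w2 * \<rho>)\<^sup>2)"
    by (intro sum.cong) (auto simp: spike_dir_def)
  then show "(\<Sum>k<p. (spike_dir w2 \<rho> S k)\<^sup>2) = w2\<^sup>2 * (\<rho>\<^sup>2 * card S)"
    by (simp add: sum_subset_of_bool[OF S] power_mult_distrib)
  have "(\<Sum>k<p. spike_dir w2 \<rho> S k * x k) = (\<Sum>k<p. of_bool (k \<in> S) * (w2 * (\<rho> * x k)))"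
    by (intro sum.cong) (auto simp: spike_dir_def)
  then show "(\<Sum>k<p. spike_dir w2 \<rho> S k * x k) = w2 * (\<Sum>j\<in>S. \<rho> * x j)"
    by (simp add: sum_subset_of_bool[OF S] sum_distrib_left)
qed

lemma alt_coef_linear_form:
  assumes "admissible S"
  shows "(\<Sum>j<p. x j * alt_coef p \<beta> \<sigma> w1 w2 \<rho> S $ j) = (\<Sum>j<p. x j * \<beta> $ j)
    + \<sigma> * (w1 / (1 - w2\<^sup>2 * (\<rho>\<^sup>2 * card S))) * ((\<Sum>j\<in>S. \<rho> * x j) - w2 * (\<rho>\<^sup>2 * card S) * x 0)"
proof -
  have S: "S \<subseteq> {..<p}" using assms by (simp add: admissible_def)
  define c where "c = \<sigma> * (w1 / (1 - w2\<^sup>2 * (\<rho>\<^sup>2 * card S)))"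
  define b where "b = w2 * (\<rho>\<^sup>2 * card S)"
  have "(\<Sum>j<p. x j * alt_coef p \<beta> \<sigma> w1 w2 \<rho> S $ j)
      = (\<Sum>j<p. x j * \<beta> $ j + c * (of_bool (j \<in> S) * (\<rho> * x j) - b * (of_bool (j = 0) * x j)))"
  proof (rule sum.cong[OF refl])
    fix j assume "j \<in> {..<p}"
    then have eq: "alt_coef p \<beta> \<sigma> w1 w2 \<rho> S $ j = \<beta> $ j + c * (of_bool (j \<in> S) * \<rho> - of_bool (j = 0) * b)"
      by (simp add: alt_coef_def c_def b_def)
    show "x j * alt_coef p \<beta> \<sigma> w1 w2 \<rho> S $ j = x j * \<beta> $ j + c * (of_bool (j \<in> S) * (\<rho> * x j) - b * (of_bool (j = 0) * x j))"
      unfolding eq by (simp only: distrib_left right_diff_distrib left_diff_distrib ac_simps)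
  qed
  also have "\<dots> = (\<Sum>j<p. x j * \<beta> $ j) + c * ((\<Sum>j\<in>S. \<rho> * x j) - b * x 0)"
    using p by (simp only: sum.distrib sum_subtractf sum_distrib_left[symmetric] sum_of_bool_mult sum_subset_of_bool[OF S])
  finally show ?thesis by (simp add: c_def b_def)
qed

text \<open>
  The alternative parameter has exactly the likelihood ratio that was prescribed: the exponents agree
  by \<open>normal_ratio_exponent_identity\<close>, and the variances \<open>D\<close> of \<open>x\<^sub>0\<close> given the other covariates and
  \<open>\<sigma>\<^sup>2 (1 - r) / D\<close> of the noise multiply to \<open>\<sigma>\<^sup>2 (1 - r)\<close>.
\<close>

lemma row_density_eq:
  assumes S: "admissible S"
  shows "mvn_density p (spiked_cov p (spike_dir w2 \<rho> S)) x
      * normal_density 0 (\<sigma> * sqrt ((1 - \<rho>\<^sup>2 * card S) / (1 - w2\<^sup>2 * (\<rho>\<^sup>2 * card S))))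
          (y - (\<Sum>j<p. x j * alt_coef p \<beta> \<sigma> w1 w2 \<rho> S $ j))
    = mvn_density p (1\<^sub>m p) x * normal_density 0 \<sigma> (y - (\<Sum>j<p. x j * \<beta> $ j)) * row_ratio p \<beta> \<sigma> w1 w2 \<rho> S (y, x)"
proof -
  define r where "r = \<rho>\<^sup>2 * card S"
  define D where "D = 1 - w2\<^sup>2 * r"
  define s where "s = (\<Sum>j\<in>S. \<rho> * x j)"
  define u where "u = (y - (\<Sum>j<p. x j * \<beta> $ j)) / \<sigma>"
  define X where "X = (\<Sum>j<p. (x j)\<^sup>2)"
  define P where "P = (2 * pi) ^ p"
  define t where "t = u + w1 / D * (w2 * r * x 0 - s)"
  define \<sigma>' where "\<sigma>' = \<sigma> * sqrt ((1 - r) / D)"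
  have r: "r < 1" using S by (simp add: r_def admissible_def)
  have D: "0 < D" using denominator_pos[OF S] by (simp add: D_def r_def)
  have wr: "w2\<^sup>2 * r < 1" using D by (simp add: D_def)
  have P: "0 < P" by (simp add: P_def)
  have \<sigma>'2: "\<sigma>'\<^sup>2 = \<sigma>\<^sup>2 * ((1 - r) / D)" using r D by (simp add: \<sigma>'_def power_mult_distrib)
  have yb: "y - (\<Sum>j<p. x j * \<beta> $ j) = \<sigma> * u" using \<sigma> by (simp add: u_def)
  have ya: "y - (\<Sum>j<p. x j * alt_coef p \<beta> \<sigma> w1 w2 \<rho> S $ j) = \<sigma> * t"
  proof -
    have "(\<Sum>j<p. x j * alt_coef p \<beta> \<sigma> w1 w2 \<rho> S $ j)
        = (\<Sum>j<p. x j * \<beta> $ j) + \<sigma> * (w1 / D) * (s - w2 * r * x 0)"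
      unfolding D_def r_def s_def by (rule alt_coef_linear_form[OF S])
    then have "y - (\<Sum>j<p. x j * alt_coef p \<beta> \<sigma> w1 w2 \<rho> S $ j) = \<sigma> * u - \<sigma> * (w1 / D) * (s - w2 * r * x 0)"
      using yb by simp
    then show ?thesis by (simp add: t_def algebra_simps)
  qed
  have dens1: "mvn_density p (spiked_cov p (spike_dir w2 \<rho> S)) x = exp (- (X - (x 0)\<^sup>2 + (x 0 - w2 * s)\<^sup>2 / D) / 2) / sqrt (P * D)"
    using D p spike_dir_admissible[OF S] wr
    by (subst mvn_density_spiked_cov) (simp_all add: r_def[symmetric] D_def[symmetric] s_def[symmetric] X_def P_def)
  have n1: "normal_density 0 \<sigma>' (\<sigma> * t) = exp (- (t\<^sup>2 / ((1 - r) / D)) / 2) / sqrt (2 * pi * \<sigma>\<^sup>2 * ((1 - r) / D))"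
  proof -
    have "(\<sigma> * t - 0)\<^sup>2 / (2 * \<sigma>'\<^sup>2) = t\<^sup>2 / ((1 - r) / D) / 2"
      unfolding \<sigma>'2 using \<sigma> by (simp add: power_mult_distrib)
    then show ?thesis unfolding normal_density_def minus_divide_left[symmetric] by (simp add: \<sigma>'2 mult.assoc)
  qed
  have n0: "normal_density 0 \<sigma> (\<sigma> * u) = exp (- u\<^sup>2 / 2) / sqrt (2 * pi * \<sigma>\<^sup>2)"
    using \<sigma> by (simp add: normal_density_def power_mult_distrib)
  have ratio: "row_ratio p \<beta> \<sigma> w1 w2 \<rho> S (y, x)
      = exp ((w1 * u + w2 * x 0)\<^sup>2 / 2 - (w1 * u + w2 * x 0 - s)\<^sup>2 / (2 * (1 - r))) / sqrt (1 - r)"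
    by (simp add: row_ratio_def normal_ratio_def row_score_def r_def s_def u_def)
  have expo: "- (X - (x 0)\<^sup>2 + (x 0 - w2 * s)\<^sup>2 / D) / 2 + - (t\<^sup>2 / ((1 - r) / D)) / 2
      = - X / 2 + - u\<^sup>2 / 2 + ((w1 * u + w2 * x 0)\<^sup>2 / 2 - (w1 * u + w2 * x 0 - s)\<^sup>2 / (2 * (1 - r)))"
  proof -
    have "(x 0 - w2 * s)\<^sup>2 / D - (x 0)\<^sup>2 + t\<^sup>2 / ((1 - r) / D)
        = u\<^sup>2 - (w1 * u + w2 * x 0)\<^sup>2 + (w1 * u + w2 * x 0 - s)\<^sup>2 / (1 - r)"
      using normal_ratio_exponent_identity[OF w r, of "x 0" s u] D unfolding t_def D_def by simp
    moreover have "(w1 * u + w2 * x 0 - s)\<^sup>2 / (2 * (1 - r)) = (w1 * u + w2 * x 0 - s)\<^sup>2 / (1 - r) / 2"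
      by simp
    moreover have "- (X - b + a) / 2 + - c / 2 = - X / 2 + - d / 2 + (e / 2 - q)"
      if "a - b + c = d - e + f" "q = f / 2" for a b c d e f q :: real
      using that by (simp add: field_simps)
    ultimately show ?thesis by blast
  qed
  have nrm: "sqrt (P * D) * sqrt (2 * pi * \<sigma>\<^sup>2 * ((1 - r) / D)) = sqrt P * sqrt (2 * pi * \<sigma>\<^sup>2) * sqrt (1 - r)"
    using D r P by (simp add: real_sqrt_mult real_sqrt_divide)
  have "mvn_density p (spiked_cov p (spike_dir w2 \<rho> S)) x * normal_density 0 \<sigma>' (\<sigma> * t)
      = exp (- (X - (x 0)\<^sup>2 + (x 0 - w2 * s)\<^sup>2 / D) / 2 + - (t\<^sup>2 / ((1 - r) / D)) / 2)
        / (sqrt (P * D) * sqrt (2 * pi * \<sigma>\<^sup>2 * ((1 - r) / D)))"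
    unfolding dens1 n1 exp_add by simp
  also have "\<dots> = exp (- X / 2) / sqrt P * (exp (- u\<^sup>2 / 2) / sqrt (2 * pi * \<sigma>\<^sup>2))
      * (exp ((w1 * u + w2 * x 0)\<^sup>2 / 2 - (w1 * u + w2 * x 0 - s)\<^sup>2 / (2 * (1 - r))) / sqrt (1 - r))"
    unfolding expo nrm exp_add by simp
  also have "\<dots> = mvn_density p (1\<^sub>m p) x * normal_density 0 \<sigma> (\<sigma> * u) * row_ratio p \<beta> \<sigma> w1 w2 \<rho> S (y, x)"
    unfolding ratio n0 mvn_density_one[OF p] X_def P_def ..
  finally show ?thesis
    unfolding ya yb \<sigma>'_def r_def D_def .
qed

lemma row_ratio_nonneg: "admissible S \<Longrightarrow> 0 \<le> row_ratio p \<beta> \<sigma> w1 w2 \<rho> S z"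
  by (simp add: row_ratio_def normal_ratio_def admissible_def)

lemma measurable_row_ratio:
  assumes "admissible S"
  shows "row_ratio p \<beta> \<sigma> w1 w2 \<rho> S \<in> borel_measurable (row_space p)"
proof -
  have c: "(\<lambda>z. snd z j) \<in> borel_measurable (row_space p)" if "j < p" for j
    using that by (intro measurable_compose[OF measurable_snd measurable_component_singleton]) simp
  have [measurable]: "(\<lambda>z. \<Sum>j\<in>S. \<rho> * snd z j) \<in> borel_measurable (row_space p)"
    using assms by (intro borel_measurable_sum borel_measurable_times c) (auto simp: admissible_def)
  have [measurable]: "(\<lambda>z. snd z 0) \<in> borel_measurable (row_space p)" by (rule c[OF p])
  have [measurable]: "(\<lambda>z. \<Sum>j<p. snd z j * \<beta> $ j) \<in> borel_measurable (row_space p)"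
    by (intro borel_measurable_sum borel_measurable_times c) auto
  show ?thesis
    unfolding row_ratio_def[abs_def] normal_ratio_def row_score_def case_prod_beta by measurable
qed

lemma alt_row_law:
  assumes S: "admissible S"
  shows "row_law p (alt_coef p \<beta> \<sigma> w1 w2 \<rho> S) (inv_mat (spiked_prec p (spike_dir w2 \<rho> S)))
      (\<sigma> * sqrt ((1 - \<rho>\<^sup>2 * card S) / (1 - w2\<^sup>2 * (\<rho>\<^sup>2 * card S))))
    = density (row_law p \<beta> (1\<^sub>m p) \<sigma>) (\<lambda>z. ennreal (row_ratio p \<beta> \<sigma> w1 w2 \<rho> S z))"
proof -
  note d = spike_dir_admissible[OF S]
  have lt: "(\<Sum>k<p. (spike_dir w2 \<rho> S k)\<^sup>2) < 1" using denominator_pos[OF S] by (simp add: d)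
  show ?thesis
    unfolding inv_spiked(2)[where d = "spike_dir w2 \<rho> S", OF p d(1) lt]
  proof (rule row_law_eq_density)
    show "0 \<le> mvn_density p (spiked_cov p (spike_dir w2 \<rho> S)) x" for x
      using lt by (subst mvn_density_spiked_cov[where d = "spike_dir w2 \<rho> S", OF p d(1) lt]) auto
  qed (use row_density_eq[OF S] row_ratio_nonneg[OF S] measurable_row_ratio[OF S] measurable_mvn_density_one[OF p]
      measurable_mvn_density_spiked_cov[where d = "spike_dir w2 \<rho> S", OF p d(1) lt] mvn_density_one[OF p] in auto)
qed

lemma sample_law_one: "sample_law n p (\<beta>, 1\<^sub>m p, \<sigma>) = (\<Pi>\<^sub>M i\<in>{..<n}. row_law p \<beta> (1\<^sub>m p) \<sigma>)"
  using sample_law_eq_PiM[OF \<beta> \<sigma>, of "1\<^sub>m p" n] prob_space_row_law_one[OF \<sigma>] measurable_mvn_density_one[OF p]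
  by (simp add: inv_mat_one prob_space_imp_sigma_finite)

lemma prob_space_sample_law_one: "prob_space (sample_law n p (\<beta>, 1\<^sub>m p, \<sigma>))"
  unfolding sample_law_one by (intro prob_space_PiM prob_space_row_law_one \<sigma>)

text \<open>
  The product law of the alternative is obtained from the row densities, which also supply the
  sigma-finiteness that product measures require.
\<close>

lemma sample_law_alt:
  assumes S: "admissible S"
  shows "sample_law n p (alt_param p \<beta> \<sigma> w1 w2 \<rho> S)
    = density (sample_law n p (\<beta>, 1\<^sub>m p, \<sigma>)) (\<lambda>z. ennreal (\<Prod>i<n. row_ratio p \<beta> \<sigma> w1 w2 \<rho> S (z i)))"
proof -
  note d = spike_dir_admissible[OF S]
  have lt: "(\<Sum>k<p. (spike_dir w2 \<rho> S k)\<^sup>2) < 1" using denominator_pos[OF S] by (simp add: d)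
  have sf: "sigma_finite_measure (row_law p \<beta> (1\<^sub>m p) \<sigma>)"
    by (intro prob_space_imp_sigma_finite prob_space_row_law_one \<sigma>)
  have m: "row_ratio p \<beta> \<sigma> w1 w2 \<rho> S \<in> borel_measurable (row_law p \<beta> (1\<^sub>m p) \<sigma>)"
    using measurable_row_ratio[OF S] by (simp cong: measurable_cong_sets)
  have sd: "sigma_finite_measure (density (row_law p \<beta> (1\<^sub>m p) \<sigma>) (\<lambda>z. ennreal (row_ratio p \<beta> \<sigma> w1 w2 \<rho> S z)))"
    by (rule sigma_finite_density_real[OF sf m])
  have pos: "0 < \<sigma> * sqrt ((1 - \<rho>\<^sup>2 * card S) / (1 - w2\<^sup>2 * (\<rho>\<^sup>2 * card S)))"
    using \<sigma> S denominator_pos[OF S] by (simp add: admissible_def)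
  have "sample_law n p (alt_param p \<beta> \<sigma> w1 w2 \<rho> S)
      = (\<Pi>\<^sub>M i\<in>{..<n}. density (row_law p \<beta> (1\<^sub>m p) \<sigma>) (\<lambda>z. ennreal (row_ratio p \<beta> \<sigma> w1 w2 \<rho> S z)))"
    unfolding alt_param_def alt_row_law[OF S, symmetric]
  proof (rule sample_law_eq_PiM[OF _ pos])
    show "alt_coef p \<beta> \<sigma> w1 w2 \<rho> S \<in> carrier_vec p" by (simp add: alt_coef_def)
    show "mvn_density p (inv_mat (spiked_prec p (spike_dir w2 \<rho> S))) \<in> borel_measurable (\<Pi>\<^sub>M j\<in>{..<p}. borel)"
      unfolding inv_spiked(2)[where d = "spike_dir w2 \<rho> S", OF p d(1) lt]
      by (rule measurable_mvn_density_spiked_cov[where d = "spike_dir w2 \<rho> S", OF p d(1) lt])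
  qed (use sd alt_row_law[OF S] in simp)
  also have "\<dots> = density (\<Pi>\<^sub>M i\<in>{..<n}. row_law p \<beta> (1\<^sub>m p) \<sigma>) (\<lambda>z. ennreal (\<Prod>i<n. row_ratio p \<beta> \<sigma> w1 w2 \<rho> S (z i)))"
    using sf m row_ratio_nonneg[OF S] by (intro PiM_density) auto
  finally show ?thesis by (simp add: sample_law_one)
qed

lemma nn_integral_row_ratio_mult:
  assumes S: "admissible S" and T: "admissible T"
  shows "(\<integral>\<^sup>+z. ennreal (row_ratio p \<beta> \<sigma> w1 w2 \<rho> S z * row_ratio p \<beta> \<sigma> w1 w2 \<rho> T z) \<partial>row_law p \<beta> (1\<^sub>m p) \<sigma>)
    = ennreal (1 / (1 - \<rho>\<^sup>2 * card (S \<inter> T)))"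
proof -
  define I where "I = insert p {..<p}"
  define c where "c i = (if i = p then w1 else if i = 0 then w2 else 0)" for i
  have score: "row_score p \<beta> \<sigma> w1 w2 (row_map p \<beta> (restrict x {..<p}, \<sigma> * x p)) = (\<Sum>i\<in>I. c i * x i)" for x
  proof -
    have "(\<Sum>i<p. c i * x i) = (\<Sum>i<p. of_bool (i = 0) * (w2 * x i))"
      by (intro sum.cong) (auto simp: c_def)
    also have "\<dots> = w2 * x 0" using p by (simp only: sum_of_bool_mult)
    finally show ?thesis
      using \<sigma> p by (simp add: row_score_def row_map_def I_def) (simp add: c_def)
  qed
  have lin: "(\<Sum>j\<in>U. \<rho> * snd (row_map p \<beta> (restrict x {..<p}, \<sigma> * x p)) j) = (\<Sum>j\<in>U. \<rho> * x j)"
    if "admissible U" for U x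
    using that by (intro sum.cong) (auto simp: row_map_def admissible_def)
  have c1: "(\<Sum>i\<in>I. (c i)\<^sup>2) = 1"
  proof -
    have "(\<Sum>i<p. (c i)\<^sup>2) = (\<Sum>i<p. of_bool (i = 0) * w2\<^sup>2)"
      by (intro sum.cong) (auto simp: c_def)
    also have "\<dots> = w2\<^sup>2" using p by (simp only: sum_of_bool_mult)
    finally show ?thesis using w by (simp add: I_def) (simp add: c_def)
  qed
  have "(\<lambda>z. ennreal (row_ratio p \<beta> \<sigma> w1 w2 \<rho> S z * row_ratio p \<beta> \<sigma> w1 w2 \<rho> T z)) \<in> borel_measurable (row_space p)"
    using measurable_row_ratio[OF S] measurable_row_ratio[OF T] by measurable
  from nn_integral_row_law_one[OF \<sigma> this]
  have "(\<integral>\<^sup>+z. ennreal (row_ratio p \<beta> \<sigma> w1 w2 \<rho> S z * row_ratio p \<beta> \<sigma> w1 w2 \<rho> T z) \<partial>row_law p \<beta> (1\<^sub>m p) \<sigma>)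
    = (\<integral>\<^sup>+x. ennreal (normal_ratio (\<rho>\<^sup>2 * card S) (\<Sum>i\<in>I. c i * x i) (\<Sum>i\<in>S. \<rho> * x i)
              * normal_ratio (\<rho>\<^sup>2 * card T) (\<Sum>i\<in>I. c i * x i) (\<Sum>i\<in>T. \<rho> * x i)) \<partial>(\<Pi>\<^sub>M i\<in>I. std_normal))"
    by (simp add: row_ratio_def score lin[OF S] lin[OF T] I_def[symmetric])
  also have "\<dots> = ennreal (1 / (1 - \<rho>\<^sup>2 * card (S \<inter> T)))"
    using S T by (intro nn_integral_normal_ratio_mult c1) (auto simp: I_def c_def admissible_def)
  finally show ?thesis .
qed

lemma nn_integral_sample_ratio_mult:
  assumes S: "admissible S" and T: "admissible T"
  shows "(\<integral>\<^sup>+z. ennreal ((\<Prod>i<n. row_ratio p \<beta> \<sigma> w1 w2 \<rho> S (z i)) * (\<Prod>i<n. row_ratio p \<beta> \<sigma> w1 w2 \<rho> T (z i)))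
      \<partial>sample_law n p (\<beta>, 1\<^sub>m p, \<sigma>))
    = ennreal ((1 / (1 - \<rho>\<^sup>2 * card (S \<inter> T))) ^ n)"
proof -
  let ?G = "\<lambda>z. ennreal (row_ratio p \<beta> \<sigma> w1 w2 \<rho> S z * row_ratio p \<beta> \<sigma> w1 w2 \<rho> T z)"
  interpret R: product_sigma_finite "\<lambda>_::nat. row_law p \<beta> (1\<^sub>m p) \<sigma>"
    by (intro product_sigma_finite.intro prob_space_imp_sigma_finite prob_space_row_law_one \<sigma>)
  have "?G \<in> borel_measurable (row_space p)"
    using measurable_row_ratio[OF S] measurable_row_ratio[OF T] by measurable
  then have G: "?G \<in> borel_measurable (row_law p \<beta> (1\<^sub>m p) \<sigma>)"
    by (simp cong: measurable_cong_sets)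
  have "(\<integral>\<^sup>+z. ennreal ((\<Prod>i<n. row_ratio p \<beta> \<sigma> w1 w2 \<rho> S (z i)) * (\<Prod>i<n. row_ratio p \<beta> \<sigma> w1 w2 \<rho> T (z i)))
      \<partial>sample_law n p (\<beta>, 1\<^sub>m p, \<sigma>))
    = (\<integral>\<^sup>+z. (\<Prod>i<n. ?G (z i)) \<partial>(\<Pi>\<^sub>M i\<in>{..<n}. row_law p \<beta> (1\<^sub>m p) \<sigma>))"
    unfolding sample_law_one
    by (intro nn_integral_cong) (simp add: prod_ennreal row_ratio_nonneg S T prod.distrib)
  also have "\<dots> = (\<Prod>i<n. \<integral>\<^sup>+z. ?G z \<partial>row_law p \<beta> (1\<^sub>m p) \<sigma>)"
    by (rule R.product_nn_integral_prod) (auto intro: G)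
  also have "\<dots> = ennreal ((1 / (1 - \<rho>\<^sup>2 * card (S \<inter> T))) ^ n)"
  proof -
    have "card (S \<inter> T) \<le> card S"
      using S by (intro card_mono) (auto simp: admissible_def intro: finite_subset)
    then have "\<rho>\<^sup>2 * card (S \<inter> T) \<le> \<rho>\<^sup>2 * card S" by (intro mult_left_mono) auto
    then have "\<rho>\<^sup>2 * card (S \<inter> T) < 1" using S by (simp add: admissible_def)
    then show ?thesis unfolding nn_integral_row_ratio_mult[OF S T] by (simp add: ennreal_power)
  qed
  finally show ?thesis .
qed

lemma nn_integral_sample_ratio:
  assumes S: "admissible S"
  shows "(\<integral>\<^sup>+z. ennreal (\<Prod>i<n. row_ratio p \<beta> \<sigma> w1 w2 \<rho> S (z i)) \<partial>sample_law n p (\<beta>, 1\<^sub>m p, \<sigma>)) = 1"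
proof -
  have "admissible {}" by (simp add: admissible_def)
  moreover have "row_ratio p \<beta> \<sigma> w1 w2 \<rho> {} z = 1" for z
    by (simp add: row_ratio_def normal_ratio_def)
  ultimately show ?thesis using nn_integral_sample_ratio_mult[OF S, of "{}" n] by simp
qed

lemma alt_param_in_Theta:
  assumes S: "admissible S" and \<sigma>2: "\<sigma> \<le> M2" and M1: "1 < M1"
    and sp: "w2\<^sup>2 * (\<rho>\<^sup>2 * card S) \<le> (1 - 1 / M1)\<^sup>2" and k: "l0_norm \<beta> + card (insert 0 S) \<le> k"
  shows "alt_param p \<beta> \<sigma> w1 w2 \<rho> S \<in> Theta p M1 M2 k"
proof -
  note d = spike_dir_admissible[OF S]
  have R: "(\<Sum>k<p. (spike_dir w2 \<rho> S k)\<^sup>2) \<le> (1 - 1 / M1)\<^sup>2" using sp by (simp add: d)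
  have finS: "finite S" using S by (auto simp: admissible_def intro: finite_subset)
  have "{i. i < p \<and> alt_coef p \<beta> \<sigma> w1 w2 \<rho> S $ i \<noteq> 0} \<subseteq> {i. i < p \<and> \<beta> $ i \<noteq> 0} \<union> insert 0 S"
    by (auto simp: alt_coef_def)
  then have "card {i. i < p \<and> alt_coef p \<beta> \<sigma> w1 w2 \<rho> S $ i \<noteq> 0} \<le> card ({i. i < p \<and> \<beta> $ i \<noteq> 0} \<union> insert 0 S)"
    using finS by (intro card_mono) auto
  also have "\<dots> \<le> card {i. i < p \<and> \<beta> $ i \<noteq> 0} + card (insert 0 S)" by (rule card_Un_le)
  also have "\<dots> \<le> k" using k \<beta> by (simp add: l0_norm_def)
  finally have l0: "l0_norm (alt_coef p \<beta> \<sigma> w1 w2 \<rho> S) \<le> k"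
    by (simp add: l0_norm_def alt_coef_def)
  have "0 < (1 - \<rho>\<^sup>2 * card S) / (1 - w2\<^sup>2 * (\<rho>\<^sup>2 * card S))" "(1 - \<rho>\<^sup>2 * card S) / (1 - w2\<^sup>2 * (\<rho>\<^sup>2 * card S)) \<le> 1"
    using denominator_pos[OF S] S by (auto simp: admissible_def)
  then have "0 < \<sigma> * sqrt ((1 - \<rho>\<^sup>2 * card S) / (1 - w2\<^sup>2 * (\<rho>\<^sup>2 * card S)))"
    "\<sigma> * sqrt ((1 - \<rho>\<^sup>2 * card S) / (1 - w2\<^sup>2 * (\<rho>\<^sup>2 * card S))) \<le> \<sigma> * 1"
    using \<sigma> by (auto intro!: mult_left_mono simp del: mult_1_right)
  then show ?thesis
    using l0 \<sigma>2 spiked_prec_spectrum_bounds[where d = "spike_dir w2 \<rho> S", OF p d(1) M1 R]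
    by (simp add: Theta_def alt_param_def transpose_spiked_prec) (simp add: alt_coef_def)
qed

lemma expected_length_ge_of_alternatives:
  assumes CI: "CI \<in> conf_intervals n p \<alpha> (Theta p M1 M2 k) (\<lambda>b. b $ 0)"
    and \<theta>0: "(\<beta>, 1\<^sub>m p, \<sigma>) \<in> Theta p M1 M2 k"
    and F: "finite F" "F \<noteq> {}" and M1: "1 < M1"
    and adm: "\<And>f. f \<in> F \<Longrightarrow> admissible (S f)"
    and sp: "\<And>f. f \<in> F \<Longrightarrow> w2\<^sup>2 * (\<rho>\<^sup>2 * card (S f)) \<le> (1 - 1 / M1)\<^sup>2"
    and k: "\<And>f. f \<in> F \<Longrightarrow> l0_norm \<beta> + card (insert 0 (S f)) \<le> k"
    and t: "\<And>f. f \<in> F \<Longrightarrow> alt_coef p \<beta> \<sigma> w1 w2 \<rho> (S f) $ 0 = \<beta> $ 0 + \<delta>"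
    and chi: "(\<Sum>f\<in>F. \<Sum>g\<in>F. (1 / (1 - \<rho>\<^sup>2 * card (S f \<inter> S g))) ^ n) \<le> (real (card F))\<^sup>2 * (1 + \<eta>\<^sup>2)"
    and \<eta>: "0 < \<eta>"
  shows "ennreal (\<bar>\<delta>\<bar> * (1 - 2 * \<alpha> - \<eta>)) \<le> expected_length n p (\<beta>, 1\<^sub>m p, \<sigma>) CI"
proof -
  have lt: "\<rho>\<^sup>2 * card (S f \<inter> S g) < 1" if "f \<in> F" for f g
  proof -
    have "card (S f \<inter> S g) \<le> card (S f)"
      using adm[OF that] by (intro card_mono) (auto simp: admissible_def intro: finite_subset)
    then have "\<rho>\<^sup>2 * card (S f \<inter> S g) \<le> \<rho>\<^sup>2 * card (S f)" by (intro mult_left_mono) auto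
    then show ?thesis using adm[OF that] by (simp add: admissible_def)
  qed
  define L where "L f z = (if f \<in> F then \<Prod>i<n. row_ratio p \<beta> \<sigma> w1 w2 \<rho> (S f) (z i) else 0)" for f z
  define c where "c f g = (if f \<in> F \<and> g \<in> F then (1 / (1 - \<rho>\<^sup>2 * card (S f \<inter> S g))) ^ n else 0)" for f g
  have "ennreal (\<bar>(\<beta> $ 0 + \<delta>) - fst (\<beta>, 1\<^sub>m p :: real mat, \<sigma>) $ 0\<bar> * (1 - 2 * \<alpha> - \<eta>))
      \<le> expected_length n p (\<beta>, 1\<^sub>m p, \<sigma>) CI"
  proof (rule expected_length_ge[OF CI prob_space_sample_law_one \<theta>0 F, where \<theta> = "\<lambda>f. alt_param p \<beta> \<sigma> w1 w2 \<rho> (S f)" and L = L and c = c])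
    show "alt_param p \<beta> \<sigma> w1 w2 \<rho> (S f) \<in> Theta p M1 M2 k" if "f \<in> F" for f
      using \<theta>0 that by (intro alt_param_in_Theta adm M1 sp k) (auto simp: Theta_def)
    show "fst (alt_param p \<beta> \<sigma> w1 w2 \<rho> (S f)) $ 0 = \<beta> $ 0 + \<delta>" if "f \<in> F" for f
      using t[OF that] by (simp add: alt_param_def)
    show "L f \<in> borel_measurable (sample_space n p)" if "f \<in> F" for f
      using measurable_sample_prod[OF measurable_row_ratio[OF adm[OF that]], of n] that
      by (simp add: L_def[abs_def])
    show "0 \<le> L f z" for f z by (auto simp: L_def intro!: prod_nonneg row_ratio_nonneg adm)
    show "sample_law n p (alt_param p \<beta> \<sigma> w1 w2 \<rho> (S f)) = density (sample_law n p (\<beta>, 1\<^sub>m p, \<sigma>)) (\<lambda>z. ennreal (L f z))"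
      if "f \<in> F" for f using that by (simp add: L_def sample_law_alt adm)
    show "(\<integral>\<^sup>+z. ennreal (L f z) \<partial>sample_law n p (\<beta>, 1\<^sub>m p, \<sigma>)) = 1" if "f \<in> F" for f
      using that by (simp add: L_def nn_integral_sample_ratio adm)
    show "(\<integral>\<^sup>+z. ennreal (L f z * L g z) \<partial>sample_law n p (\<beta>, 1\<^sub>m p, \<sigma>)) = ennreal (c f g)" if "f \<in> F" "g \<in> F" for f g
      using that nn_integral_sample_ratio_mult[OF adm[OF that(1)] adm[OF that(2)], of n] by (simp add: L_def c_def)
    show "0 \<le> c f g" for f g
    proof (cases "f \<in> F")
      case True
      then show ?thesis using lt[OF True, of g] by (simp add: c_def)
    qed (simp add: c_def)
    have "(\<Sum>f\<in>F. \<Sum>g\<in>F. c f g) = (\<Sum>f\<in>F. \<Sum>g\<in>F. (1 / (1 - \<rho>\<^sup>2 * card (S f \<inter> S g))) ^ n)"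
      by (intro sum.cong refl) (simp add: c_def)
    then show "(\<Sum>f\<in>F. \<Sum>g\<in>F. c f g) \<le> (real (card F))\<^sup>2 * (1 + \<eta>\<^sup>2)" using chi by simp
  qed (rule \<eta>)
  then show ?thesis by simp
qed

end

section \<open>Random supports chosen from disjoint blocks\<close>

lemma inverse_one_minus_le_exp:
  fixes x :: real
  assumes "0 \<le> x" "x \<le> 1 / 2"
  shows "1 / (1 - x) \<le> exp (2 * x)"
proof -
  have "2 * x\<^sup>2 \<le> x" using mult_right_mono[OF assms(2,1)] by (simp add: power2_eq_square)
  then have "- 2 * x \<le> ln (1 - x)" using ln_one_minus_pos_lower_bound[OF assms] by linarith
  then have "exp (- 2 * x) \<le> 1 - x" using assms by (simp add: ln_ge_iff)
  then show ?thesis using assms by (simp add: exp_minus field_simps)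
qed

text \<open>
  For \<open>f\<close> and \<open>g\<close> drawn independently and uniformly, the number of agreements is a sum of \<open>s\<close> independent
  indicators of probability \<open>1 / m\<close>; this is its generating function, without the normalisation.
\<close>

lemma sum_power_agreements:
  fixes B :: real
  shows "(\<Sum>f\<in>{..<s} \<rightarrow>\<^sub>E {..<m}. \<Sum>g\<in>{..<s} \<rightarrow>\<^sub>E {..<m}. B ^ card {i. i < s \<and> f i = g i})
    = (real m * (B + (real m - 1))) ^ s"
proof -
  have pow: "B ^ card {i. i < s \<and> f i = g i} = (\<Prod>i<s. if f i = g i then B else 1)" for f g :: "nat \<Rightarrow> nat"
  proof -
    have "{..<s} \<inter> {i. f i = g i} = {i. i < s \<and> f i = g i}" by auto
    then show ?thesis by (simp add: prod.If_cases)
  qed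
  have inner: "(\<Sum>g\<in>{..<s} \<rightarrow>\<^sub>E {..<m}. B ^ card {i. i < s \<and> f i = g i}) = (B + (real m - 1)) ^ s"
    if f: "f \<in> {..<s} \<rightarrow>\<^sub>E {..<m}" for f
  proof -
    have "(\<Sum>g\<in>{..<s} \<rightarrow>\<^sub>E {..<m}. B ^ card {i. i < s \<and> f i = g i}) = (\<Prod>i<s. \<Sum>j<m. if f i = j then B else 1)"
      unfolding pow by (rule prod_sum_PiE[symmetric]) auto
    also have "\<dots> = (\<Prod>i<s. B + (real m - 1))"
    proof (rule prod.cong[OF refl])
      fix i assume "i \<in> {..<s}"
      then have fi: "f i \<in> {..<m}" using f by auto
      have "(\<Sum>j<m. if f i = j then B else 1) = B + (\<Sum>j\<in>{..<m} - {f i}. if f i = j then B else 1)"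
        using fi by (subst sum.remove[of _ "f i"]) auto
      also have "(\<Sum>j\<in>{..<m} - {f i}. if f i = j then B else 1) = (\<Sum>j\<in>{..<m} - {f i}. 1)"
        by (intro sum.cong) auto
      also have "\<dots> = real m - 1" using fi by (simp add: of_nat_diff)
      finally show "(\<Sum>j<m. if f i = j then B else 1) = B + (real m - 1)" .
    qed
    finally show ?thesis by simp
  qed
  have "(\<Sum>f\<in>{..<s} \<rightarrow>\<^sub>E {..<m}. \<Sum>g\<in>{..<s} \<rightarrow>\<^sub>E {..<m}. B ^ card {i. i < s \<and> f i = g i})
      = (\<Sum>f\<in>{..<s} \<rightarrow>\<^sub>E {..<m}. (B + (real m - 1)) ^ s)"
    by (intro sum.cong refl inner)
  also have "\<dots> = (real m * (B + (real m - 1))) ^ s"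
    by (simp add: card_PiE power_mult_distrib)
  finally show ?thesis .
qed

section \<open>The two lower bounds\<close>

text \<open>
  A single alternative that moves \<open>\<beta>\<^sub>1\<close> alone, by \<open>\<sigma> \<tau> / sqrt n\<close>: its second moment
  \<open>(1 - \<tau>\<^sup>2 / n)\<close> to the power \<open>- n\<close> stays below \<open>exp (2 \<tau>\<^sup>2)\<close>.
\<close>

lemma expected_length_ge_parametric:
  assumes CI: "CI \<in> conf_intervals n p \<alpha> (Theta p M1 M2 k) (\<lambda>b. b $ 0)"
    and \<theta>0: "(\<beta>, 1\<^sub>m p, \<sigma>) \<in> Theta p M1 M2 k1" and k: "k1 + 1 \<le> k"
    and n: "0 < n" and p: "0 < p" and M1: "1 < M1" and \<eta>: "0 < \<eta>"
    and \<tau>: "0 < \<tau>" "\<tau>\<^sup>2 \<le> 1 / 2" "2 * \<tau>\<^sup>2 \<le> ln (1 + \<eta>\<^sup>2)"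
  shows "ennreal (\<sigma> * (\<tau> / sqrt n) * (1 - 2 * \<alpha> - \<eta>)) \<le> expected_length n p (\<beta>, 1\<^sub>m p, \<sigma>) CI"
proof -
  have \<beta>: "\<beta> \<in> carrier_vec p" and \<sigma>: "0 < \<sigma>" and l0: "l0_norm \<beta> \<le> k1"
    and \<theta>0k: "(\<beta>, 1\<^sub>m p, \<sigma>) \<in> Theta p M1 M2 k"
    using \<theta>0 k by (auto simp: Theta_def)
  define \<rho> where "\<rho> = \<tau> / sqrt n"
  have \<rho>2: "\<rho>\<^sup>2 = \<tau>\<^sup>2 / n" by (simp add: \<rho>_def power_divide)
  have \<rho>le: "\<rho>\<^sup>2 \<le> 1 / 2"
  proof -
    have "\<tau>\<^sup>2 / n \<le> \<tau>\<^sup>2 / 1" using n by (intro divide_left_mono) auto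
    then show ?thesis unfolding \<rho>2 using \<tau>(2) by linarith
  qed
  interpret spiked_alternative p \<beta> \<sigma> 1 0 \<rho>
    by standard (use p \<beta> \<sigma> in auto)
  have "ennreal (\<bar>\<sigma> * \<rho>\<bar> * (1 - 2 * \<alpha> - \<eta>)) \<le> expected_length n p (\<beta>, 1\<^sub>m p, \<sigma>) CI"
  proof (rule expected_length_ge_of_alternatives[OF CI \<theta>0k _ _ M1, where F = "{()}" and S = "\<lambda>_. {0}"])
    show "admissible {0}" using p \<rho>le by (simp add: admissible_def)
    show "l0_norm \<beta> + card (insert 0 {0::nat}) \<le> k" using l0 k by simp
    show "alt_coef p \<beta> \<sigma> 1 0 \<rho> {0} $ 0 = \<beta> $ 0 + \<sigma> * \<rho>"
      using p by (simp add: alt_coef_def)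
    have "(1 / (1 - \<rho>\<^sup>2)) ^ n \<le> exp (2 * \<rho>\<^sup>2) ^ n"
      using \<rho>le inverse_one_minus_le_exp[of "\<rho>\<^sup>2"] by (intro power_mono) auto
    also have "\<dots> = exp (2 * \<tau>\<^sup>2)" using n by (simp add: exp_of_nat_mult[symmetric] \<rho>2)
    also have "\<dots> \<le> 1 + \<eta>\<^sup>2"
      using \<tau>(3) by (simp add: ln_ge_iff add_pos_nonneg)
    finally show "(\<Sum>f\<in>{()}. \<Sum>g\<in>{()}. (1 / (1 - \<rho>\<^sup>2 * card ({0::nat} \<inter> {0}))) ^ n) \<le> (real (card {()}))\<^sup>2 * (1 + \<eta>\<^sup>2)"
      by simp
  qed (use \<eta> in auto)
  then show ?thesis using \<sigma> \<tau>(1) by (simp add: \<rho>_def)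
qed

text \<open>
  The supports \<open>S f\<close> pick one covariate from each of \<open>s\<close> blocks of size \<open>m\<close>, none of them in the support
  of \<open>\<beta>\<close> and none equal to \<open>0\<close>.  All have size \<open>s\<close>, so that all alternatives shift \<open>\<beta>\<^sub>1\<close> by the same
  amount \<open>- \<delta>\<close>.
\<close>

lemma expected_length_ge_sparse:
  fixes s m n p k k1 :: nat and \<rho> \<eta> :: real
  assumes CI: "CI \<in> conf_intervals n p \<alpha> (Theta p M1 M2 k) (\<lambda>b. b $ 0)"
    and \<theta>0: "(\<beta>, 1\<^sub>m p, \<sigma>) \<in> Theta p M1 M2 k1" and k: "k1 + s + 1 \<le> k"
    and p: "0 < p" and M1: "1 < M1" and \<eta>: "0 < \<eta>" "0 \<le> 1 - 2 * \<alpha> - \<eta>"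
    and s: "0 < s" and m: "0 < m" and sm: "s * m + k1 + 1 \<le> p"
    and r: "\<rho>\<^sup>2 * s \<le> 1 / 2" "\<rho>\<^sup>2 * s \<le> (1 - 1 / M1)\<^sup>2"
    and chi: "s * exp (2 * n * \<rho>\<^sup>2) / m \<le> ln (1 + \<eta>\<^sup>2)"
  shows "ennreal (\<sigma> * (\<rho>\<^sup>2 * s / 2) * (1 - 2 * \<alpha> - \<eta>)) \<le> expected_length n p (\<beta>, 1\<^sub>m p, \<sigma>) CI"
proof -
  have \<beta>: "\<beta> \<in> carrier_vec p" and \<sigma>: "0 < \<sigma>" and l0: "l0_norm \<beta> \<le> k1"
    and \<theta>0k: "(\<beta>, 1\<^sub>m p, \<sigma>) \<in> Theta p M1 M2 k"
    using \<theta>0 k by (auto simp: Theta_def)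
  define A where "A = {1..<p} - {i. i < p \<and> \<beta> $ i \<noteq> 0}"
  have "p - 1 - k1 \<le> card A"
  proof -
    have "card {i. i < p \<and> \<beta> $ i \<noteq> 0} \<le> k1" using l0 \<beta> by (simp add: l0_norm_def)
    moreover have "card {1..<p} - card {i. i < p \<and> \<beta> $ i \<noteq> 0} \<le> card A"
      unfolding A_def by (rule diff_card_le_card_Diff) simp
    ultimately show ?thesis by simp
  qed
  then have "card ({..<s} \<times> {..<m}) \<le> card A" using sm by simp
  moreover have "finite A" by (simp add: A_def)
  \<comment> \<open>\<open>\<phi> (i, j)\<close> is the \<open>j\<close>-th covariate of block \<open>i\<close>.\<close>
  ultimately obtain \<phi> where \<phi>A: "\<phi> ` ({..<s} \<times> {..<m}) \<subseteq> A" and \<phi>: "inj_on \<phi> ({..<s} \<times> {..<m})"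
    using card_le_inj[of "{..<s} \<times> {..<m}" A] by (auto simp del: card_cartesian_product)
  define F where "F = {..<s} \<rightarrow>\<^sub>E {..<m}"
  define S where "S f = (\<lambda>i. \<phi> (i, f i)) ` {..<s}" for f
  have F: "finite F" "F \<noteq> {}" "real (card F) = real m ^ s"
    using m by (auto simp: F_def finite_PiE card_PiE PiE_eq_empty_iff)
  have \<phi>_eq: "\<phi> (i, f i) = \<phi> (j, g j) \<longleftrightarrow> i = j \<and> f i = g j" if "f \<in> F" "g \<in> F" "i < s" "j < s" for f g i j
    using that inj_on_eq_iff[OF \<phi>, of "(i, f i)" "(j, g j)"] by (auto simp: F_def)
  have SA: "S f \<subseteq> A" if "f \<in> F" for f
    using \<phi>A that by (auto simp: S_def F_def image_subset_iff)
  have cardS: "card (S f) = s" if "f \<in> F" for f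
    unfolding S_def using \<phi>_eq[OF that that] by (subst card_image) (auto simp: inj_on_def)
  have cardI: "card (S f \<inter> S g) = card {i. i < s \<and> f i = g i}" if "f \<in> F" "g \<in> F" for f g
  proof -
    have "S f \<inter> S g = (\<lambda>i. \<phi> (i, f i)) ` {i. i < s \<and> f i = g i}" (is "_ = ?R")
    proof (intro equalityI subsetI)
      fix y assume "y \<in> S f \<inter> S g"
      then obtain i j where "i < s" "j < s" "y = \<phi> (i, f i)" "y = \<phi> (j, g j)" by (auto simp: S_def)
      moreover from this have "i = j \<and> f i = g j" using \<phi>_eq[OF that, of i j] by auto
      ultimately show "y \<in> ?R" by blast
    next
      fix y assume "y \<in> ?R"
      then obtain i where i: "i < s" "f i = g i" "y = \<phi> (i, f i)" by blast
      then have "y = \<phi> (i, g i)" by simp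
      then show "y \<in> S f \<inter> S g" using i(1,3) unfolding S_def by blast
    qed
    moreover have "inj_on (\<lambda>i. \<phi> (i, f i)) {i. i < s \<and> f i = g i}"
      using \<phi>_eq[OF that(1) that(1)] by (intro inj_onI) blast
    ultimately show ?thesis by (simp only: card_image)
  qed
  define w where "w = 1 / sqrt (2::real)"
  have w2: "w\<^sup>2 = 1 / 2" by (simp add: w_def power_divide)
  interpret spiked_alternative p \<beta> \<sigma> w w \<rho>
    by standard (use p \<beta> \<sigma> w2 in auto)
  define R where "R = \<rho>\<^sup>2 * s"
  have R: "0 \<le> R" "R \<le> 1 / 2" using r by (simp_all add: R_def)
  define \<delta> where "\<delta> = \<sigma> * (R / 2 / (1 - R / 2))"
  have shift: "alt_coef p \<beta> \<sigma> w w \<rho> (S f) $ 0 = \<beta> $ 0 - \<delta>" if "f \<in> F" for f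
  proof -
    have "0 \<notin> S f" using SA[OF that] by (auto simp: A_def)
    then have "alt_coef p \<beta> \<sigma> w w \<rho> (S f) $ 0 = \<beta> $ 0 - \<sigma> * (w\<^sup>2 * R / (1 - w\<^sup>2 * R))"
      using p by (simp add: alt_coef_def cardS[OF that] R_def power2_eq_square)
    then show ?thesis unfolding w2 by (simp add: \<delta>_def)
  qed
  have \<delta>: "\<sigma> * (R / 2) \<le> \<delta>"
  proof -
    have "R / 2 / 1 \<le> R / 2 / (1 - R / 2)" using R by (intro divide_left_mono) auto
    then show ?thesis unfolding \<delta>_def using \<sigma> by (intro mult_left_mono) auto
  qed
  have \<delta>0: "0 \<le> \<delta>" using \<delta> R \<sigma> by (smt (verit) divide_nonneg_pos mult_nonneg_nonneg)
  have "ennreal (\<bar>- \<delta>\<bar> * (1 - 2 * \<alpha> - \<eta>)) \<le> expected_length n p (\<beta>, 1\<^sub>m p, \<sigma>) CI"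
  proof (rule expected_length_ge_of_alternatives[OF CI \<theta>0k F(1,2) M1, where S = S])
    fix f assume f: "f \<in> F"
    show "admissible (S f)"
      using SA[OF f] R by (auto simp: admissible_def cardS[OF f] A_def R_def)
    show "w\<^sup>2 * (\<rho>\<^sup>2 * card (S f)) \<le> (1 - 1 / M1)\<^sup>2"
      using r(2) R unfolding w2 cardS[OF f] R_def by linarith
    show "l0_norm \<beta> + card (insert 0 (S f)) \<le> k"
      using l0 k cardS[OF f] card_insert_le_m1[of "Suc s" "S f" 0] by simp
    show "alt_coef p \<beta> \<sigma> w w \<rho> (S f) $ 0 = \<beta> $ 0 + - \<delta>" using shift[OF f] by simp
  next
    define B where "B = exp (2 * n * \<rho>\<^sup>2)"
    have B: "1 \<le> B" by (simp add: B_def)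
    have "(\<Sum>f\<in>F. \<Sum>g\<in>F. (1 / (1 - \<rho>\<^sup>2 * card (S f \<inter> S g))) ^ n)
        \<le> (\<Sum>f\<in>F. \<Sum>g\<in>F. B ^ card {i. i < s \<and> f i = g i})"
    proof (intro sum_mono)
      fix f g assume fg: "f \<in> F" "g \<in> F"
      define j where "j = card {i. i < s \<and> f i = g i}"
      have "j \<le> s" unfolding j_def using card_mono[of "{..<s}" "{i. i < s \<and> f i = g i}"] by auto
      then have "\<rho>\<^sup>2 * j \<le> R" unfolding R_def by (intro mult_left_mono) auto
      then have "(1 / (1 - \<rho>\<^sup>2 * j)) ^ n \<le> exp (2 * (\<rho>\<^sup>2 * j)) ^ n"
        using R by (intro power_mono inverse_one_minus_le_exp) auto
      also have "\<dots> = B ^ j"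
        by (simp add: B_def exp_of_nat_mult[symmetric] ac_simps)
      finally show "(1 / (1 - \<rho>\<^sup>2 * card (S f \<inter> S g))) ^ n \<le> B ^ card {i. i < s \<and> f i = g i}"
        unfolding cardI[OF fg] j_def .
    qed
    also have "\<dots> = (real m * (B + (real m - 1))) ^ s"
      unfolding F_def by (rule sum_power_agreements)
    also have "\<dots> = (real (card F))\<^sup>2 * (1 + (B - 1) / m) ^ s"
    proof -
      have "B + (real m - 1) = real m * (1 + (B - 1) / m)"
        using m by (simp add: field_simps)
      then show ?thesis by (simp only: F(3) power_mult_distrib power2_eq_square mult.assoc)
    qed
    also have "\<dots> \<le> (real (card F))\<^sup>2 * exp ((B - 1) / m) ^ s"
      using B m by (intro mult_left_mono power_mono exp_ge_add_one_self) auto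
    also have "\<dots> \<le> (real (card F))\<^sup>2 * (1 + \<eta>\<^sup>2)"
    proof (intro mult_left_mono)
      have "s * ((B - 1) / m) \<le> s * B / m" using m by (simp add: field_simps)
      then have "s * ((B - 1) / m) \<le> ln (1 + \<eta>\<^sup>2)" using chi by (simp add: B_def)
      then show "exp ((B - 1) / m) ^ s \<le> 1 + \<eta>\<^sup>2"
        by (simp add: exp_of_nat_mult[symmetric] ln_ge_iff add_pos_nonneg)
    qed simp
    finally show "(\<Sum>f\<in>F. \<Sum>g\<in>F. (1 / (1 - \<rho>\<^sup>2 * card (S f \<inter> S g))) ^ n) \<le> (real (card F))\<^sup>2 * (1 + \<eta>\<^sup>2)" .
  qed (rule \<eta>(1))
  moreover have "ennreal (\<sigma> * (R / 2) * (1 - 2 * \<alpha> - \<eta>)) \<le> ennreal (\<delta> * (1 - 2 * \<alpha> - \<eta>))"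
    using \<delta> \<eta> by (intro ennreal_leI mult_right_mono) auto
  ultimately show ?thesis using \<delta>0 by (simp add: R_def)
qed

text \<open>
  The exponents are \<open>\<gamma> - 1\<close> and \<open>\<gamma> - 1/2\<close>, both negative; here \<open>\<gamma> < 1/2\<close> enters.
\<close>

lemma eventually_dimension_large:
  fixes c \<gamma> \<epsilon> :: real
  assumes "0 < c" "\<gamma> < 1 / 2" "0 < \<epsilon>"
  shows "\<exists>p0. \<forall>p\<ge>p0. 2 \<le> p \<longrightarrow> c * real p powr \<gamma> \<le> real p / 4
    \<and> 2 * c\<^sup>2 * real p powr (\<gamma> - 1 / 2) \<le> \<epsilon>"
proof -
  have "((\<lambda>p::nat. c * real p powr (\<gamma> - 1)) \<longlongrightarrow> c * 0) sequentially"
    using assms by (intro tendsto_mult tendsto_const tendsto_neg_powr filterlim_real_sequentially) auto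
  then have "\<forall>\<^sub>F p in sequentially. c * real p powr (\<gamma> - 1) < 1 / 4"
    by (rule order_tendstoD) simp
  moreover have "((\<lambda>p::nat. 2 * c\<^sup>2 * real p powr (\<gamma> - 1 / 2)) \<longlongrightarrow> 2 * c\<^sup>2 * 0) sequentially"
    using assms by (intro tendsto_mult tendsto_const tendsto_neg_powr filterlim_real_sequentially) auto
  then have "\<forall>\<^sub>F p in sequentially. 2 * c\<^sup>2 * real p powr (\<gamma> - 1 / 2) < \<epsilon>"
    by (rule order_tendstoD) (use assms in simp)
  ultimately have "\<forall>\<^sub>F p in sequentially. 2 \<le> p \<longrightarrow> c * real p powr \<gamma> \<le> real p / 4
      \<and> 2 * c\<^sup>2 * real p powr (\<gamma> - 1 / 2) \<le> \<epsilon>"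
  proof eventually_elim
    case (elim p)
    have "c * real p powr \<gamma> \<le> real p / 4" if "2 \<le> p"
      using elim(1) that by (simp add: powr_diff field_simps)
    then show ?case using elim(2) by simp
  qed
  then show ?thesis by (simp add: eventually_sequentially)
qed

theorem corollary1:
  fixes \<alpha> M1 M2 c \<gamma> \<zeta>0 :: real
  assumes "0 < \<alpha>" and "\<alpha> < 1 / 2"
    and "1 < M1" and "0 < M2"
    and "0 < c" and "0 \<le> \<gamma>" and "\<gamma> < 1 / 2"
    and "0 < \<zeta>0" and "\<zeta>0 < 1"
  shows "\<exists>c1>0. \<forall>(n::nat) (p::nat) (k::nat) (k1::nat) (\<beta>::real Matrix.vec) (\<sigma>::real).
    1 \<le> n \<longrightarrow> 2 \<le> p \<longrightarrow>
    real k \<le> c * min (real p powr \<gamma>) (real n / ln (real p)) \<longrightarrow>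
    real k1 \<le> (1 - \<zeta>0) * real k - 1 \<longrightarrow>
    (\<beta>, 1\<^sub>m p, \<sigma>) \<in> Theta p M1 M2 k1 \<longrightarrow>
    (INF CI \<in> conf_intervals n p \<alpha> (Theta p M1 M2 k) (\<lambda>b. b $ 0).
        expected_length n p (\<beta>, 1\<^sub>m p, \<sigma>) CI)
      \<ge> ennreal (c1 * (1 / sqrt (real n) + real k * (ln (real p) / real n)) * \<sigma>)"
proof -
  define \<eta> where "\<eta> = (1 - 2 * \<alpha>) / 2"
  have \<eta>: "0 < \<eta>" "1 - 2 * \<alpha> - \<eta> = \<eta>" using assms by (auto simp: \<eta>_def field_simps)
  have ln\<eta>: "0 < ln (1 + \<eta>\<^sup>2)" using \<eta> by (intro ln_gt_zero) simp
  \<comment> \<open>\<open>\<tau>\<close> and \<open>a\<close> are small enough for the hypotheses of the two lower bounds; \<open>\<rho>\<^sup>2\<close> will be \<open>a log p / n\<close>.\<close>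
  define \<tau> where "\<tau> = sqrt (min (1 / 2) (ln (1 + \<eta>\<^sup>2) / 2))"
  have \<tau>: "0 < \<tau>" "\<tau>\<^sup>2 \<le> 1 / 2" "2 * \<tau>\<^sup>2 \<le> ln (1 + \<eta>\<^sup>2)" using ln\<eta> by (auto simp: \<tau>_def)
  define a where "a = min ((1 / 2 - \<gamma>) / 2) (min (1 / (2 * c)) ((1 - 1 / M1)\<^sup>2 / c))"
  have a: "0 < a" "a \<le> (1 / 2 - \<gamma>) / 2" "a * c \<le> 1 / 2" "a * c \<le> (1 - 1 / M1)\<^sup>2"
  proof -
    have "a \<le> 1 / (2 * c)" "a \<le> (1 - 1 / M1)\<^sup>2 / c" by (auto simp: a_def)
    then show "a * c \<le> 1 / 2" "a * c \<le> (1 - 1 / M1)\<^sup>2" using assms by (simp_all add: field_simps)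
    show "0 < a" using assms by (auto simp: a_def)
    show "a \<le> (1 / 2 - \<gamma>) / 2" unfolding a_def by (rule min.cobounded1)
  qed
  obtain p0 where p0: "\<And>p. p0 \<le> p \<Longrightarrow> 2 \<le> p \<Longrightarrow> c * real p powr \<gamma> \<le> real p / 4
      \<and> 2 * c\<^sup>2 * real p powr (\<gamma> - 1 / 2) \<le> ln (1 + \<eta>\<^sup>2)"
    using eventually_dimension_large[OF \<open>0 < c\<close> \<open>\<gamma> < 1 / 2\<close> ln\<eta>] by blast
  \<comment> \<open>For \<open>p < p0\<close> the sparse term is at most \<open>K / sqrt n\<close>.\<close>
  define K where "K = c * (real p0)\<^sup>2"
  have K: "0 \<le> K" using assms by (simp add: K_def)
  define c1 where "c1 = min (\<eta> * \<tau> / (2 * (1 + K))) (\<eta> * \<zeta>0 * a / 4)"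
  have c1: "0 < c1" "c1 \<le> \<eta> * \<tau> / (2 * (1 + K))" "c1 \<le> \<eta> * \<zeta>0 * a / 4"
    unfolding c1_def using \<eta> \<tau> a K assms by (simp, intro min.cobounded1, intro min.cobounded2)
  have main: "ennreal (c1 * (1 / sqrt (real n) + real k * (ln (real p) / real n)) * \<sigma>) \<le> expected_length n p (\<beta>, 1\<^sub>m p, \<sigma>) CI"
    if n: "1 \<le> n" and p: "2 \<le> p" and k: "real k \<le> c * min (real p powr \<gamma>) (real n / ln (real p))"
      and k1: "real k1 \<le> (1 - \<zeta>0) * real k - 1" and \<theta>: "(\<beta>, 1\<^sub>m p, \<sigma>) \<in> Theta p M1 M2 k1"
      and CI: "CI \<in> conf_intervals n p \<alpha> (Theta p M1 M2 k) (\<lambda>b. b $ 0)"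
    for n p k k1 :: nat and \<beta> \<sigma> CI
  proof -
    have \<sigma>: "0 < \<sigma>" using \<theta> by (simp add: Theta_def)
    have lnp: "0 < ln (real p)" using p by simp
    have "c * min (real p powr \<gamma>) (real n / ln (real p)) \<le> c * real p powr \<gamma>"
      "c * min (real p powr \<gamma>) (real n / ln (real p)) \<le> c * (real n / ln (real p))"
      using assms by (auto intro!: mult_left_mono simp del: times_divide_eq_right)
    then have kp: "real k \<le> c * real p powr \<gamma>" and kn: "real k \<le> c * (real n / ln (real p))"
      using k by linarith+
    have "\<zeta>0 * real k + real k1 + 1 \<le> real k" using k1 by (simp add: algebra_simps)
    moreover have "0 \<le> \<zeta>0 * real k" using assms by simp
    ultimately have kk: "k1 + 1 \<le> k" by linarith
    define s where "s = k - k1 - 1"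
    have s: "k1 + s + 1 = k" "\<zeta>0 * real k \<le> real s"
      using kk \<open>\<zeta>0 * real k + real k1 + 1 \<le> real k\<close> by (simp_all add: s_def of_nat_diff)
    have "0 < \<zeta>0 * real k" using kk assms by simp
    then have s0: "0 < s" using s(2) by linarith
    define E1 where "E1 = \<sigma> * (\<tau> / sqrt n) * \<eta>"
    have E1: "ennreal E1 \<le> expected_length n p (\<beta>, 1\<^sub>m p, \<sigma>) CI"
      using expected_length_ge_parametric[OF CI \<theta> kk _ _ \<open>1 < M1\<close> \<eta>(1) \<tau>] n p by (simp add: \<eta>(2) E1_def)
    have sqn: "0 < sqrt (real n)" "1 / real n \<le> 1 / sqrt (real n)"
    proof -
      show "0 < sqrt (real n)" using n by simp
      have "sqrt (real n) \<le> real n" using n by (simp add: sqrt_le_D real_le_lsqrt power2_eq_square)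
      then show "1 / real n \<le> 1 / sqrt (real n)" using n by (intro divide_left_mono) auto
    qed
    show ?thesis
    proof (cases "p0 \<le> p")
      case False
      have "real k * ln (real p) \<le> K"
      proof -
        have "real p powr \<gamma> \<le> real p powr 1" using p assms by (intro powr_mono) auto
        then have "c * real p powr \<gamma> \<le> c * real p0" using p False assms by (intro mult_left_mono) auto
        moreover have "ln (real p) \<le> real p0" using ln_le_minus_one[of "real p"] p False by linarith
        ultimately have "real k * ln (real p) \<le> (c * real p0) * real p0"
          using kp lnp assms by (intro mult_mono) linarith+
        then show ?thesis by (simp add: K_def power2_eq_square)
      qed
      then have "real k * ln (real p) * (1 / real n) \<le> K * (1 / sqrt (real n))"
        using sqn K by (intro mult_mono) auto
      then have "1 / sqrt (real n) + real k * (ln (real p) / real n) \<le> (1 + K) * (1 / sqrt (real n))"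
        by (simp add: algebra_simps add_divide_distrib)
      then have "c1 * (1 / sqrt (real n) + real k * (ln (real p) / real n)) \<le> \<eta> * \<tau> / (2 * (1 + K)) * ((1 + K) * (1 / sqrt (real n)))"
        using c1 lnp by (intro mult_mono) auto
      also have "\<dots> = \<eta> * \<tau> * (1 / sqrt (real n)) / 2"
      proof -
        have cancel: "a / (2 * b) * (b * x) = a * x / 2" if "b \<noteq> 0" for a b x :: real using that by simp
        show ?thesis by (rule cancel) (use K in linarith)
      qed
      also have "\<dots> \<le> \<eta> * \<tau> * (1 / sqrt (real n))"
      proof -
        have half: "x / 2 \<le> x" if "0 \<le> x" for x :: real using that by simp
        show ?thesis by (rule half) (use \<eta> \<tau> in simp)
      qed
      finally have "c1 * (1 / sqrt (real n) + real k * (ln (real p) / real n)) * \<sigma> \<le> \<eta> * \<tau> * (1 / sqrt (real n)) * \<sigma>"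
        using \<sigma> by (intro mult_right_mono) auto
      then have "c1 * (1 / sqrt (real n) + real k * (ln (real p) / real n)) * \<sigma> \<le> E1"
        by (simp add: E1_def ac_simps)
      then show ?thesis using E1 by (meson ennreal_leI order_trans)
    next
      case True
      note pl = p0[OF True p]
      define \<rho> where "\<rho> = sqrt (a * ln (real p) / real n)"
      have \<rho>2: "\<rho>\<^sup>2 = a * ln (real p) / real n" using a lnp by (simp add: \<rho>_def)
      have sk: "real s \<le> real k" using s(1) by simp
      have R: "\<rho>\<^sup>2 * s \<le> a * c"
      proof -
        have "real s * ln (real p) \<le> real k * ln (real p)" using sk lnp by (intro mult_right_mono) auto
        also have "\<dots> \<le> c * (real n / ln (real p)) * ln (real p)" using kn lnp by (intro mult_right_mono) auto
        also have "\<dots> = c * real n" using lnp by simp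
        finally have "a * (real s * ln (real p)) \<le> a * (c * real n)" using a by (intro mult_left_mono) auto
        then show ?thesis using n by (simp add: \<rho>2 field_simps)
      qed
      \<comment> \<open>There are at least \<open>p - 1 - k1\<close> free covariates, shared out evenly among \<open>s\<close> blocks.\<close>
      define m where "m = (p - 1 - k1) div s"
      have ml: "real p / (2 * real s) \<le> real m"
      proof -
        have kp4: "real k \<le> real p / 4" using kp pl by linarith
        have "p - 1 - k1 < s + m * s"
          unfolding m_def by (rule dividend_less_div_times[OF s0])
        then have "real (p - 1 - k1) \<le> real (s + m * s)"
          by (intro of_nat_mono) simp
        then have "real (p - 1 - k1) \<le> real s * (real m + 1)"
          by (simp add: algebra_simps)
        moreover have "real (p - 1 - k1) \<ge> real p - real k" using s(1) by linarith
        ultimately have "real p - real k - real s \<le> real s * real m" by (simp add: algebra_simps)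
        then have "real p / 2 \<le> real s * real m" using kp4 sk by linarith
        then show ?thesis using s0 by (simp add: field_simps)
      qed
      have m0: "0 < m"
      proof -
        have "0 < real p / (2 * real s)" using p s0 by simp
        then show ?thesis using ml by linarith
      qed
      have sm: "s * m + k1 + 1 \<le> p"
      proof -
        have "k1 + 1 \<le> p"
        proof -
          have "real k \<le> real p / 4" using kp pl by linarith
          then show ?thesis using kk by linarith
        qed
        moreover have "s * m \<le> p - 1 - k1" unfolding m_def by simp
        ultimately show ?thesis by linarith
      qed
      have chi: "s * exp (2 * n * \<rho>\<^sup>2) / m \<le> ln (1 + \<eta>\<^sup>2)"
      proof -
        have "exp (2 * n * \<rho>\<^sup>2) = real p powr (2 * a)"
          using n p by (simp add: \<rho>2 powr_def ac_simps)
        also have "\<dots> \<le> real p powr (1 / 2 - \<gamma>)" using p a by (intro powr_mono) auto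
        finally have e: "exp (2 * n * \<rho>\<^sup>2) \<le> real p powr (1 / 2 - \<gamma>)" .
        have "s * exp (2 * n * \<rho>\<^sup>2) / m \<le> s * real p powr (1 / 2 - \<gamma>) / (real p / (2 * real s))"
          using e ml p s0 by (intro frac_le mult_left_mono) auto
        also have "\<dots> = 2 * (real s)\<^sup>2 * (real p powr (1 / 2 - \<gamma>) / real p)"
          by (simp add: power2_eq_square)
        also have "\<dots> \<le> 2 * (c * real p powr \<gamma>)\<^sup>2 * (real p powr (1 / 2 - \<gamma>) / real p)"
          using sk kp by (intro mult_right_mono mult_left_mono power_mono) auto
        also have "\<dots> = 2 * c\<^sup>2 * real p powr (\<gamma> - 1 / 2)"
        proof -
          have "(real p powr \<gamma>)\<^sup>2 = real p powr (\<gamma> + \<gamma>)"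
            by (simp only: power2_eq_square powr_add)
          moreover have "real p powr (1 / 2 - \<gamma>) / real p = real p powr (1 / 2 - \<gamma> - 1)"
            using p powr_diff[of "real p" "1 / 2 - \<gamma>" 1] by simp
          ultimately have "(real p powr \<gamma>)\<^sup>2 * (real p powr (1 / 2 - \<gamma>) / real p) = real p powr (\<gamma> - 1 / 2)"
            by (simp add: powr_add[symmetric])
          moreover have "2 * (c * x)\<^sup>2 * y = 2 * c\<^sup>2 * (x\<^sup>2 * y)" for x y :: real
            by (simp add: power_mult_distrib)
          ultimately show ?thesis by (simp only:)
        qed
        also have "\<dots> \<le> ln (1 + \<eta>\<^sup>2)" using pl by simp
        finally show ?thesis .
      qed
      define E2 where "E2 = \<sigma> * (\<rho>\<^sup>2 * s / 2) * \<eta>"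
      have E2: "ennreal E2 \<le> expected_length n p (\<beta>, 1\<^sub>m p, \<sigma>) CI"
      proof -
        have "k1 + s + 1 \<le> k" "0 < p" "0 \<le> 1 - 2 * \<alpha> - \<eta>" "\<rho>\<^sup>2 * s \<le> 1 / 2" "\<rho>\<^sup>2 * s \<le> (1 - 1 / M1)\<^sup>2"
          using s(1) p \<eta> R a by linarith+
        from expected_length_ge_sparse[OF CI \<theta> this(1,2) \<open>1 < M1\<close> \<eta>(1) this(3) s0 m0 sm this(4,5) chi]
        show ?thesis by (simp only: E2_def \<eta>(2))
      qed
      have "c1 * (1 / sqrt (real n)) * \<sigma> \<le> E1 / 2"
      proof -
        have "c1 \<le> \<eta> * \<tau> / 2"
        proof -
          have "\<eta> * \<tau> / (2 * (1 + K)) \<le> \<eta> * \<tau> / 2" using \<eta> \<tau> K by (intro divide_left_mono) auto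
          with c1(2) show ?thesis by (rule order_trans)
        qed
        then have "c1 * (1 / sqrt (real n) * \<sigma>) \<le> \<eta> * \<tau> / 2 * (1 / sqrt (real n) * \<sigma>)"
          using \<sigma> sqn by (intro mult_right_mono) auto
        then show ?thesis by (simp add: E1_def ac_simps)
      qed
      moreover have "c1 * (real k * (ln (real p) / real n)) * \<sigma> \<le> E2 / 2"
      proof -
        have "c1 * (real k * (ln (real p) / real n)) * \<sigma> \<le> \<eta> * \<zeta>0 * a / 4 * (real k * (ln (real p) / real n)) * \<sigma>"
          using c1 \<sigma> lnp by (intro mult_right_mono) auto
        also have "\<dots> = (\<zeta>0 * real k) * (\<eta> * (a * (ln (real p) / real n)) * \<sigma> / 4)" by (simp add: ac_simps)
        also have "\<dots> \<le> real s * (\<eta> * (a * (ln (real p) / real n)) * \<sigma> / 4)"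
          using s(2) \<eta> a \<sigma> lnp by (intro mult_right_mono) auto
        also have "\<dots> = E2 / 2" by (simp add: E2_def \<rho>2 ac_simps)
        finally show ?thesis .
      qed
      ultimately have "c1 * (1 / sqrt (real n) + real k * (ln (real p) / real n)) * \<sigma> \<le> E1 / 2 + E2 / 2"
        by (simp only: distrib_left distrib_right add_mono)
      also have "\<dots> \<le> max E1 E2" by simp
      finally have "ennreal (c1 * (1 / sqrt (real n) + real k * (ln (real p) / real n)) * \<sigma>) \<le> ennreal (max E1 E2)"
        by (rule ennreal_leI)
      also have "\<dots> \<le> expected_length n p (\<beta>, 1\<^sub>m p, \<sigma>) CI"
        using E1 E2 by (simp add: max_def)
      finally show ?thesis .
    qed
  qed
  show ?thesis
    using c1(1) main by (intro exI[of _ c1]) (auto intro!: INF_greatest)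
qed

end
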